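(* Let $G$ be a group. The sequence $$\cdots\overset{\partial_2}{\to}P_1\overset{\partial_1}{\to}P_0\overset{\partial_0}{\to}B\to0$$ is a projective resolution of $B$ in the category of left $K_{\mathrm{par}}(G)$-modules.
   Context: $K$ is a commutative unital ring. $\mathcal S(G)$ is the monoid generated by symbols $[g]$, $g\in G$, with relations $[g^{-1}][g][h]=[g^{-1}][gh]$, $[g][h][h^{-1}]=[gh][h^{-1}]$, $[g][1_G]=[g]$ (so $[1_G]$ is the identity). It is an inverse monoid; $s^{-1}$ denotes the inverse of $s$ and $E(\mathcal S(G))$ the semilattice of idempotents, ordered by $e\le f\iff ef=e$. $e_g=[g][g^{-1}]$ and $e_{(g_1,\dots,g_n)}=e_{g_1}e_{g_1g_2}\cdots e_{g_1\cdots g_n}$. $K_{\mathrm{par}}(G)=K\mathcal S(G)$ is the semigroup algebra. $B=KE(\mathcal S(G))$ is the left $K_{\mathrm{par}}(G)$-module with $s\cdot e=ses^{-1}$ for $s\in\mathcal S(G)$, $e\in E(\mathcal S(G))$. $P_0=K_{\mathrm{par}}(G)$ and $P_n=\bigoplus_{g_1,\dots,g_n\in G}K_{\mathrm{par}}(G)e_{(g_1,\dots,g_n)}$ for $n\ge1$. For $n\ge1$, $s(g_1,\dots,g_n)$ denotes the element $se_{(g_1,\dots,g_n)}$ of the summand indexed by $(g_1,\dots,g_n)$; the elements $s(g_1,\dots,g_n)$ with $s\in\mathcal S(G)$, $g_i\in G$ and $s^{-1}s\le e_{(g_1,\dots,g_n)}$ form a $K$-basis of $P_n$. The element $s\in P_0$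 is written $s(\ )$. The maps $\partial_n$ are the $K$-linear maps given on these basis elements by $\partial_0(s(\ ))=ss^{-1}$; $\partial_1(s(g))=s([g](\ )-(\ ))$; and for $n\ge2$ $$\partial_n(s(g_1,\dots,g_n))=s\Big([g_1](g_2,\dots,g_n)+\sum_{i=1}^{n-1}(-1)^i(g_1,\dots,g_ig_{i+1},\dots,g_n)+(-1)^n(g_1,\dots,g_{n-1})\Big),$$ where $s\cdot[g_1](g_2,\dots,g_n)$ means $(s[g_1])(g_2,\dots,g_n)$, etc. *)

theory Defs
  imports "HOL-Algebra.Module" "HOL-Algebra.AbelCoset"
begin

section \<open>Left modules over a ring, and projective resolutions\<close>

text \<open>
  The library locale \<^locale>\<open>module\<close> requires a commutative ring of scalars, which a semigroup
  algebra is not. We keep its record type; the fields for multiplication and unit are unused.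
\<close>

locale left_module = R?: ring R + M?: abelian_group M
  for R :: "('a, 'c) ring_scheme" (structure)
    and M :: "('a, 'b, 'd) module_scheme" (structure) +
  assumes smult_closed:
      "\<lbrakk>a \<in> carrier R; x \<in> carrier M\<rbrakk> \<Longrightarrow> a \<odot>\<^bsub>M\<^esub> x \<in> carrier M"
    and smult_l_distr:
      "\<lbrakk>a \<in> carrier R; b \<in> carrier R; x \<in> carrier M\<rbrakk> \<Longrightarrow>
        (a \<oplus> b) \<odot>\<^bsub>M\<^esub> x = a \<odot>\<^bsub>M\<^esub> x \<oplus>\<^bsub>M\<^esub> b \<odot>\<^bsub>M\<^esub> x"
    and smult_r_distr:
      "\<lbrakk>a \<in> carrier R; x \<in> carrier M; y \<in> carrier M\<rbrakk> \<Longrightarrow>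
        a \<odot>\<^bsub>M\<^esub> (x \<oplus>\<^bsub>M\<^esub> y) = a \<odot>\<^bsub>M\<^esub> x \<oplus>\<^bsub>M\<^esub> a \<odot>\<^bsub>M\<^esub> y"
    and smult_assoc:
      "\<lbrakk>a \<in> carrier R; b \<in> carrier R; x \<in> carrier M\<rbrakk> \<Longrightarrow>
        (a \<otimes> b) \<odot>\<^bsub>M\<^esub> x = a \<odot>\<^bsub>M\<^esub> (b \<odot>\<^bsub>M\<^esub> x)"
    and smult_one:
      "x \<in> carrier M \<Longrightarrow> \<one> \<odot>\<^bsub>M\<^esub> x = x"

definition left_module_hom ::
  "('a, 'c) ring_scheme \<Rightarrow> ('a, 'm, 'd) module_scheme \<Rightarrow> ('a, 'n, 'e) module_scheme \<Rightarrow> ('m \<Rightarrow> 'n) set"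
where
  "left_module_hom R M N =
    {f \<in> hom (add_monoid M) (add_monoid N).
      \<forall>a \<in> carrier R. \<forall>x \<in> carrier M. f (a \<odot>\<^bsub>M\<^esub> x) = a \<odot>\<^bsub>N\<^esub> f x}"

text \<open>
  The lifting property quantifies over all modules, and hence over types, which is impossible
  inside a HOL definition. The carrier types of the test modules are therefore parameters;
  a theorem in which \<^typ>\<open>'m\<close> and \<^typ>\<open>'n\<close> are free type variables asserts the property for all of them.
\<close>

definition projective_module ::
  "'m itself \<Rightarrow> 'n itself \<Rightarrow> ('a, 'c) ring_scheme \<Rightarrow> ('a, 'p, 'd) module_scheme \<Rightarrow> bool"
where
  "projective_module TM TN R P \<longleftrightarrow>
    left_module R P \<and>
    (\<forall>(M :: ('a, 'm) module) (N :: ('a, 'n) module) p f.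
      left_module R M \<and> left_module R N \<and>
      p \<in> left_module_hom R M N \<and> p ` carrier M = carrier N \<and>
      f \<in> left_module_hom R P N \<longrightarrow>
      (\<exists>h \<in> left_module_hom R P M. \<forall>x \<in> carrier P. p (h x) = f x))"

text \<open>
  \<open>d n\<close> maps \<open>P n\<close> to \<open>P (n - 1)\<close> and is only relevant for \<open>n \<ge> 1\<close>; the augmentation
  from \<open>P 0\<close> to \<open>B\<close> is the separate argument \<open>d0\<close>, as \<open>B\<close> may have a different type.
\<close>

definition projective_resolution ::
  "'m itself \<Rightarrow> 'n itself \<Rightarrow> ('a, 'c) ring_scheme \<Rightarrow> (nat \<Rightarrow> ('a, 'p, 'd) module_scheme) \<Rightarrow>
    (nat \<Rightarrow> 'p \<Rightarrow> 'p) \<Rightarrow> ('p \<Rightarrow> 'b) \<Rightarrow> ('a, 'b, 'e) module_scheme \<Rightarrow> bool"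
where
  "projective_resolution TM TN R P d d0 B \<longleftrightarrow>
    left_module R B \<and>
    (\<forall>n. projective_module TM TN R (P n)) \<and>
    d0 \<in> left_module_hom R (P 0) B \<and>
    (\<forall>n. d (Suc n) \<in> left_module_hom R (P (Suc n)) (P n)) \<and>
    d0 ` carrier (P 0) = carrier B \<and>
    d (Suc 0) ` carrier (P (Suc 0)) = a_kernel (P 0) B d0 \<and>
    (\<forall>n. d (Suc (Suc n)) ` carrier (P (Suc (Suc n))) =
      a_kernel (P (Suc n)) (P n) (d (Suc n)))"

definition principal_left_ideal :: "('a, 'c) ring_scheme \<Rightarrow> 'a \<Rightarrow> ('a, 'a) module" where
  "principal_left_ideal R e =
    \<lparr>carrier = {a \<otimes>\<^bsub>R\<^esub> e |a. a \<in> carrier R}, mult = undefined, one = undefined,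
     zero = \<zero>\<^bsub>R\<^esub>, add = add R, smult = mult R\<rparr>"

definition regular_module :: "('a, 'c) ring_scheme \<Rightarrow> ('a, 'a) module" where
  "regular_module R =
    \<lparr>carrier = carrier R, mult = undefined, one = undefined,
     zero = \<zero>\<^bsub>R\<^esub>, add = add R, smult = mult R\<rparr>"

definition direct_sum_module :: "'i set \<Rightarrow> ('i \<Rightarrow> ('a, 'b, 'd) module_scheme) \<Rightarrow> ('a, 'i \<Rightarrow> 'b) module"
where
  "direct_sum_module I M =
    \<lparr>carrier = {x \<in> \<Pi>\<^sub>E i\<in>I. carrier (M i). finite {i \<in> I. x i \<noteq> \<zero>\<^bsub>M i\<^esub>}},
     mult = undefined, one = undefined,
     zero = (\<lambda>i\<in>I. \<zero>\<^bsub>M i\<^esub>),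
     add = (\<lambda>x y. \<lambda>i\<in>I. x i \<oplus>\<^bsub>M i\<^esub> y i),
     smult = (\<lambda>a x. \<lambda>i\<in>I. a \<odot>\<^bsub>M i\<^esub> x i)\<rparr>"


section \<open>The free module on a set, and semigroup algebras\<close>

definition free_carrier :: "('k, 'c) ring_scheme \<Rightarrow> 's set \<Rightarrow> ('s \<Rightarrow> 'k) set" where
  "free_carrier K X =
    {f \<in> UNIV \<rightarrow> carrier K. finite {s. f s \<noteq> \<zero>\<^bsub>K\<^esub>} \<and> {s. f s \<noteq> \<zero>\<^bsub>K\<^esub>} \<subseteq> X}"

definition monomial :: "('k, 'c) ring_scheme \<Rightarrow> 'k \<Rightarrow> 's \<Rightarrow> 's \<Rightarrow> 'k" where
  "monomial K c s = (\<lambda>x. if x = s then c else \<zero>\<^bsub>K\<^esub>)"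

text \<open>The \<open>K\<close>-bilinear extension of a map \<open>\<phi>\<close> defined on pairs of basis elements.\<close>

definition bilinear_ext ::
  "('k, 'c) ring_scheme \<Rightarrow> ('s \<Rightarrow> 't \<Rightarrow> 'u) \<Rightarrow> ('s \<Rightarrow> 'k) \<Rightarrow> ('t \<Rightarrow> 'k) \<Rightarrow> 'u \<Rightarrow> 'k"
where
  "bilinear_ext K \<phi> f g =
    (\<lambda>x. \<Oplus>\<^bsub>K\<^esub>p \<in> {(s, t). f s \<noteq> \<zero>\<^bsub>K\<^esub> \<and> g t \<noteq> \<zero>\<^bsub>K\<^esub> \<and> \<phi> s t = x}. f (fst p) \<otimes>\<^bsub>K\<^esub> g (snd p))"

definition semigroup_algebra :: "('k, 'c) ring_scheme \<Rightarrow> ('s, 'd) monoid_scheme \<Rightarrow> ('s \<Rightarrow> 'k) ring" where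
  "semigroup_algebra K S =
    \<lparr>carrier = free_carrier K (carrier S),
     mult = bilinear_ext K (mult S),
     one = monomial K \<one>\<^bsub>K\<^esub> \<one>\<^bsub>S\<^esub>,
     zero = (\<lambda>_. \<zero>\<^bsub>K\<^esub>),
     add = (\<lambda>f g s. f s \<oplus>\<^bsub>K\<^esub> g s)\<rparr>"


section \<open>Inverses and idempotents\<close>

text \<open>
  The inverse in the sense of inverse semigroups, in contrast to the library's \<^const>\<open>m_inv\<close>;
  meaningful when \<open>S\<close> is an inverse monoid.
\<close>

definition semigroup_inv :: "('s, 'd) monoid_scheme \<Rightarrow> 's \<Rightarrow> 's" where
  "semigroup_inv S s =
    (THE t. t \<in> carrier S \<and> s \<otimes>\<^bsub>S\<^esub> t \<otimes>\<^bsub>S\<^esub> s = s \<and> t \<otimes>\<^bsub>S\<^esub> s \<otimes>\<^bsub>S\<^esub> t = t)"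

definition idempotents :: "('s, 'd) monoid_scheme \<Rightarrow> 's set" where
  "idempotents S = {e \<in> carrier S. e \<otimes>\<^bsub>S\<^esub> e = e}"

definition idempotent_le :: "('s, 'd) monoid_scheme \<Rightarrow> 's \<Rightarrow> 's \<Rightarrow> bool" where
  "idempotent_le S e f \<longleftrightarrow> e \<otimes>\<^bsub>S\<^esub> f = e"


section \<open>The monoid \<open>S(G)\<close> and the partial group algebra\<close>

text \<open>
  The word \<open>[g\<^sub>1, \<dots>, g\<^sub>n]\<close> stands for the product of the symbols \<open>[g\<^sub>1] \<cdots> [g\<^sub>n]\<close>.
  In the free monoid the relations \<open>[g][1] = [g]\<close> alone would not identify \<open>[1]\<close> with the
  empty word (no defining relation involves the empty word), whereas \<open>[1]\<close> is meant to be the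
  identity of the monoid; \<open>unit\<close> records this.
\<close>

inductive par_cong :: "('g, 'c) monoid_scheme \<Rightarrow> 'g list \<Rightarrow> 'g list \<Rightarrow> bool"
  for G :: "('g, 'c) monoid_scheme" where
  rel_left: "\<lbrakk>g \<in> carrier G; h \<in> carrier G\<rbrakk> \<Longrightarrow>
      par_cong G [inv\<^bsub>G\<^esub> g, g, h] [inv\<^bsub>G\<^esub> g, g \<otimes>\<^bsub>G\<^esub> h]"
| rel_right: "\<lbrakk>g \<in> carrier G; h \<in> carrier G\<rbrakk> \<Longrightarrow>
      par_cong G [g, h, inv\<^bsub>G\<^esub> h] [g \<otimes>\<^bsub>G\<^esub> h, inv\<^bsub>G\<^esub> h]"
| rel_one: "g \<in> carrier G \<Longrightarrow> par_cong G [g, \<one>\<^bsub>G\<^esub>] [g]"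
| unit: "par_cong G [\<one>\<^bsub>G\<^esub>] []"
| refl: "u \<in> lists (carrier G) \<Longrightarrow> par_cong G u u"
| sym: "par_cong G u v \<Longrightarrow> par_cong G v u"
| trans: "\<lbrakk>par_cong G u v; par_cong G v w\<rbrakk> \<Longrightarrow> par_cong G u w"
| append: "\<lbrakk>par_cong G u u'; par_cong G v v'\<rbrakk> \<Longrightarrow> par_cong G (u @ v) (u' @ v')"

definition par_class :: "('g, 'c) monoid_scheme \<Rightarrow> 'g list \<Rightarrow> 'g list set" where
  "par_class G u = {v. par_cong G u v}"

definition par_monoid :: "('g, 'c) monoid_scheme \<Rightarrow> 'g list set monoid" where
  "par_monoid G =
    \<lparr>carrier = par_class G ` lists (carrier G),
     mult = (\<lambda>s t. {w. \<exists>u \<in> s. \<exists>v \<in> t. par_cong G (u @ v) w}),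
     one = par_class G []\<rparr>"

definition par_gen :: "('g, 'c) monoid_scheme \<Rightarrow> 'g \<Rightarrow> 'g list set" where
  "par_gen G g = par_class G [g]"

definition par_e :: "('g, 'c) monoid_scheme \<Rightarrow> 'g \<Rightarrow> 'g list set" where
  "par_e G g = par_gen G g \<otimes>\<^bsub>par_monoid G\<^esub> par_gen G (inv\<^bsub>G\<^esub> g)"

definition par_e_tuple :: "('g, 'c) monoid_scheme \<Rightarrow> 'g list \<Rightarrow> 'g list set" where
  "par_e_tuple G gs =
    foldr (mult (par_monoid G))
      (map (\<lambda>k. par_e G (foldr (mult G) (take k gs) \<one>\<^bsub>G\<^esub>)) [1..<Suc (length gs)])
      \<one>\<^bsub>par_monoid G\<^esub>"

definition par_algebra ::
  "('k, 'c) ring_scheme \<Rightarrow> ('g, 'd) monoid_scheme \<Rightarrow> ('g list set \<Rightarrow> 'k) ring"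
where
  "par_algebra K G = semigroup_algebra K (par_monoid G)"

definition par_B ::
  "('k, 'c) ring_scheme \<Rightarrow> ('g, 'd) monoid_scheme \<Rightarrow> ('g list set \<Rightarrow> 'k, 'g list set \<Rightarrow> 'k) module"
where
  "par_B K G =
    \<lparr>carrier = free_carrier K (idempotents (par_monoid G)),
     mult = undefined, one = undefined,
     zero = (\<lambda>_. \<zero>\<^bsub>K\<^esub>),
     add = (\<lambda>f g s. f s \<oplus>\<^bsub>K\<^esub> g s),
     smult = bilinear_ext K
       (\<lambda>s e. s \<otimes>\<^bsub>par_monoid G\<^esub> e \<otimes>\<^bsub>par_monoid G\<^esub> semigroup_inv (par_monoid G) s)\<rparr>"


section \<open>The resolution\<close>

definition tuples :: "('g, 'd) monoid_scheme \<Rightarrow> nat \<Rightarrow> 'g list set" where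
  "tuples G n = {gs \<in> lists (carrier G). length gs = n}"

text \<open>
  \<open>P\<^sub>0\<close> is the algebra itself, regarded as a direct sum with the empty tuple as its only index, so
  that all \<open>P\<^sub>n\<close> have the same type; this index is the \<open>( )\<close> in \<open>s( )\<close>.
\<close>

definition par_P ::
  "('k, 'c) ring_scheme \<Rightarrow> ('g, 'd) monoid_scheme \<Rightarrow> nat \<Rightarrow>
    ('g list set \<Rightarrow> 'k, 'g list \<Rightarrow> 'g list set \<Rightarrow> 'k) module"
where
  "par_P K G n =
    (if n = 0 then direct_sum_module (tuples G 0) (\<lambda>_. regular_module (par_algebra K G))
     else direct_sum_module (tuples G n)
       (\<lambda>gs. principal_left_ideal (par_algebra K G) (monomial K \<one>\<^bsub>K\<^esub> (par_e_tuple G gs))))"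

text \<open>The element \<open>s(g\<^sub>1, \<dots>, g\<^sub>n)\<close>, that is \<open>s e\<^bsub>(g\<^sub>1, \<dots>, g\<^sub>n)\<^esub>\<close> in the summand of \<open>(g\<^sub>1, \<dots>, g\<^sub>n)\<close>.\<close>

definition par_elem ::
  "('k, 'c) ring_scheme \<Rightarrow> ('g, 'd) monoid_scheme \<Rightarrow> 'g list set \<Rightarrow> 'g list \<Rightarrow>
    'g list \<Rightarrow> 'g list set \<Rightarrow> 'k"
where
  "par_elem K G s gs =
    (\<lambda>hs \<in> tuples G (length gs).
      if hs = gs then monomial K \<one>\<^bsub>K\<^esub> (s \<otimes>\<^bsub>par_monoid G\<^esub> par_e_tuple G gs) else (\<lambda>_. \<zero>\<^bsub>K\<^esub>))"

definition par_basis :: "('g, 'd) monoid_scheme \<Rightarrow> nat \<Rightarrow> ('g list set \<times> 'g list) set" where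
  "par_basis G n =
    {(s, gs). s \<in> carrier (par_monoid G) \<and> gs \<in> tuples G n \<and>
      idempotent_le (par_monoid G)
        (semigroup_inv (par_monoid G) s \<otimes>\<^bsub>par_monoid G\<^esub> s) (par_e_tuple G gs)}"

text \<open>
  The \<open>K\<close>-linear extension to \<open>P\<^sub>n\<close> of a map \<open>\<phi>\<close> on the basis elements \<open>s(g\<^sub>1, \<dots>, g\<^sub>n)\<close>; the
  coefficient of \<open>x\<close> at that element is \<open>x [g\<^sub>1, \<dots>, g\<^sub>n] s\<close>. On a left module over the algebra, \<open>c\<close> in \<open>K\<close>
  acts as \<open>c\<close> times the unit of the algebra.
\<close>

definition par_linear_ext ::
  "('k, 'c) ring_scheme \<Rightarrow> ('g, 'd) monoid_scheme \<Rightarrow> nat \<Rightarrow> ('g list set \<Rightarrow> 'k, 'b, 'e) module_scheme \<Rightarrow>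
    ('g list set \<Rightarrow> 'g list \<Rightarrow> 'b) \<Rightarrow> ('g list \<Rightarrow> 'g list set \<Rightarrow> 'k) \<Rightarrow> 'b"
where
  "par_linear_ext K G n M \<phi> x =
    (\<Oplus>\<^bsub>M\<^esub>b \<in> {(s, gs). (s, gs) \<in> par_basis G n \<and> x gs s \<noteq> \<zero>\<^bsub>K\<^esub>}.
      monomial K (x (snd b) (fst b)) \<one>\<^bsub>par_monoid G\<^esub> \<odot>\<^bsub>M\<^esub> \<phi> (fst b) (snd b))"

definition par_boundary0 ::
  "('k, 'c) ring_scheme \<Rightarrow> ('g, 'd) monoid_scheme \<Rightarrow> ('g list \<Rightarrow> 'g list set \<Rightarrow> 'k) \<Rightarrow> 'g list set \<Rightarrow> 'k"
where
  "par_boundary0 K G = par_linear_ext K G 0 (par_B K G)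
    (\<lambda>s _. monomial K \<one>\<^bsub>K\<^esub> (s \<otimes>\<^bsub>par_monoid G\<^esub> semigroup_inv (par_monoid G) s))"

text \<open>The tuple \<open>(g\<^sub>1, \<dots>, g\<^sub>i g\<^bsub>i+1\<^esub>, \<dots>, g\<^sub>n)\<close>; tuples are 1-based, lists 0-based.\<close>

definition merge_at :: "('g, 'd) monoid_scheme \<Rightarrow> nat \<Rightarrow> 'g list \<Rightarrow> 'g list" where
  "merge_at G i gs = take (i - 1) gs @ [gs ! (i - 1) \<otimes>\<^bsub>G\<^esub> gs ! i] @ drop (i + 1) gs"

text \<open>For \<open>n = 1\<close> the middle sum is empty and the formula reads \<open>s[g]( ) - s( )\<close>.\<close>

definition par_boundary ::
  "('k, 'c) ring_scheme \<Rightarrow> ('g, 'd) monoid_scheme \<Rightarrow> nat \<Rightarrow>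
    ('g list \<Rightarrow> 'g list set \<Rightarrow> 'k) \<Rightarrow> 'g list \<Rightarrow> 'g list set \<Rightarrow> 'k"
where
  "par_boundary K G n = par_linear_ext K G n (par_P K G (n - 1))
    (\<lambda>s gs.
      par_elem K G (s \<otimes>\<^bsub>par_monoid G\<^esub> par_gen G (hd gs)) (tl gs)
      \<oplus>\<^bsub>par_P K G (n - 1)\<^esub>
      (\<Oplus>\<^bsub>par_P K G (n - 1)\<^esub>i \<in> {1..n - 1}.
        [((-1 :: int) ^ i)] \<cdot>\<^bsub>par_P K G (n - 1)\<^esub> par_elem K G s (merge_at G i gs))
      \<oplus>\<^bsub>par_P K G (n - 1)\<^esub>
      [((-1 :: int) ^ n)] \<cdot>\<^bsub>par_P K G (n - 1)\<^esub> par_elem K G s (butlast gs))"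

end

theory Submission
  imports Defs
begin

text \<open>
  An element of \<open>S(G)\<close> amounts to a pair \<open>(V, g)\<close> of a finite set \<open>V \<subseteq> G\<close> containing \<open>1\<close> and \<open>g\<close>, with
  \<open>(V, g) (W, h) = (V \<union> g W, g h)\<close>. In these terms \<open>(V, g)(g\<^sub>1, \<dots>, g\<^sub>n)\<close> is a basis element of \<open>P\<^sub>n\<close> iff the
  vertices \<open>g, g g\<^sub>1, \<dots>, g g\<^sub>1 \<cdots> g\<^sub>n\<close> all lie in \<open>V\<close>, and \<open>\<partial>\<^sub>n\<close> is the alternating sum over the omissions of
  a vertex. So the complex is the direct sum, over all \<open>V\<close>, of the augmented ordered chain complexes of
  the full simplices on \<open>V\<close>, and inserting \<open>1\<close> as first vertex is a \<open>K\<close>-linear contraction. The \<open>P\<^sub>n\<close> are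
  direct sums of left ideals generated by idempotents, hence projective.
\<close>

section \<open>Left modules\<close>

text \<open>The contraction is uniform in \<open>V\<close> because \<open>1\<close> lies in every
  \<open>V\<close>. It is not linear over the algebra: left multiplication by \<open>(W, h)\<close>
  moves the inserted vertex \<open>1\<close> to \<open>h\<close>. Hence maps between the modules are
  treated as additive wherever possible, and \<open>d d = 0\<close> comes from the homotopy and a
  generation property instead of face identities: every basis element is an algebra multiple of a
  contraction. The main obstacle is the description of \<open>S(G)\<close> by pairs, since the
  monoid is given by generators and relations. That the pair is an invariant is checked relation by
  relation. That it is a complete invariant needs a normal form: the idempotents \<open>e_h\<close>
  commute and satisfy \<open>[g] e_h = e_(gh) [g]\<close>, so every word can be rewritten as a
  product of some \<open>e_h\<close> followed by a single generator. After that, an identity in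
  \<open>S(G)\<close> is decided by comparing two sets and two group elements. The module
  \<open>B\<close> sits in degree -1: its basis, the idempotents, consists of the pairs
  \<open>(V, 1)\<close>, one for each \<open>V\<close>, and \<open>s\<close> times its inverse
  forgets \<open>g\<close>.\<close>

lemma additive_zero:
  assumes "abelian_group M" "abelian_group N" "f \<in> hom (add_monoid M) (add_monoid N)"
  shows "f \<zero>\<^bsub>M\<^esub> = \<zero>\<^bsub>N\<^esub>"
proof -
  interpret abelian_group_hom M N f
    using assms by (intro abelian_group_homI) (auto simp: group_hom_def group_hom_axioms_def abelian_group.a_group)
  show ?thesis by (rule hom_zero)
qed

lemma additive_add:
  assumes "f \<in> hom (add_monoid M) (add_monoid N)" "x \<in> carrier M" "y \<in> carrier M"
  shows "f (x \<oplus>\<^bsub>M\<^esub> y) = f x \<oplus>\<^bsub>N\<^esub> f y"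
  using assms by (auto simp: hom_def)

lemma additive_closed:
  assumes "f \<in> hom (add_monoid M) (add_monoid N)" "x \<in> carrier M"
  shows "f x \<in> carrier N"
  using assms by (auto simp: hom_def)

lemma additive_finsum:
  assumes M: "abelian_group M" and N: "abelian_group N"
    and f: "f \<in> hom (add_monoid M) (add_monoid N)" and g: "g \<in> A \<rightarrow> carrier M"
  shows "f (finsum M g A) = finsum N (\<lambda>i. f (g i)) A"
proof -
  interpret M: abelian_group M by (rule M)
  interpret N: abelian_group N by (rule N)
  show ?thesis using g
  proof (induction A rule: infinite_finite_induct)
    case (insert a A)
    then have "finsum M g A \<in> carrier M" "g a \<in> carrier M" "(\<lambda>i. f (g i)) \<in> A \<rightarrow> carrier N"
      "f (g a) \<in> carrier N"
      using additive_closed[OF f] by (auto intro!: M.finsum_closed)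
    with insert show ?case by (simp add: additive_add[OF f])
  qed (simp_all add: additive_zero[OF M N f])
qed

lemma additive_add_pow_int:
  assumes "abelian_group M" "abelian_group N" "f \<in> hom (add_monoid M) (add_monoid N)"
    "x \<in> carrier M"
  shows "f ([(k::int)] \<cdot>\<^bsub>M\<^esub> x) = [k] \<cdot>\<^bsub>N\<^esub> f x"
  using hom_int_pow[of f "add_monoid M" "add_monoid N" x k] assms
  by (simp add: abelian_group.a_group add_pow_def)

text \<open>The maps out of direct sums and free modules are sums over the support of the argument,
  and the supports of \<open>x\<close>, \<open>y\<close> and their sum differ. All three sums are
  first extended by zeros to the union of the supports of \<open>x\<close> and
  \<open>y\<close>.\<close>

lemma (in abelian_group) finsum_support_add:
  assumes N: "\<And>i. i \<in> I \<Longrightarrow> abelian_group (N i)"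
    and \<psi>: "\<And>i. i \<in> I \<Longrightarrow> \<psi> i \<in> hom (add_monoid (N i)) (add_monoid G)"
    and x: "\<And>i. i \<in> I \<Longrightarrow> x i \<in> carrier (N i)" "finite {i \<in> I. x i \<noteq> \<zero>\<^bsub>N i\<^esub>}"
    and y: "\<And>i. i \<in> I \<Longrightarrow> y i \<in> carrier (N i)" "finite {i \<in> I. y i \<noteq> \<zero>\<^bsub>N i\<^esub>}"
  shows "(\<Oplus>i\<in>{i \<in> I. x i \<oplus>\<^bsub>N i\<^esub> y i \<noteq> \<zero>\<^bsub>N i\<^esub>}. \<psi> i (x i \<oplus>\<^bsub>N i\<^esub> y i)) =
    (\<Oplus>i\<in>{i \<in> I. x i \<noteq> \<zero>\<^bsub>N i\<^esub>}. \<psi> i (x i)) \<oplus> (\<Oplus>i\<in>{i \<in> I. y i \<noteq> \<zero>\<^bsub>N i\<^esub>}. \<psi> i (y i))"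
proof -
  let ?F = "{i \<in> I. x i \<noteq> \<zero>\<^bsub>N i\<^esub>} \<union> {i \<in> I. y i \<noteq> \<zero>\<^bsub>N i\<^esub>}"
  have fin: "finite ?F" using x y by simp
  have extend: "(\<Oplus>i\<in>{i \<in> I. z i \<noteq> \<zero>\<^bsub>N i\<^esub>}. \<psi> i (z i)) = (\<Oplus>i\<in>?F. \<psi> i (z i))"
    if "\<And>i. i \<in> I \<Longrightarrow> z i \<in> carrier (N i)" "{i \<in> I. z i \<noteq> \<zero>\<^bsub>N i\<^esub>} \<subseteq> ?F" for z
    using that fin additive_zero[OF N abelian_group_axioms \<psi>] additive_closed[OF \<psi>]
    by (intro add.finprod_mono_neutral_cong_left) auto
  have "(\<Oplus>i\<in>{i \<in> I. x i \<oplus>\<^bsub>N i\<^esub> y i \<noteq> \<zero>\<^bsub>N i\<^esub>}. \<psi> i (x i \<oplus>\<^bsub>N i\<^esub> y i)) =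
      (\<Oplus>i\<in>?F. \<psi> i (x i \<oplus>\<^bsub>N i\<^esub> y i))"
    using x y by (intro extend)
      (auto intro!: abelian_monoid.a_closed abelian_group.axioms(1)[OF N]
         simp: abelian_monoid.l_zero[OF abelian_group.axioms(1)[OF N]]
            abelian_monoid.zero_closed[OF abelian_group.axioms(1)[OF N]])
  also have "\<dots> = (\<Oplus>i\<in>?F. \<psi> i (x i) \<oplus> \<psi> i (y i))"
    using x y additive_closed[OF \<psi>] by (intro finsum_cong') (auto simp: additive_add[OF \<psi>])
  also have "\<dots> = (\<Oplus>i\<in>?F. \<psi> i (x i)) \<oplus> (\<Oplus>i\<in>?F. \<psi> i (y i))"
    using x y additive_closed[OF \<psi>] by (intro finsum_addf) auto
  also have "(\<Oplus>i\<in>?F. \<psi> i (x i)) = (\<Oplus>i\<in>{i \<in> I. x i \<noteq> \<zero>\<^bsub>N i\<^esub>}. \<psi> i (x i))"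
    using x by (intro extend[symmetric]) auto
  also have "(\<Oplus>i\<in>?F. \<psi> i (y i)) = (\<Oplus>i\<in>{i \<in> I. y i \<noteq> \<zero>\<^bsub>N i\<^esub>}. \<psi> i (y i))"
    using y by (intro extend[symmetric]) auto
  finally show ?thesis .
qed

section \<open>Module homomorphisms and principal left ideals\<close>

lemma left_module_hom_additive:
  "f \<in> left_module_hom R M N \<Longrightarrow> f \<in> hom (add_monoid M) (add_monoid N)"
  by (simp add: left_module_hom_def)

lemma left_module_hom_smult:
  "\<lbrakk>f \<in> left_module_hom R M N; a \<in> carrier R; x \<in> carrier M\<rbrakk> \<Longrightarrow> f (a \<odot>\<^bsub>M\<^esub> x) = a \<odot>\<^bsub>N\<^esub> f x"
  by (simp add: left_module_hom_def)

context left_module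
begin

lemma abelian_group: "abelian_group M" ..


lemma smult_additive_right:
  "a \<in> carrier R \<Longrightarrow> (\<lambda>x. a \<odot>\<^bsub>M\<^esub> x) \<in> hom (add_monoid M) (add_monoid M)"
  by (auto simp: hom_def smult_closed smult_r_distr)

lemma smult_additive_left:
  "x \<in> carrier M \<Longrightarrow> (\<lambda>a. a \<odot>\<^bsub>M\<^esub> x) \<in> hom (add_monoid R) (add_monoid M)"
  by (auto simp: hom_def smult_closed smult_l_distr)

lemma smult_l_null: "x \<in> carrier M \<Longrightarrow> \<zero> \<odot>\<^bsub>M\<^esub> x = \<zero>\<^bsub>M\<^esub>"
  by (rule additive_zero[OF R.is_abelian_group abelian_group smult_additive_left])

lemma smult_r_null: "a \<in> carrier R \<Longrightarrow> a \<odot>\<^bsub>M\<^esub> \<zero>\<^bsub>M\<^esub> = \<zero>\<^bsub>M\<^esub>"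
  by (rule additive_zero[OF abelian_group abelian_group smult_additive_right])

end

lemma principal_left_ideal_simps [simp]:
  "zero (principal_left_ideal R e) = \<zero>\<^bsub>R\<^esub>"
  "add (principal_left_ideal R e) = add R"
  "smult (principal_left_ideal R e) = mult R"
  by (simp_all add: principal_left_ideal_def)

lemma left_module_principal_left_ideal:
  assumes R: "ring R" and e: "e \<in> carrier R"
  shows "left_module R (principal_left_ideal R e)"
proof -
  interpret ring R by (rule R)
  let ?Q = "principal_left_ideal R e"
  have mem: "x \<in> carrier ?Q \<longleftrightarrow> (\<exists>a\<in>carrier R. x = a \<otimes>\<^bsub>R\<^esub> e)" for x
    by (auto simp: principal_left_ideal_def)
  have sub: "x \<in> carrier R" if "x \<in> carrier ?Q" for x
    using that e by (auto simp: mem)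
  show ?thesis
  proof (intro left_module.intro left_module_axioms.intro abelian_groupI R)
    show "\<zero>\<^bsub>?Q\<^esub> \<in> carrier ?Q"
      unfolding mem using e by (intro bexI[of _ "\<zero>\<^bsub>R\<^esub>"]) simp_all
  next
    fix x y assume "x \<in> carrier ?Q" "y \<in> carrier ?Q"
    then obtain a b where "a \<in> carrier R" "b \<in> carrier R" "x = a \<otimes>\<^bsub>R\<^esub> e" "y = b \<otimes>\<^bsub>R\<^esub> e"
      by (auto simp: mem)
    then show "x \<oplus>\<^bsub>?Q\<^esub> y \<in> carrier ?Q"
      unfolding mem using e by (intro bexI[of _ "a \<oplus>\<^bsub>R\<^esub> b"]) (simp_all add: l_distr)
  next
    fix x assume "x \<in> carrier ?Q"
    then obtain a where "a \<in> carrier R" "x = a \<otimes>\<^bsub>R\<^esub> e"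
      by (auto simp: mem)
    then show "\<exists>y\<in>carrier ?Q. y \<oplus>\<^bsub>?Q\<^esub> x = \<zero>\<^bsub>?Q\<^esub>"
      using e by (intro bexI[of _ "(\<ominus>\<^bsub>R\<^esub> a) \<otimes>\<^bsub>R\<^esub> e"])
        (auto simp: mem l_minus l_neg intro: bexI[of _ "\<ominus>\<^bsub>R\<^esub> a"])
  next
    fix r x assume "r \<in> carrier R" "x \<in> carrier ?Q"
    moreover from this obtain a where "a \<in> carrier R" "x = a \<otimes>\<^bsub>R\<^esub> e"
      by (auto simp: mem)
    ultimately show "r \<odot>\<^bsub>?Q\<^esub> x \<in> carrier ?Q"
      unfolding mem using e by (intro bexI[of _ "r \<otimes>\<^bsub>R\<^esub> a"]) (simp_all add: m_assoc)
  qed (auto dest!: sub simp: a_ac l_distr r_distr m_assoc)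
qed

lemma regular_module_eq_principal:
  assumes "ring R"
  shows "regular_module R = principal_left_ideal R \<one>\<^bsub>R\<^esub>"
proof -
  interpret ring R by (rule assms)
  have "carrier R = {a \<otimes>\<^bsub>R\<^esub> \<one>\<^bsub>R\<^esub> |a. a \<in> carrier R}" by force
  then show ?thesis by (simp add: regular_module_def principal_left_ideal_def)
qed

subsection \<open>Direct sums\<close>

definition direct_sum_single ::
  "'i set \<Rightarrow> ('i \<Rightarrow> ('a, 'b, 'd) module_scheme) \<Rightarrow> 'i \<Rightarrow> 'b \<Rightarrow> 'i \<Rightarrow> 'b"
where
  "direct_sum_single I M i y = (\<lambda>j\<in>I. if j = i then y else \<zero>\<^bsub>M j\<^esub>)"

locale left_module_family = R?: ring R
  for R :: "('a, 'c) ring_scheme" (structure) +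
  fixes I :: "'i set" and M :: "'i \<Rightarrow> ('a, 'b, 'd) module_scheme"
  assumes family: "i \<in> I \<Longrightarrow> left_module R (M i)"
begin

abbreviation "S \<equiv> direct_sum_module I M"

lemma family_group: "i \<in> I \<Longrightarrow> abelian_group (M i)"
  using family left_module.abelian_group by blast

lemma family_monoid: "i \<in> I \<Longrightarrow> abelian_monoid (M i)"
  using family_group abelian_group.axioms(1) by blast

lemma family_minus_zero: "i \<in> I \<Longrightarrow> \<ominus>\<^bsub>M i\<^esub> \<zero>\<^bsub>M i\<^esub> = \<zero>\<^bsub>M i\<^esub>"
  by (metis abelian_group.l_neg abelian_group.a_inv_closed abelian_monoid.r_zero
      abelian_monoid.zero_closed family_group family_monoid)

lemma carrier_iff:
  "x \<in> carrier S \<longleftrightarrow> x \<in> extensional I \<and> (\<forall>i\<in>I. x i \<in> carrier (M i)) \<and> finite {i \<in> I. x i \<noteq> \<zero>\<^bsub>M i\<^esub>}"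
  by (auto simp: direct_sum_module_def PiE_iff)

lemma left_module_direct_sum: "left_module R S"
proof (intro left_module.intro left_module_axioms.intro abelian_groupI ring_axioms)
  fix x y assume x: "x \<in> carrier S" and y: "y \<in> carrier S"
  have "finite {i \<in> I. x i \<oplus>\<^bsub>M i\<^esub> y i \<noteq> \<zero>\<^bsub>M i\<^esub>}"
    by (rule finite_subset[where B = "{i \<in> I. x i \<noteq> \<zero>\<^bsub>M i\<^esub>} \<union> {i \<in> I. y i \<noteq> \<zero>\<^bsub>M i\<^esub>}"])
      (use x y in \<open>auto simp: carrier_iff abelian_monoid.l_zero[OF family_monoid]
         abelian_monoid.zero_closed[OF family_monoid]\<close>)
  then show "x \<oplus>\<^bsub>S\<^esub> y \<in> carrier S"
    using x y by (auto simp: carrier_iff, auto simp: direct_sum_module_def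
        intro!: abelian_monoid.a_closed[OF family_monoid] cong: conj_cong)
next
  show "\<zero>\<^bsub>S\<^esub> \<in> carrier S"
    by (auto simp: carrier_iff, auto simp: direct_sum_module_def
        intro!: abelian_monoid.zero_closed[OF family_monoid] cong: conj_cong)
next
  fix x assume x: "x \<in> carrier S"
  let ?y = "\<lambda>i\<in>I. \<ominus>\<^bsub>M i\<^esub> x i"
  have "finite {i \<in> I. ?y i \<noteq> \<zero>\<^bsub>M i\<^esub>}"
    by (rule finite_subset[where B = "{i \<in> I. x i \<noteq> \<zero>\<^bsub>M i\<^esub>}"])
      (use x in \<open>auto simp: carrier_iff family_minus_zero\<close>)
  then have "?y \<in> carrier S"
    using x by (auto simp: carrier_iff intro!: abelian_group.a_inv_closed[OF family_group])
  moreover have "?y \<oplus>\<^bsub>S\<^esub> x = \<zero>\<^bsub>S\<^esub>"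
    using x by (auto simp: carrier_iff, auto simp: direct_sum_module_def fun_eq_iff
        abelian_group.l_neg[OF family_group])
  ultimately show "\<exists>y\<in>carrier S. y \<oplus>\<^bsub>S\<^esub> x = \<zero>\<^bsub>S\<^esub>" by blast
next
  fix a x assume a: "a \<in> carrier R" and x: "x \<in> carrier S"
  have "finite {i \<in> I. a \<odot>\<^bsub>M i\<^esub> x i \<noteq> \<zero>\<^bsub>M i\<^esub>}"
    by (rule finite_subset[where B = "{i \<in> I. x i \<noteq> \<zero>\<^bsub>M i\<^esub>}"])
      (use a x in \<open>auto simp: carrier_iff left_module.smult_r_null[OF family]\<close>)
  then show "a \<odot>\<^bsub>S\<^esub> x \<in> carrier S"
    using a x by (auto simp: carrier_iff, auto simp: direct_sum_module_def
        intro!: left_module.smult_closed[OF family] cong: conj_cong)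
next
  fix x assume "x \<in> carrier S"
  then have x: "x \<in> extensional I" "\<And>i. i \<in> I \<Longrightarrow> x i \<in> carrier (M i)"
    by (auto simp: carrier_iff)
  show "\<zero>\<^bsub>S\<^esub> \<oplus>\<^bsub>S\<^esub> x = x"
    using x by (auto simp: direct_sum_module_def fun_eq_iff extensional_def
        abelian_monoid.l_zero[OF family_monoid])
  show "\<one>\<^bsub>R\<^esub> \<odot>\<^bsub>S\<^esub> x = x"
    using x by (auto simp: direct_sum_module_def fun_eq_iff extensional_def
        left_module.smult_one[OF family])
next
  fix x y assume "x \<in> carrier S" "y \<in> carrier S"
  then show "x \<oplus>\<^bsub>S\<^esub> y = y \<oplus>\<^bsub>S\<^esub> x"
    unfolding carrier_iff
    by (auto simp: direct_sum_module_def fun_eq_iff intro!: abelian_monoid.a_comm[OF family_monoid])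
next
  fix x y z assume "x \<in> carrier S" "y \<in> carrier S" "z \<in> carrier S"
  then show "x \<oplus>\<^bsub>S\<^esub> y \<oplus>\<^bsub>S\<^esub> z = x \<oplus>\<^bsub>S\<^esub> (y \<oplus>\<^bsub>S\<^esub> z)"
    unfolding carrier_iff
    by (auto simp: direct_sum_module_def fun_eq_iff intro!: abelian_monoid.a_assoc[OF family_monoid])
qed (auto simp: carrier_iff, auto simp: direct_sum_module_def fun_eq_iff
    left_module.smult_l_distr[OF family]
    left_module.smult_r_distr[OF family] left_module.smult_assoc[OF family])

lemma single_closed:
  assumes "i \<in> I" "y \<in> carrier (M i)"
  shows "direct_sum_single I M i y \<in> carrier S"
proof -
  have "finite {j \<in> I. direct_sum_single I M i y j \<noteq> \<zero>\<^bsub>M j\<^esub>}"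
    by (rule finite_subset[of _ "{i}"]) (auto simp: direct_sum_single_def split: if_splits)
  then show ?thesis using assms abelian_monoid.zero_closed[OF family_monoid]
    by (auto simp: carrier_iff, auto simp: direct_sum_single_def)
qed

lemma single_add:
  assumes "i \<in> I" "y \<in> carrier (M i)" "z \<in> carrier (M i)"
  shows "direct_sum_single I M i (y \<oplus>\<^bsub>M i\<^esub> z) =
    direct_sum_single I M i y \<oplus>\<^bsub>S\<^esub> direct_sum_single I M i z"
  using assms abelian_monoid.l_zero[OF family_monoid] abelian_monoid.zero_closed[OF family_monoid]
  by (auto simp: direct_sum_single_def direct_sum_module_def fun_eq_iff)

lemma single_smult:
  assumes "a \<in> carrier R" "i \<in> I" "y \<in> carrier (M i)"
  shows "a \<odot>\<^bsub>S\<^esub> direct_sum_single I M i y = direct_sum_single I M i (a \<odot>\<^bsub>M i\<^esub> y)"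
  using assms left_module.smult_r_null[OF family]
  by (auto simp: direct_sum_single_def direct_sum_module_def fun_eq_iff)

text \<open>Removes one nonzero coordinate at a time. It reduces an identity between additive maps
  on a direct sum to elements of a single summand.\<close>

lemma direct_sum_induct [consumes 1, case_names zero add]:
  assumes x: "x \<in> carrier S"
    and zero: "P \<zero>\<^bsub>S\<^esub>"
    and add: "\<And>x i y. \<lbrakk>x \<in> carrier S; P x; i \<in> I; y \<in> carrier (M i)\<rbrakk> \<Longrightarrow>
      P (x \<oplus>\<^bsub>S\<^esub> direct_sum_single I M i y)"
  shows "P x"
proof -
  have "finite F \<Longrightarrow> x \<in> carrier S \<Longrightarrow> {i \<in> I. x i \<noteq> \<zero>\<^bsub>M i\<^esub>} \<subseteq> F \<Longrightarrow> P x" for F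
  proof (induction F arbitrary: x rule: finite_induct)
    case empty
    then have "x = \<zero>\<^bsub>S\<^esub>"
      by (auto simp: carrier_iff, auto simp: direct_sum_module_def fun_eq_iff extensional_def)
    then show ?case using zero by simp
  next
    case (insert i F)
    show ?case
    proof (cases "i \<in> I")
      case True
      define x' where "x' = x(i := \<zero>\<^bsub>M i\<^esub>)"
      have "finite {j \<in> I. x' j \<noteq> \<zero>\<^bsub>M j\<^esub>}"
        by (rule finite_subset[where B = "{j \<in> I. x j \<noteq> \<zero>\<^bsub>M j\<^esub>}"])
          (use insert.prems in \<open>auto simp: carrier_iff x'_def split: if_splits\<close>)
      then have x': "x' \<in> carrier S"
        using insert.prems True abelian_monoid.zero_closed[OF family_monoid]
        by (auto simp: carrier_iff x'_def extensional_def)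
      have "P x'"
        using insert.prems by (intro insert.IH x') (auto simp: x'_def split: if_splits)
      moreover have "x = x' \<oplus>\<^bsub>S\<^esub> direct_sum_single I M i (x i)"
        using insert.prems True abelian_monoid.l_zero[OF family_monoid] abelian_monoid.r_zero[OF family_monoid]
        by (auto simp: carrier_iff, auto simp: x'_def direct_sum_module_def direct_sum_single_def
            fun_eq_iff extensional_def)
      ultimately show ?thesis
        using add[OF x' _ True, of "x i"] insert.prems True by (auto simp: carrier_iff)
    next
      case False
      then show ?thesis using insert by blast
    qed
  qed
  then show ?thesis using x by (auto simp: carrier_iff)
qed

end

section \<open>Projectivity of direct sums of left ideals generated by idempotents\<close>

lemma carrier_principal_left_ideal_idempotent:
  assumes "ring R" "e \<in> carrier R" "e \<otimes>\<^bsub>R\<^esub> e = e"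
  shows "carrier (principal_left_ideal R e) = {a \<in> carrier R. a \<otimes>\<^bsub>R\<^esub> e = a}"
proof -
  interpret ring R by fact
  show ?thesis using assms(2,3) by (auto simp: principal_left_ideal_def m_assoc) metis
qed

text \<open>A homomorphism on the ideal of \<open>e i\<close> is determined by its value at
  \<open>e i\<close>, since \<open>y = y (e i)\<close> there. Choose a preimage \<open>m i\<close>
  of that value and send \<open>y\<close> to \<open>y\<close> acting on \<open>m i\<close>. This
  makes sense for any preimage because \<open>y\<close> is itself a scalar, and \<open>p\<close>
  maps it to \<open>y f(e i) = f(y (e i)) = f(y)\<close>.\<close>

theorem projective_direct_sum_principal_left_ideals:
  fixes R :: "('a, 'c) ring_scheme" and e :: "'i \<Rightarrow> 'a"
  assumes R: "ring R"
    and e: "\<And>i. i \<in> I \<Longrightarrow> e i \<in> carrier R" "\<And>i. i \<in> I \<Longrightarrow> e i \<otimes>\<^bsub>R\<^esub> e i = e i"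
  shows "projective_module TYPE('m) TYPE('n) R
    (direct_sum_module I (\<lambda>i. principal_left_ideal R (e i)))"
proof -
  let ?Q = "\<lambda>i. principal_left_ideal R (e i)"
  interpret R: ring R by (rule R)
  interpret left_module_family R I ?Q
    by (intro left_module_family.intro left_module_family_axioms.intro R
        left_module_principal_left_ideal e(1))
  have e_mem: "e i \<in> carrier (?Q i)" if "i \<in> I" for i
    using e[OF that] by (auto simp: carrier_principal_left_ideal_idempotent R)
  have Q: "y \<in> carrier R" "y \<otimes>\<^bsub>R\<^esub> e i = y" if "y \<in> carrier (?Q i)" "i \<in> I" for i y
    using that e by (auto simp: carrier_principal_left_ideal_idempotent R)
  show ?thesis
    unfolding projective_module_def
  proof (intro conjI allI impI left_module_direct_sum, elim conjE)
    fix M :: "('a, 'm) module" and N :: "('a, 'n) module" and p f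
    assume M: "left_module R M" and N: "left_module R N" and p: "p \<in> left_module_hom R M N"
      and surj: "p ` carrier M = carrier N" and f: "f \<in> left_module_hom R S N"
    interpret M: left_module R M by (rule M)
    interpret N: left_module R N by (rule N)
    have "\<exists>m \<in> carrier M. p m = f (direct_sum_single I ?Q i (e i))" if "i \<in> I" for i
      using additive_closed[OF left_module_hom_additive[OF f] single_closed[OF that e_mem[OF that]]]
        surj by auto (metis imageE)
    then obtain m where m: "\<And>i. i \<in> I \<Longrightarrow> m i \<in> carrier M"
      and pm: "\<And>i. i \<in> I \<Longrightarrow> p (m i) = f (direct_sum_single I ?Q i (e i))"
      by metis
    define h where "h x = (\<Oplus>\<^bsub>M\<^esub>i\<in>{i \<in> I. x i \<noteq> \<zero>\<^bsub>R\<^esub>}. x i \<odot>\<^bsub>M\<^esub> m i)" for x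
    have car: "x i \<in> carrier R" if "x \<in> carrier S" "i \<in> I" for x i
      using that Q by (auto simp: carrier_iff)
    have fin: "finite {i \<in> I. x i \<noteq> \<zero>\<^bsub>R\<^esub>}" if "x \<in> carrier S" for x
      using that by (auto simp: carrier_iff)
    have closed: "h x \<in> carrier M" if "x \<in> carrier S" for x
      using car[OF that] m M.smult_closed unfolding h_def by (intro M.finsum_closed) auto
    have add: "h (x \<oplus>\<^bsub>S\<^esub> y) = h x \<oplus>\<^bsub>M\<^esub> h y" if x: "x \<in> carrier S" and y: "y \<in> carrier S" for x y
    proof -
      have "h (x \<oplus>\<^bsub>S\<^esub> y) =
          (\<Oplus>\<^bsub>M\<^esub>i\<in>{i \<in> I. x i \<oplus>\<^bsub>R\<^esub> y i \<noteq> \<zero>\<^bsub>R\<^esub>}. (x i \<oplus>\<^bsub>R\<^esub> y i) \<odot>\<^bsub>M\<^esub> m i)"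
        unfolding h_def using car[OF x] car[OF y] m M.smult_closed
        by (intro M.finsum_cong') (auto simp: direct_sum_module_def)
      also have "\<dots> = h x \<oplus>\<^bsub>M\<^esub> h y"
        unfolding h_def using car x y m fin
        by (intro M.finsum_support_add[where N = "\<lambda>_. R" and \<psi> = "\<lambda>i a. a \<odot>\<^bsub>M\<^esub> m i"]
            M.smult_additive_left R.is_abelian_group) auto
      finally show ?thesis .
    qed
    have smult: "h (a \<odot>\<^bsub>S\<^esub> x) = a \<odot>\<^bsub>M\<^esub> h x" if a: "a \<in> carrier R" and x: "x \<in> carrier S" for a x
    proof -
      have "h (a \<odot>\<^bsub>S\<^esub> x) = (\<Oplus>\<^bsub>M\<^esub>i\<in>{i \<in> I. x i \<noteq> \<zero>\<^bsub>R\<^esub>}. (a \<otimes>\<^bsub>R\<^esub> x i) \<odot>\<^bsub>M\<^esub> m i)"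
      proof -
        have ax: "(a \<odot>\<^bsub>S\<^esub> x) i = a \<otimes>\<^bsub>R\<^esub> x i" if "i \<in> I" for i
          using that by (simp add: direct_sum_module_def)
        show ?thesis
          unfolding h_def using a m car[OF x] fin[OF x]
          by (intro M.add.finprod_mono_neutral_cong_left)
            (auto simp: ax M.smult_l_null M.smult_closed)
      qed
      also have "\<dots> = (\<Oplus>\<^bsub>M\<^esub>i\<in>{i \<in> I. x i \<noteq> \<zero>\<^bsub>R\<^esub>}. a \<odot>\<^bsub>M\<^esub> (x i \<odot>\<^bsub>M\<^esub> m i))"
        using a car[OF x] m by (intro M.finsum_cong') (auto simp: M.smult_assoc M.smult_closed)
      also have "\<dots> = a \<odot>\<^bsub>M\<^esub> h x"
        unfolding h_def using car[OF x] m M.smult_closed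
        by (intro additive_finsum[OF M.abelian_group M.abelian_group M.smult_additive_right[OF a], symmetric]) auto
      finally show ?thesis .
    qed
    have h: "h \<in> left_module_hom R S M"
      using closed add smult by (auto simp: left_module_hom_def hom_def)
    have single: "h (direct_sum_single I ?Q i y) = y \<odot>\<^bsub>M\<^esub> m i" if i: "i \<in> I" and y: "y \<in> carrier (?Q i)" for i y
    proof -
      have "h (direct_sum_single I ?Q i y) =
          (\<Oplus>\<^bsub>M\<^esub>j\<in>{i}. direct_sum_single I ?Q i y j \<odot>\<^bsub>M\<^esub> m j)"
        unfolding h_def using i m M.smult_l_null M.smult_closed Q[OF y i]
        by (intro M.add.finprod_mono_neutral_cong_left)
          (auto simp: direct_sum_single_def split: if_splits)
      then show ?thesis using i m M.smult_closed Q[OF y i] by (simp add: direct_sum_single_def)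
    qed
    note f_add = left_module_hom_additive[OF f] and p_add = left_module_hom_additive[OF p]
      and h_add = left_module_hom_additive[OF h]
    have "p (h x) = f x" if "x \<in> carrier S" for x
      using that
    proof (induction x rule: direct_sum_induct)
      case zero
      have SG: "abelian_group S" using left_module_direct_sum left_module.abelian_group by blast
      show ?case
        by (simp add: additive_zero[OF SG N.abelian_group f_add] additive_zero[OF SG M.abelian_group h_add]
          additive_zero[OF M.abelian_group N.abelian_group p_add])
    next
      case (add x i y)
      let ?s = "direct_sum_single I ?Q i y"
      have s: "?s \<in> carrier S" using add by (intro single_closed)
      have "p (h ?s) = y \<odot>\<^bsub>N\<^esub> f (direct_sum_single I ?Q i (e i))"
        using add Q m by (simp add: single left_module_hom_smult[OF p] pm)
      also have "\<dots> = f (direct_sum_single I ?Q i (y \<otimes>\<^bsub>R\<^esub> e i))"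
        using add Q e_mem by (simp add: left_module_hom_smult[OF f, symmetric] single_closed single_smult)
      finally have "p (h ?s) = f ?s" using add Q by simp
      then show ?case
        using add s closed
        by (simp add: additive_add[OF f_add] additive_add[OF h_add] additive_add[OF p_add])
    qed
    with h show "\<exists>h\<in>left_module_hom R S M. \<forall>x\<in>carrier S. p (h x) = f x" by blast
  qed
qed

subsection \<open>Exactness from a contracting homotopy\<close>

text \<open>
  The homotopy identity alone forces \<open>d \<circ> d = 0\<close>: inductively \<open>d d h = d (1 - h d) = d - (1 - h d) d\<close>
  vanishes, and the image of \<open>h\<close> generates.
\<close>

lemma projective_resolution_from_homotopy:
  fixes R :: "('a, 'c) ring_scheme" and P :: "nat \<Rightarrow> ('a, 'p, 'd) module_scheme"
    and B :: "('a, 'b, 'e) module_scheme"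
  assumes B: "left_module R B"
    and P: "\<And>n. projective_module TYPE('m) TYPE('n) R (P n)"
    and d0: "d0 \<in> left_module_hom R (P 0) B"
    and d: "\<And>n. d (Suc n) \<in> left_module_hom R (P (Suc n)) (P n)"
    and hB: "hB \<in> hom (add_monoid B) (add_monoid (P 0))"
    and h: "\<And>n. h n \<in> hom (add_monoid (P n)) (add_monoid (P (Suc n)))"
    and id_B: "\<And>b. b \<in> carrier B \<Longrightarrow> d0 (hB b) = b"
    and id_0: "\<And>x. x \<in> carrier (P 0) \<Longrightarrow> d (Suc 0) (h 0 x) \<oplus>\<^bsub>P 0\<^esub> hB (d0 x) = x"
    and id_Suc: "\<And>n x. x \<in> carrier (P (Suc n)) \<Longrightarrow>
      d (Suc (Suc n)) (h (Suc n) x) \<oplus>\<^bsub>P (Suc n)\<^esub> h n (d (Suc n) x) = x"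
    and generates: "\<And>n Q y. \<lbrakk>Q \<zero>\<^bsub>P (Suc n)\<^esub>;
      \<And>y a x. \<lbrakk>Q y; y \<in> carrier (P (Suc n)); a \<in> carrier R; x \<in> carrier (P n)\<rbrakk> \<Longrightarrow>
        Q (y \<oplus>\<^bsub>P (Suc n)\<^esub> a \<odot>\<^bsub>P (Suc n)\<^esub> h n x);
      y \<in> carrier (P (Suc n))\<rbrakk> \<Longrightarrow> Q y"
  shows "projective_resolution TYPE('m) TYPE('n) R P d d0 B"
proof -
  interpret B: left_module R B by (rule B)
  have PM: "left_module R (P n)" for n using P by (auto simp: projective_module_def)
  interpret P: left_module R "P n" for n by (rule PM)
  note gB = B.abelian_group and gP = P.abelian_group
  note d0_add = left_module_hom_additive[OF d0] and d_add = left_module_hom_additive[OF d]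
  note closed [simp] = additive_closed[OF d0_add] additive_closed[OF d_add] additive_closed[OF hB]
    additive_closed[OF h]
  note zero [simp] = additive_zero[OF gP gB d0_add] additive_zero[OF gP gP d_add]
    additive_zero[OF gB gP hB] additive_zero[OF gP gP h]

  \<comment> \<open>Both \<open>f\<close> and \<open>d (Suc n)\<close> are \<open>R\<close>-linear,
    so their composite vanishes once it does on the generators \<open>h n x\<close>, although
    \<open>h n\<close> is only additive. The target \<open>N\<close> stays arbitrary because the
    bottom case maps to \<open>B\<close> and the others to some \<open>P n\<close>.\<close>
  have vanish: "f (d (Suc n) y) = \<zero>\<^bsub>N\<^esub>"
    if N: "left_module R N" and f: "f \<in> left_module_hom R (P n) N"
      and 0: "\<And>x. x \<in> carrier (P n) \<Longrightarrow> f (d (Suc n) (h n x)) = \<zero>\<^bsub>N\<^esub>"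
      and y: "y \<in> carrier (P (Suc n))"
    for N :: "('a, 'z, 'w) module_scheme" and f n y
  proof -
    interpret N: left_module R N by (rule N)
    note f_add = left_module_hom_additive[OF f]
    show ?thesis using _ _ y
    proof (rule generates)
      show "f (d (Suc n) \<zero>\<^bsub>P (Suc n)\<^esub>) = \<zero>\<^bsub>N\<^esub>"
        by (simp add: additive_zero[OF gP N.abelian_group f_add])
    next
      fix y a x
      assume *: "f (d (Suc n) y) = \<zero>\<^bsub>N\<^esub>" "y \<in> carrier (P (Suc n))" "a \<in> carrier R" "x \<in> carrier (P n)"
      then show "f (d (Suc n) (y \<oplus>\<^bsub>P (Suc n)\<^esub> a \<odot>\<^bsub>P (Suc n)\<^esub> h n x)) = \<zero>\<^bsub>N\<^esub>"
        using 0 by (simp add: additive_add[OF d_add] additive_add[OF f_add] P.smult_closed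
            left_module_hom_smult[OF d] left_module_hom_smult[OF f] N.smult_r_null)
    qed
  qed

  \<comment> \<open>Apply \<open>d0\<close> to the homotopy identity: by \<open>id_B\<close> the
    section term already contributes all of \<open>d0 x\<close>, so the other term must
    cancel.\<close>
  have dd0: "d0 (d (Suc 0) y) = \<zero>\<^bsub>B\<^esub>" if "y \<in> carrier (P (Suc 0))" for y
  proof (rule vanish[OF B d0 _ that])
    fix x assume x: "x \<in> carrier (P 0)"
    have "d0 x = d0 (d (Suc 0) (h 0 x)) \<oplus>\<^bsub>B\<^esub> d0 (hB (d0 x))"
      using arg_cong[OF id_0[OF x], of d0] x by (simp add: additive_add[OF d0_add])
    then have "d0 (d (Suc 0) (h 0 x)) \<oplus>\<^bsub>B\<^esub> d0 x = \<zero>\<^bsub>B\<^esub> \<oplus>\<^bsub>B\<^esub> d0 x"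
      using x by (simp add: id_B)
    then show "d0 (d (Suc 0) (h 0 x)) = \<zero>\<^bsub>B\<^esub>"
      by (subst (asm) B.add.right_cancel) (use x in auto)
  qed
  have dd: "d (Suc n) (d (Suc (Suc n)) y) = \<zero>\<^bsub>P n\<^esub>" if "y \<in> carrier (P (Suc (Suc n)))" for n y
    using that
  proof (induction n arbitrary: y)
    case 0
    show ?case
    proof (rule vanish[OF PM d _ 0])
      fix x assume x: "x \<in> carrier (P (Suc 0))"
      have "d (Suc 0) x = d (Suc 0) (d (Suc (Suc 0)) (h (Suc 0) x)) \<oplus>\<^bsub>P 0\<^esub> d (Suc 0) (h 0 (d (Suc 0) x))"
        using arg_cong[OF id_Suc[OF x], of "d (Suc 0)"] x by (simp add: additive_add[OF d_add])
      \<comment> \<open>In degree 0 the homotopy has an extra term through \<open>B\<close>;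
        \<open>dd0\<close> kills it on boundaries.\<close>
      moreover have "d (Suc 0) (h 0 (d (Suc 0) x)) = d (Suc 0) x"
        using id_0[of "d (Suc 0) x"] x by (simp add: dd0)
      ultimately have "d (Suc 0) (d (Suc (Suc 0)) (h (Suc 0) x)) \<oplus>\<^bsub>P 0\<^esub> d (Suc 0) x = \<zero>\<^bsub>P 0\<^esub> \<oplus>\<^bsub>P 0\<^esub> d (Suc 0) x"
        using x by simp
      then show "d (Suc 0) (d (Suc (Suc 0)) (h (Suc 0) x)) = \<zero>\<^bsub>P 0\<^esub>"
        by (subst (asm) P.add.right_cancel) (use x in auto)
    qed
  next
    case (Suc n)
    show ?case
    proof (rule vanish[OF PM d _ Suc.prems])
      fix x assume x: "x \<in> carrier (P (Suc (Suc n)))"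
      let ?d = "d (Suc (Suc n))"
      have "?d x = ?d (d (Suc (Suc (Suc n))) (h (Suc (Suc n)) x)) \<oplus>\<^bsub>P (Suc n)\<^esub> ?d (h (Suc n) (?d x))"
        using arg_cong[OF id_Suc[OF x], of ?d] x by (simp add: additive_add[OF d_add])
      moreover have "?d (h (Suc n) (?d x)) = ?d x"
        using id_Suc[of "?d x" n] x by (simp add: Suc.IH)
      ultimately have "?d (d (Suc (Suc (Suc n))) (h (Suc (Suc n)) x)) \<oplus>\<^bsub>P (Suc n)\<^esub> ?d x =
          \<zero>\<^bsub>P (Suc n)\<^esub> \<oplus>\<^bsub>P (Suc n)\<^esub> ?d x"
        using x by simp
      then show "?d (d (Suc (Suc (Suc n))) (h (Suc (Suc n)) x)) = \<zero>\<^bsub>P (Suc n)\<^esub>"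
        by (subst (asm) P.add.right_cancel) (use x in auto)
    qed
  qed

  have "d0 ` carrier (P 0) = carrier B"
    using id_B by (auto simp: image_iff) (metis closed(3))
  moreover have "d (Suc 0) ` carrier (P (Suc 0)) = a_kernel (P 0) B d0"
  proof -
    have "x \<in> d (Suc 0) ` carrier (P (Suc 0))" if "x \<in> carrier (P 0)" "d0 x = \<zero>\<^bsub>B\<^esub>" for x
      using id_0[OF that(1)] that by (intro image_eqI[where x = "h 0 x"]) simp_all
    then show ?thesis by (auto simp: a_kernel_def' dd0)
  qed
  moreover have "d (Suc (Suc n)) ` carrier (P (Suc (Suc n))) = a_kernel (P (Suc n)) (P n) (d (Suc n))" for n
  proof -
    have "x \<in> d (Suc (Suc n)) ` carrier (P (Suc (Suc n)))"
      if "x \<in> carrier (P (Suc n))" "d (Suc n) x = \<zero>\<^bsub>P n\<^esub>" for x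
      using id_Suc[OF that(1)] that by (intro image_eqI[where x = "h (Suc n) x"]) simp_all
    then show ?thesis by (auto simp: a_kernel_def' dd)
  qed
  ultimately show ?thesis
    using B P d0 d by (auto simp: projective_resolution_def)
qed

section \<open>Free modules and semigroup algebras\<close>

lemma free_carrier_mono: "X \<subseteq> Y \<Longrightarrow> free_carrier K X \<subseteq> free_carrier K Y"
  by (auto simp: free_carrier_def)

section \<open>Finitely supported functions and their bilinear extensions\<close>

context cring
begin

lemma free_carrierD:
  assumes "f \<in> free_carrier R X"
  shows "f s \<in> carrier R" "finite {s. f s \<noteq> \<zero>}" "f s \<noteq> \<zero> \<Longrightarrow> s \<in> X"
  using assms by (auto simp: free_carrier_def)

lemma free_carrier_zero: "(\<lambda>_. \<zero>) \<in> free_carrier R X"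
  by (auto simp: free_carrier_def)

lemma free_carrier_add:
  assumes "f \<in> free_carrier R X" "g \<in> free_carrier R X"
  shows "(\<lambda>s. f s \<oplus> g s) \<in> free_carrier R X"
proof -
  have "{s. f s \<oplus> g s \<noteq> \<zero>} \<subseteq> {s. f s \<noteq> \<zero>} \<union> {s. g s \<noteq> \<zero>}"
    by auto
  from finite_subset[OF this] have "finite {s. f s \<oplus> g s \<noteq> \<zero>}"
    using assms free_carrierD(2) by auto
  moreover have "s \<in> X" if "f s \<oplus> g s \<noteq> \<zero>" for s
    using that free_carrierD(3)[OF assms(1), of s] free_carrierD(3)[OF assms(2), of s] by fastforce
  ultimately show ?thesis
    using assms by (auto simp: free_carrier_def)
qed

lemma monomial_in_free_carrier:
  assumes "c \<in> carrier R" "c \<noteq> \<zero> \<Longrightarrow> s \<in> X"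
  shows "monomial R c s \<in> free_carrier R X"
proof -
  have "{x. monomial R c s x \<noteq> \<zero>} \<subseteq> {s}" by (auto simp: monomial_def)
  from finite_subset[OF this] show ?thesis
    using assms by (auto simp: free_carrier_def monomial_def split: if_splits)
qed

lemma monomial_add:
  "\<lbrakk>c \<in> carrier R; d \<in> carrier R\<rbrakk> \<Longrightarrow>
    (\<lambda>x. monomial R c s x \<oplus> monomial R d s x) = monomial R (c \<oplus> d) s"
  by (auto simp: monomial_def)

lemma free_carrier_induct [consumes 1, case_names zero add]:
  assumes f: "f \<in> free_carrier R X"
    and zero: "P (\<lambda>_. \<zero>)"
    and add: "\<And>f c s. \<lbrakk>f \<in> free_carrier R X; P f; c \<in> carrier R; s \<in> X\<rbrakk> \<Longrightarrow>
      P (\<lambda>x. f x \<oplus> monomial R c s x)"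
  shows "P f"
proof -
  have "finite F \<Longrightarrow> f \<in> free_carrier R X \<Longrightarrow> {s. f s \<noteq> \<zero>} \<subseteq> F \<Longrightarrow> P f" for F
  proof (induction F arbitrary: f rule: finite_induct)
    case empty
    then have "f = (\<lambda>_. \<zero>)" by auto
    with zero show ?case by simp
  next
    case (insert s F)
    show ?case
    proof (cases "f s = \<zero>")
      case True
      with insert show ?thesis by blast
    next
      case False
      define f' where "f' = f(s := \<zero>)"
      have "{x. f' x \<noteq> \<zero>} \<subseteq> {x. f x \<noteq> \<zero>}" by (auto simp: f'_def)
      from finite_subset[OF this] have f': "f' \<in> free_carrier R X"
        using insert.prems by (auto simp: free_carrier_def f'_def split: if_splits)
      have "f = (\<lambda>x. f' x \<oplus> monomial R (f s) s x)"
        using free_carrierD(1)[OF insert.prems(1)] by (auto simp: f'_def monomial_def fun_eq_iff)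
      moreover have "P f'"
        using insert.prems by (intro insert.IH f') (auto simp: f'_def)
      ultimately show ?thesis
        using add[OF f'] insert.prems False by (metis free_carrierD(1,3))
    qed
  qed
  then show ?thesis using free_carrierD(2)[OF f] f by auto
qed

text \<open>Phrased through the record fields so that it covers both the semigroup algebra and
  modules over it.\<close>

lemma free_carrier_abelian_group:
  assumes "carrier M = free_carrier R X" "zero M = (\<lambda>_. \<zero>)" "add M = (\<lambda>f g s. f s \<oplus> g s)"
  shows "abelian_group M"
proof (rule abelian_groupI)
  fix f assume f: "f \<in> carrier M"
  have "{s. \<ominus> f s \<noteq> \<zero>} \<subseteq> {s. f s \<noteq> \<zero>}" by auto
  from finite_subset[OF this] have "(\<lambda>s. \<ominus> f s) \<in> carrier M"
    using f by (force simp: assms free_carrier_def)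
  then show "\<exists>g\<in>carrier M. g \<oplus>\<^bsub>M\<^esub> f = \<zero>\<^bsub>M\<^esub>"
    using f by (intro bexI) (auto simp: assms fun_eq_iff l_neg free_carrierD)
qed (auto simp: assms free_carrier_add free_carrier_zero fun_eq_iff free_carrierD a_ac)

text \<open>In the definition the index set depends on \<open>f\<close>, \<open>g\<close> and
  \<open>x\<close>. A fixed rectangle containing the supports makes the sums for different arguments
  comparable term by term.\<close>

lemma bilinear_ext_eq:
  assumes f: "f \<in> free_carrier R X" and g: "g \<in> free_carrier R Y"
    and A: "finite A" "{s. f s \<noteq> \<zero>} \<subseteq> A" and B: "finite B" "{s. g s \<noteq> \<zero>} \<subseteq> B"
  shows "bilinear_ext R \<phi> f g x =
    (\<Oplus>p\<in>A \<times> B. if \<phi> (fst p) (snd p) = x then f (fst p) \<otimes> g (snd p) else \<zero>)"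
  unfolding bilinear_ext_def
  using A B free_carrierD(1)[OF f] free_carrierD(1)[OF g]
  by (intro add.finprod_mono_neutral_cong_left) auto

lemma bilinear_ext_zero [simp]:
  "bilinear_ext R \<phi> (\<lambda>_. \<zero>) g = (\<lambda>_. \<zero>)" "bilinear_ext R \<phi> f (\<lambda>_. \<zero>) = (\<lambda>_. \<zero>)"
  by (auto simp: bilinear_ext_def)

lemma bilinear_ext_add_left:
  assumes f: "f \<in> free_carrier R X" and f': "f' \<in> free_carrier R X" and g: "g \<in> free_carrier R Y"
  shows "bilinear_ext R \<phi> (\<lambda>s. f s \<oplus> f' s) g = (\<lambda>x. bilinear_ext R \<phi> f g x \<oplus> bilinear_ext R \<phi> f' g x)"
proof
  fix x
  let ?A = "{s. f s \<noteq> \<zero>} \<union> {s. f' s \<noteq> \<zero>}" and ?B = "{s. g s \<noteq> \<zero>}"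
  note c = free_carrierD(1)[OF f] free_carrierD(1)[OF f'] free_carrierD(1)[OF g]
  have fin: "finite ?A" "finite ?B"
    using assms free_carrierD(2) by auto
  have "bilinear_ext R \<phi> (\<lambda>s. f s \<oplus> f' s) g x =
      (\<Oplus>p\<in>?A \<times> ?B. if \<phi> (fst p) (snd p) = x then (f (fst p) \<oplus> f' (fst p)) \<otimes> g (snd p) else \<zero>)"
    by (rule bilinear_ext_eq[OF free_carrier_add[OF f f'] g fin(1) _ fin(2)]) auto
  also have "\<dots> = (\<Oplus>p\<in>?A \<times> ?B. (if \<phi> (fst p) (snd p) = x then f (fst p) \<otimes> g (snd p) else \<zero>) \<oplus>
      (if \<phi> (fst p) (snd p) = x then f' (fst p) \<otimes> g (snd p) else \<zero>))"
    using c by (intro finsum_cong') (auto simp: l_distr)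
  also have "\<dots> = bilinear_ext R \<phi> f g x \<oplus> bilinear_ext R \<phi> f' g x"
    using c fin
    by (subst finsum_addf)
      (auto simp: bilinear_ext_eq[OF f g, of ?A ?B] bilinear_ext_eq[OF f' g, of ?A ?B])
  finally show "bilinear_ext R \<phi> (\<lambda>s. f s \<oplus> f' s) g x =
      bilinear_ext R \<phi> f g x \<oplus> bilinear_ext R \<phi> f' g x" .
qed

text \<open>Commutativity of the coefficient ring exchanges the two arguments, so additivity on the
  right follows from additivity on the left.\<close>

lemma bilinear_ext_swap:
  assumes "f \<in> free_carrier R X" "g \<in> free_carrier R Y"
  shows "bilinear_ext R \<phi> f g = bilinear_ext R (\<lambda>t s. \<phi> s t) g f"
proof
  fix x
  let ?I = "{(t, s). g t \<noteq> \<zero> \<and> f s \<noteq> \<zero> \<and> \<phi> s t = x}"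
  have "(\<Oplus>p\<in>prod.swap ` ?I. f (fst p) \<otimes> g (snd p)) = (\<Oplus>p\<in>?I. f (snd p) \<otimes> g (fst p))"
    using assms by (subst finsum_reindex) (auto simp: free_carrierD)
  also have "\<dots> = (\<Oplus>p\<in>?I. g (fst p) \<otimes> f (snd p))"
    using assms by (intro finsum_cong') (auto simp: free_carrierD m_comm)
  also have "prod.swap ` ?I = {(s, t). f s \<noteq> \<zero> \<and> g t \<noteq> \<zero> \<and> \<phi> s t = x}"
    by (auto simp: image_iff)
  finally show "bilinear_ext R \<phi> f g x = bilinear_ext R (\<lambda>t s. \<phi> s t) g f x"
    by (simp add: bilinear_ext_def)
qed

lemma bilinear_ext_add_right:
  assumes "f \<in> free_carrier R X" "g \<in> free_carrier R Y" "g' \<in> free_carrier R Y"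
  shows "bilinear_ext R \<phi> f (\<lambda>s. g s \<oplus> g' s) = (\<lambda>x. bilinear_ext R \<phi> f g x \<oplus> bilinear_ext R \<phi> f g' x)"
  using bilinear_ext_add_left[OF assms(2,3,1), of "\<lambda>t s. \<phi> s t"]
  by (simp add: bilinear_ext_swap[OF assms(1) assms(2)] bilinear_ext_swap[OF assms(1) assms(3)]
      bilinear_ext_swap[OF assms(1) free_carrier_add[OF assms(2,3)]])

lemma bilinear_ext_monomial:
  assumes "c \<in> carrier R" "d \<in> carrier R"
  shows "bilinear_ext R \<phi> (monomial R c s) (monomial R d t) = monomial R (c \<otimes> d) (\<phi> s t)"
proof
  fix x
  have "bilinear_ext R \<phi> (monomial R c s) (monomial R d t) x =
      (\<Oplus>p\<in>{s} \<times> {t}. if \<phi> (fst p) (snd p) = x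
        then monomial R c s (fst p) \<otimes> monomial R d t (snd p) else \<zero>)"
    using assms by (intro bilinear_ext_eq monomial_in_free_carrier) (auto simp: monomial_def)
  then show "bilinear_ext R \<phi> (monomial R c s) (monomial R d t) x = monomial R (c \<otimes> d) (\<phi> s t) x"
    using assms by (auto simp: monomial_def)
qed

lemma bilinear_ext_closed:
  assumes f: "f \<in> free_carrier R X" and g: "g \<in> free_carrier R Y"
    and \<phi>: "\<And>s t. \<lbrakk>s \<in> X; t \<in> Y\<rbrakk> \<Longrightarrow> \<phi> s t \<in> Z"
  shows "bilinear_ext R \<phi> f g \<in> free_carrier R Z"
  using f
proof (induction f rule: free_carrier_induct)
  case (add f c s)
  have "bilinear_ext R \<phi> (monomial R c s) g \<in> free_carrier R Z"
    using g
  proof (induction g rule: free_carrier_induct)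
    case (add g d t)
    then show ?case
      using \<open>c \<in> carrier R\<close> \<open>s \<in> X\<close> \<phi>
      by (simp add: bilinear_ext_add_right[of _ X _ Y] monomial_in_free_carrier bilinear_ext_monomial
          free_carrier_add)
  qed (simp add: free_carrier_zero)
  with add show ?case
    by (simp add: bilinear_ext_add_left[OF _ _ g, of _ X] monomial_in_free_carrier free_carrier_add)
qed (simp add: free_carrier_zero)

text \<open>Both sides are trilinear, so monomials suffice. Four separate maps are allowed in order
  to cover associativity of the algebra as well as the action law \<open>(s t) x = s (t x)\<close>,
  where product and action differ.\<close>

lemma bilinear_ext_assoc:
  assumes f: "f \<in> free_carrier R X" and g: "g \<in> free_carrier R Y" and h: "h \<in> free_carrier R Z"
    and assoc: "\<And>s t u. \<lbrakk>s \<in> X; t \<in> Y; u \<in> Z\<rbrakk> \<Longrightarrow> \<phi> (\<psi> s t) u = \<phi>' s (\<psi>' t u)"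
  shows "bilinear_ext R \<phi> (bilinear_ext R \<psi> f g) h = bilinear_ext R \<phi>' f (bilinear_ext R \<psi>' g h)"
proof -
  \<comment> \<open>Additivity is applied with unrestricted support, which makes its closure
    conditions easy. The inductions themselves keep \<open>X\<close>, \<open>Y\<close> and
    \<open>Z\<close>, where \<open>assoc\<close> is available.\<close>
  let ?U = "free_carrier R UNIV"
  have U: "a \<in> ?U" if "a \<in> free_carrier R V" for a V
    using that free_carrier_mono[of V UNIV] by blast
  have C: "bilinear_ext R \<theta> a b \<in> ?U" if "a \<in> ?U" "b \<in> ?U" for a b \<theta>
    using that by (rule bilinear_ext_closed) simp
  have M: "monomial R c s \<in> ?U" if "c \<in> carrier R" for c s
    using that by (intro monomial_in_free_carrier) auto
  note simps = bilinear_ext_add_left[where X = UNIV and Y = UNIV]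
    bilinear_ext_add_right[where X = UNIV and Y = UNIV] bilinear_ext_monomial C M
  have 1: "bilinear_ext R \<phi> (bilinear_ext R \<psi> (monomial R c s) (monomial R d t)) h =
      bilinear_ext R \<phi>' (monomial R c s) (bilinear_ext R \<psi>' (monomial R d t) h)"
    if "c \<in> carrier R" "s \<in> X" "d \<in> carrier R" "t \<in> Y" for c d s t
    using h
  proof (induction h rule: free_carrier_induct)
    case (add h e u)
    then show ?case using that U[OF add.hyps(1)] by (simp add: simps m_assoc assoc)
  qed simp
  have 2: "bilinear_ext R \<phi> (bilinear_ext R \<psi> (monomial R c s) g) h =
      bilinear_ext R \<phi>' (monomial R c s) (bilinear_ext R \<psi>' g h)"
    if "c \<in> carrier R" "s \<in> X" for c s
    using g
  proof (induction g rule: free_carrier_induct)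
    case (add g d t)
    then show ?case using that U[OF add.hyps(1)] U[OF h] 1[OF that add.hyps(2,3)] by (simp add: simps)
  qed simp
  show ?thesis
    using f
  proof (induction f rule: free_carrier_induct)
    case (add f c s)
    then show ?case using U[OF add.hyps(1)] U[OF g] U[OF h] by (simp add: simps 2)
  qed simp
qed

text \<open>The linearisation of an action of the monoid \<open>S\<close> on the set
  \<open>X\<close>; for \<open>B\<close> the action is conjugation on idempotents.\<close>

lemma left_module_free_carrier:
  assumes S: "monoid S"
    and M: "carrier M = free_carrier R X" "zero M = (\<lambda>_. \<zero>)" "add M = (\<lambda>f g s. f s \<oplus> g s)"
      "smult M = bilinear_ext R \<phi>"
    and ring: "Ring.ring (semigroup_algebra R S)"
    and closed: "\<And>s x. \<lbrakk>s \<in> carrier S; x \<in> X\<rbrakk> \<Longrightarrow> \<phi> s x \<in> X"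
    and one: "\<And>x. x \<in> X \<Longrightarrow> \<phi> \<one>\<^bsub>S\<^esub> x = x"
    and assoc: "\<And>s t x. \<lbrakk>s \<in> carrier S; t \<in> carrier S; x \<in> X\<rbrakk> \<Longrightarrow> \<phi> (s \<otimes>\<^bsub>S\<^esub> t) x = \<phi> s (\<phi> t x)"
  shows "left_module (semigroup_algebra R S) M"
proof (intro left_module.intro left_module_axioms.intro ring free_carrier_abelian_group[OF M(1-3)])
  interpret S: monoid S by (rule S)
  fix x assume "x \<in> carrier M"
  then have "x \<in> free_carrier R X" by (simp add: M)
  then have "bilinear_ext R \<phi> (monomial R \<one> \<one>\<^bsub>S\<^esub>) x = x"
  proof (induction x rule: free_carrier_induct)
    case (add f c s)
    then show ?case
      by (simp add: bilinear_ext_add_right[where X = "carrier S" and Y = X] monomial_in_free_carrier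
          bilinear_ext_monomial one)
  qed simp
  then show "\<one>\<^bsub>semigroup_algebra R S\<^esub> \<odot>\<^bsub>M\<^esub> x = x"
    by (simp add: M semigroup_algebra_def)
qed (auto simp: M semigroup_algebra_def bilinear_ext_add_left bilinear_ext_add_right
    intro!: bilinear_ext_closed[of _ "carrier S" _ X] closed bilinear_ext_assoc assoc)

lemma ring_semigroup_algebra:
  assumes "monoid S"
  shows "Ring.ring (semigroup_algebra R S)"
proof -
  interpret S: monoid S by (rule assms)
  let ?A = "semigroup_algebra R S"
  have one: "monomial R \<one> \<one>\<^bsub>S\<^esub> \<in> free_carrier R (carrier S)"
    by (simp add: monomial_in_free_carrier)
  show ?thesis
  proof (intro ringI free_carrier_abelian_group monoidI)
    fix x assume "x \<in> carrier ?A"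
    then have x: "x \<in> free_carrier R (carrier S)" by (simp add: semigroup_algebra_def)
    then have "bilinear_ext R (mult S) (monomial R \<one> \<one>\<^bsub>S\<^esub>) x = x \<and>
        bilinear_ext R (mult S) x (monomial R \<one> \<one>\<^bsub>S\<^esub>) = x"
    proof (induction x rule: free_carrier_induct)
      case (add f c s)
      then show ?case
        by (simp add: bilinear_ext_add_right[OF one] bilinear_ext_add_left[OF _ _ one]
            monomial_in_free_carrier bilinear_ext_monomial)
    qed simp
    then show "\<one>\<^bsub>?A\<^esub> \<otimes>\<^bsub>?A\<^esub> x = x" "x \<otimes>\<^bsub>?A\<^esub> \<one>\<^bsub>?A\<^esub> = x"
      by (simp_all add: semigroup_algebra_def)
  qed (auto simp: semigroup_algebra_def bilinear_ext_add_left bilinear_ext_add_right one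
      intro!: bilinear_ext_closed[of _ "carrier S" _ "carrier S"] S.m_closed
        bilinear_ext_assoc S.m_assoc)
qed

end

section \<open>The normal form in the partial group monoid\<close>

\<comment> \<open>otherwise \<open>auto\<close> unfolds list membership into a form that the simplifier cannot use for side conditions\<close>
declare in_listsD [rule del] in_listsI [rule del]

definition word_prod :: "('g, 'd) monoid_scheme \<Rightarrow> 'g list \<Rightarrow> 'g" where
  "word_prod G u = foldr (mult G) u \<one>\<^bsub>G\<^esub>"

text \<open>The vertices of the path that the word traces from the identity in the Cayley graph, in
  order and with repetitions.\<close>

primrec prefix_prods :: "('g, 'd) monoid_scheme \<Rightarrow> 'g list \<Rightarrow> 'g list" where
  "prefix_prods G [] = [\<one>\<^bsub>G\<^esub>]"
| "prefix_prods G (g # u) = \<one>\<^bsub>G\<^esub> # map (mult G g) (prefix_prods G u)"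

text \<open>
  The pair \<open>(V, g)\<close> that belongs to \<open>s\<close> is \<open>(par_supp G s, par_deg G s)\<close>; it does not depend on the
  word chosen from the class \<open>s\<close>.
\<close>

definition par_deg :: "('g, 'd) monoid_scheme \<Rightarrow> 'g list set \<Rightarrow> 'g" where
  "par_deg G s = word_prod G (SOME u. u \<in> s)"

definition par_supp :: "('g, 'd) monoid_scheme \<Rightarrow> 'g list set \<Rightarrow> 'g set" where
  "par_supp G s = set (prefix_prods G (SOME u. u \<in> s))"

definition par_e_prod :: "('g, 'd) monoid_scheme \<Rightarrow> 'g list \<Rightarrow> 'g list set" where
  "par_e_prod G hs = foldr (mult (par_monoid G)) (map (par_e G) hs) \<one>\<^bsub>par_monoid G\<^esub>"

context group
begin

lemma mult_image_mult_image:
  assumes "g \<in> carrier G" "h \<in> carrier G" "A \<subseteq> carrier G"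
  shows "mult G g ` mult G h ` A = mult G (g \<otimes> h) ` A"
  unfolding image_image using assms by (intro image_cong refl) (auto simp: m_assoc)

lemma mult_one_image: "A \<subseteq> carrier G \<Longrightarrow> mult G \<one> ` A = A"
  by force

lemma word_prod_simps [simp]:
  "word_prod G [] = \<one>" "word_prod G (g # u) = g \<otimes> word_prod G u"
  by (simp_all add: word_prod_def)

lemma word_prod_closed [simp]: "u \<in> lists (carrier G) \<Longrightarrow> word_prod G u \<in> carrier G"
  by (induction u) auto

lemma word_prod_append:
  "\<lbrakk>u \<in> lists (carrier G); v \<in> lists (carrier G)\<rbrakk> \<Longrightarrow>
    word_prod G (u @ v) = word_prod G u \<otimes> word_prod G v"
  by (induction u) (auto simp: m_assoc)

lemma prefix_prods_closed: "u \<in> lists (carrier G) \<Longrightarrow> set (prefix_prods G u) \<subseteq> carrier G"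
  by (induction u) auto

lemma prefix_prods_in_lists [simp]:
  "u \<in> lists (carrier G) \<Longrightarrow> prefix_prods G u \<in> lists (carrier G)"
  using prefix_prods_closed by (auto simp: in_lists_conv_set)

lemma one_in_prefix_prods: "\<one> \<in> set (prefix_prods G u)"
  by (cases u) auto

lemma word_prod_in_prefix_prods: "word_prod G u \<in> set (prefix_prods G u)"
  by (induction u) auto

lemma set_prefix_prods_append:
  assumes "u \<in> lists (carrier G)" "v \<in> lists (carrier G)"
  shows "set (prefix_prods G (u @ v)) =
    set (prefix_prods G u) \<union> mult G (word_prod G u) ` set (prefix_prods G v)"
  using assms
proof (induction u)
  case Nil
  show ?case using one_in_prefix_prods prefix_prods_closed[OF assms(2)] by (auto simp: mult_one_image)
next
  case (Cons g u)
  then have "g \<in> carrier G" "word_prod G u \<in> carrier G" by (auto intro!: word_prod_closed)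
  then show ?case
    using Cons mult_image_mult_image[OF _ _ prefix_prods_closed[OF assms(2)]] by (simp add: image_Un)
qed

lemma prefix_prods_eq:
  "prefix_prods G gs = map (\<lambda>k. word_prod G (take k gs)) [0..<Suc (length gs)]"
proof (induction gs)
  case (Cons g gs)
  have "map (\<lambda>k. word_prod G (take k (g # gs))) [0..<Suc (length (g # gs))] =
      word_prod G (take 0 (g # gs)) # map (\<lambda>k. word_prod G (take (Suc k) (g # gs))) [0..<Suc (length gs)]"
    unfolding length_Cons by (rule map_upt_Suc)
  then show ?case using Cons by simp
qed simp

section \<open>The invariants of the congruence, and the quotient monoid\<close>

lemma par_cong_lists: "par_cong G u v \<Longrightarrow> u \<in> lists (carrier G) \<and> v \<in> lists (carrier G)"
  by (induction rule: par_cong.induct) auto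

text \<open>Each relation keeps the endpoint of the path and its set of visited vertices. For
  \<open>rel_left\<close> the paths are \<open>1, inv g, 1, h\<close> and
  \<open>1, inv g, h\<close>; for \<open>rel_right\<close> they are \<open>1, g, gh, g\<close> and
  \<open>1, gh, g\<close>. Compatibility with \<open>append\<close> is translation of the second
  path by the endpoint of the first.\<close>

lemma par_cong_invariant:
  "par_cong G u v \<Longrightarrow>
    word_prod G u = word_prod G v \<and> set (prefix_prods G u) = set (prefix_prods G v)"
proof (induction rule: par_cong.induct)
  case (append u u' v v')
  from append.hyps[THEN par_cong_lists] append.IH show ?case
    by (simp add: word_prod_append set_prefix_prods_append)
qed (auto simp: m_assoc[symmetric], auto simp: m_assoc)

lemma par_class_eq_iff:
  assumes "u \<in> lists (carrier G)"
  shows "par_class G u = par_class G v \<longleftrightarrow> par_cong G u v"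
proof
  assume "par_class G u = par_class G v"
  moreover have "u \<in> par_class G u" using assms by (simp add: par_class_def par_cong.refl)
  ultimately show "par_cong G u v" by (simp add: par_class_def par_cong.sym)
next
  assume "par_cong G u v"
  then show "par_class G u = par_class G v"
    unfolding par_class_def by (intro Collect_cong) (meson par_cong.sym par_cong.trans)
qed

lemma par_carrier: "carrier (par_monoid G) = par_class G ` lists (carrier G)"
  by (simp add: par_monoid_def)

lemma par_class_closed [simp]: "u \<in> lists (carrier G) \<Longrightarrow> par_class G u \<in> carrier (par_monoid G)"
  by (simp add: par_carrier)

lemma par_one: "\<one>\<^bsub>par_monoid G\<^esub> = par_class G []"
  by (simp add: par_monoid_def)

lemma par_mult_class:
  assumes "u \<in> lists (carrier G)" "v \<in> lists (carrier G)"
  shows "par_class G u \<otimes>\<^bsub>par_monoid G\<^esub> par_class G v = par_class G (u @ v)"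
proof -
  have "(\<exists>u'\<in>par_class G u. \<exists>v'\<in>par_class G v. par_cong G (u' @ v') w) \<longleftrightarrow> par_cong G (u @ v) w" for w
  proof
    assume "par_cong G (u @ v) w"
    then show "\<exists>u'\<in>par_class G u. \<exists>v'\<in>par_class G v. par_cong G (u' @ v') w"
      using assms by (intro bexI[of _ u] bexI[of _ v]) (simp_all add: par_class_def par_cong.refl)
  next
    assume "\<exists>u'\<in>par_class G u. \<exists>v'\<in>par_class G v. par_cong G (u' @ v') w"
    then obtain u' v' where "par_cong G u u'" "par_cong G v v'" "par_cong G (u' @ v') w"
      by (auto simp: par_class_def)
    then show "par_cong G (u @ v) w"
      by (rule par_cong.trans[OF par_cong.append])
  qed
  then show ?thesis by (simp add: par_monoid_def par_class_def)
qed

lemma monoid_par_monoid: "monoid (par_monoid G)"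
proof (rule monoidI)
  show "\<one>\<^bsub>par_monoid G\<^esub> \<in> carrier (par_monoid G)" by (simp add: par_one)
qed (auto simp: par_carrier par_mult_class par_one)

sublocale par: monoid "par_monoid G"
  by (rule monoid_par_monoid)

lemma par_reassoc:
  assumes "x \<otimes>\<^bsub>par_monoid G\<^esub> y = w" "x \<in> carrier (par_monoid G)" "y \<in> carrier (par_monoid G)"
    "z \<in> carrier (par_monoid G)"
  shows "x \<otimes>\<^bsub>par_monoid G\<^esub> (y \<otimes>\<^bsub>par_monoid G\<^esub> z) = w \<otimes>\<^bsub>par_monoid G\<^esub> z"
  using assms by (simp add: par.m_assoc[symmetric])

lemma par_supp_deg_class:
  assumes "u \<in> lists (carrier G)"
  shows "par_supp G (par_class G u) = set (prefix_prods G u)" "par_deg G (par_class G u) = word_prod G u"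
proof -
  have "u \<in> par_class G u" using assms by (simp add: par_class_def par_cong.refl)
  then have "(SOME v. v \<in> par_class G u) \<in> par_class G u" by (rule someI)
  then have "par_cong G u (SOME v. v \<in> par_class G u)" by (simp add: par_class_def)
  from par_cong_invariant[OF this]
  show "par_supp G (par_class G u) = set (prefix_prods G u)" "par_deg G (par_class G u) = word_prod G u"
    by (auto simp: par_supp_def par_deg_def)
qed

lemma par_deg_closed [simp]: "s \<in> carrier (par_monoid G) \<Longrightarrow> par_deg G s \<in> carrier G"
  by (auto simp: par_carrier par_supp_deg_class)

lemma par_supp_props:
  assumes "s \<in> carrier (par_monoid G)"
  shows "par_supp G s \<subseteq> carrier G" "finite (par_supp G s)" "\<one> \<in> par_supp G s" "par_deg G s \<in> par_supp G s"
  using assms unfolding par_carrier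
  by (auto simp: par_supp_deg_class one_in_prefix_prods word_prod_in_prefix_prods
      dest: prefix_prods_closed[THEN subsetD])

lemma par_deg_mult:
  "\<lbrakk>s \<in> carrier (par_monoid G); t \<in> carrier (par_monoid G)\<rbrakk> \<Longrightarrow>
    par_deg G (s \<otimes>\<^bsub>par_monoid G\<^esub> t) = par_deg G s \<otimes> par_deg G t"
  unfolding par_carrier
  by (elim imageE) (simp add: par_mult_class par_supp_deg_class word_prod_append)

lemma par_supp_mult:
  "\<lbrakk>s \<in> carrier (par_monoid G); t \<in> carrier (par_monoid G)\<rbrakk> \<Longrightarrow>
    par_supp G (s \<otimes>\<^bsub>par_monoid G\<^esub> t) = par_supp G s \<union> mult G (par_deg G s) ` par_supp G t"
  unfolding par_carrier
  by (elim imageE) (simp add: par_mult_class par_supp_deg_class set_prefix_prods_append)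

lemma par_supp_deg_one [simp]:
  "par_supp G \<one>\<^bsub>par_monoid G\<^esub> = {\<one>}" "par_deg G \<one>\<^bsub>par_monoid G\<^esub> = \<one>"
  by (simp_all add: par_one par_supp_deg_class)

lemma par_gen_closed [simp]: "g \<in> carrier G \<Longrightarrow> par_gen G g \<in> carrier (par_monoid G)"
  by (simp add: par_gen_def)

lemma par_e_closed [simp]: "g \<in> carrier G \<Longrightarrow> par_e G g \<in> carrier (par_monoid G)"
  by (simp add: par_e_def)

lemma par_supp_deg_gen:
  assumes "g \<in> carrier G"
  shows "par_supp G (par_gen G g) = {\<one>, g}" "par_deg G (par_gen G g) = g"
  using assms by (simp_all add: par_gen_def par_supp_deg_class)

lemma par_supp_deg_e:
  assumes "g \<in> carrier G"
  shows "par_supp G (par_e G g) = {\<one>, g}" "par_deg G (par_e G g) = \<one>"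
  using assms by (auto simp: par_e_def par_supp_mult par_deg_mult par_supp_deg_gen)

subsection \<open>Products of the idempotents \<open>e\<^sub>g\<close>\<close>

lemma par_gen_one: "par_gen G \<one> = \<one>\<^bsub>par_monoid G\<^esub>"
  by (simp add: par_gen_def par_one par_class_eq_iff par_cong.unit)

lemma par_gen_rel_left:
  assumes "g \<in> carrier G" "h \<in> carrier G"
  shows "par_gen G (inv g) \<otimes>\<^bsub>par_monoid G\<^esub> par_gen G g \<otimes>\<^bsub>par_monoid G\<^esub> par_gen G h =
    par_gen G (inv g) \<otimes>\<^bsub>par_monoid G\<^esub> par_gen G (g \<otimes> h)"
  using assms par_cong.rel_left[of g G h] by (simp add: par_gen_def par_mult_class par_class_eq_iff)

lemma par_gen_rel_right:
  assumes "g \<in> carrier G" "h \<in> carrier G"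
  shows "par_gen G g \<otimes>\<^bsub>par_monoid G\<^esub> par_gen G h \<otimes>\<^bsub>par_monoid G\<^esub> par_gen G (inv h) =
    par_gen G (g \<otimes> h) \<otimes>\<^bsub>par_monoid G\<^esub> par_gen G (inv h)"
  using assms par_cong.rel_right[of g G h] by (simp add: par_gen_def par_mult_class par_class_eq_iff)

text \<open>This is the first defining relation with \<open>inv g\<close> in place of
  \<open>g\<close>.\<close>

lemma par_e_mult_gen:
  assumes "g \<in> carrier G" "h \<in> carrier G"
  shows "par_e G g \<otimes>\<^bsub>par_monoid G\<^esub> par_gen G h = par_gen G g \<otimes>\<^bsub>par_monoid G\<^esub> par_gen G (inv g \<otimes> h)"
  using assms par_gen_rel_left[of "inv g" h] by (simp add: par_e_def)

lemma par_e_gen: "g \<in> carrier G \<Longrightarrow> par_e G g \<otimes>\<^bsub>par_monoid G\<^esub> par_gen G g = par_gen G g"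
  by (simp add: par_e_mult_gen par_gen_one)

text \<open>Merges two generators into one at the cost of an idempotent on the left; this drives the
  normal form.\<close>

lemma par_gen_gen:
  assumes "g \<in> carrier G" "h \<in> carrier G"
  shows "par_gen G g \<otimes>\<^bsub>par_monoid G\<^esub> par_gen G h = par_e G g \<otimes>\<^bsub>par_monoid G\<^esub> par_gen G (g \<otimes> h)"
  using assms by (simp add: par_e_mult_gen m_assoc[symmetric])

text \<open>Both sides equal \<open>[gh][inv h]\<close>: the left one by the second defining
  relation, the right one by \<open>par_e_mult_gen\<close>, because
  \<open>inv (gh) g = inv h\<close>.\<close>

lemma par_gen_e:
  assumes "g \<in> carrier G" "h \<in> carrier G"
  shows "par_gen G g \<otimes>\<^bsub>par_monoid G\<^esub> par_e G h = par_e G (g \<otimes> h) \<otimes>\<^bsub>par_monoid G\<^esub> par_gen G g"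
proof -
  have "inv (g \<otimes> h) \<otimes> g = inv h"
    using assms by (simp add: inv_mult_group m_assoc)
  then have "par_e G (g \<otimes> h) \<otimes>\<^bsub>par_monoid G\<^esub> par_gen G g =
      par_gen G (g \<otimes> h) \<otimes>\<^bsub>par_monoid G\<^esub> par_gen G (inv h)"
    using assms by (simp add: par_e_mult_gen)
  then show ?thesis
    using assms par_gen_rel_right[OF assms] by (simp add: par_e_def par.m_assoc)
qed

text \<open>Write \<open>e_g = [g][inv g]\<close> and pull \<open>e_h\<close> through both factors:
  \<open>[inv g]\<close> turns its index into \<open>inv g h\<close>, and \<open>[g]\<close> turns
  it back into \<open>h\<close>.\<close>

lemma par_e_comm:
  assumes "g \<in> carrier G" "h \<in> carrier G"
  shows "par_e G g \<otimes>\<^bsub>par_monoid G\<^esub> par_e G h = par_e G h \<otimes>\<^bsub>par_monoid G\<^esub> par_e G g"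
proof -
  have "par_e G g \<otimes>\<^bsub>par_monoid G\<^esub> par_e G h =
      par_gen G g \<otimes>\<^bsub>par_monoid G\<^esub> (par_gen G (inv g) \<otimes>\<^bsub>par_monoid G\<^esub> par_e G h)"
    using assms by (simp add: par_e_def[of G g] par.m_assoc)
  also have "\<dots> = par_gen G g \<otimes>\<^bsub>par_monoid G\<^esub> par_e G (inv g \<otimes> h) \<otimes>\<^bsub>par_monoid G\<^esub> par_gen G (inv g)"
    using assms par_gen_e[of "inv g" h] by (simp add: par.m_assoc)
  also have "\<dots> = par_e G h \<otimes>\<^bsub>par_monoid G\<^esub> par_gen G g \<otimes>\<^bsub>par_monoid G\<^esub> par_gen G (inv g)"
    using assms par_gen_e[of g "inv g \<otimes> h"] by (simp add: m_assoc[symmetric])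
  finally show ?thesis
    using assms by (simp add: par_e_def[of G g] par.m_assoc)
qed

lemma par_e_idem: "g \<in> carrier G \<Longrightarrow> par_e G g \<otimes>\<^bsub>par_monoid G\<^esub> par_e G g = par_e G g"
  using par_e_gen[of g] by (simp add: par_e_def[of G g] par.m_assoc[symmetric])

lemma par_e_prod_simps [simp]:
  "par_e_prod G [] = \<one>\<^bsub>par_monoid G\<^esub>"
  "par_e_prod G (h # hs) = par_e G h \<otimes>\<^bsub>par_monoid G\<^esub> par_e_prod G hs"
  by (simp_all add: par_e_prod_def)

lemma par_e_prod_closed [simp]:
  "hs \<in> lists (carrier G) \<Longrightarrow> par_e_prod G hs \<in> carrier (par_monoid G)"
  by (induction hs) auto

lemma par_e_e_prod_comm:
  assumes "g \<in> carrier G" "hs \<in> lists (carrier G)"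
  shows "par_e G g \<otimes>\<^bsub>par_monoid G\<^esub> par_e_prod G hs = par_e_prod G hs \<otimes>\<^bsub>par_monoid G\<^esub> par_e G g"
  using assms(2)
proof (induction hs)
  case (Cons h hs)
  have "par_e G g \<otimes>\<^bsub>par_monoid G\<^esub> par_e_prod G (h # hs) =
      par_e G h \<otimes>\<^bsub>par_monoid G\<^esub> (par_e G g \<otimes>\<^bsub>par_monoid G\<^esub> par_e_prod G hs)"
    using Cons.hyps assms(1) par_reassoc[OF par_e_comm[of g h]] by (simp add: par.m_assoc)
  then show ?case using Cons assms(1) by (simp add: par.m_assoc)
qed (use assms in simp)

lemma par_e_prod_comm:
  assumes "hs \<in> lists (carrier G)" "ks \<in> lists (carrier G)"
  shows "par_e_prod G hs \<otimes>\<^bsub>par_monoid G\<^esub> par_e_prod G ks =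
    par_e_prod G ks \<otimes>\<^bsub>par_monoid G\<^esub> par_e_prod G hs"
  using assms(1)
proof (induction hs)
  case (Cons h hs)
  have "par_e_prod G (h # hs) \<otimes>\<^bsub>par_monoid G\<^esub> par_e_prod G ks =
      par_e G h \<otimes>\<^bsub>par_monoid G\<^esub> par_e_prod G ks \<otimes>\<^bsub>par_monoid G\<^esub> par_e_prod G hs"
    using Cons assms(2) by (simp add: par.m_assoc)
  then show ?case using Cons assms(2) by (simp add: par_e_e_prod_comm par.m_assoc)
qed (use assms in simp)

lemma par_e_absorb:
  assumes "hs \<in> lists (carrier G)" "g \<in> set hs"
  shows "par_e G g \<otimes>\<^bsub>par_monoid G\<^esub> par_e_prod G hs = par_e_prod G hs"
  using assms
proof (induction hs)
  case (Cons h hs)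
  show ?case
  proof (cases "g = h")
    case True
    then show ?thesis using Cons.hyps Cons.prems par_reassoc[OF par_e_idem[of h]] by simp
  next
    case False
    then have g: "g \<in> carrier G" "g \<in> set hs" using Cons.hyps Cons.prems by (auto simp: in_lists_conv_set)
    have "par_e G g \<otimes>\<^bsub>par_monoid G\<^esub> par_e_prod G (h # hs) =
        par_e G h \<otimes>\<^bsub>par_monoid G\<^esub> (par_e G g \<otimes>\<^bsub>par_monoid G\<^esub> par_e_prod G hs)"
      using Cons.hyps Cons.prems g par_reassoc[OF par_e_comm[of g h]] by (simp add: par.m_assoc)
    then show ?thesis using Cons g by simp
  qed
qed simp

lemma par_e_prod_absorb:
  assumes "ks \<in> lists (carrier G)" "set hs \<subseteq> set ks"
  shows "par_e_prod G hs \<otimes>\<^bsub>par_monoid G\<^esub> par_e_prod G ks = par_e_prod G ks"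
  using assms(2)
proof (induction hs)
  case (Cons h hs)
  then have "hs \<in> lists (carrier G)" "h \<in> carrier G" using assms(1) by (auto simp: in_lists_conv_set)
  with Cons assms(1) show ?case by (simp add: par.m_assoc par_e_absorb)
qed (use assms in simp)

text \<open>Each product absorbs the other and the two commute, so the product depends only on the
  set of indices. This turns equality of supports into equality in the monoid.\<close>

lemma par_e_prod_cong:
  assumes "hs \<in> lists (carrier G)" "ks \<in> lists (carrier G)" "set hs = set ks"
  shows "par_e_prod G hs = par_e_prod G ks"
  using par_e_prod_absorb[OF assms(2), of hs] par_e_prod_absorb[OF assms(1), of ks]
    par_e_prod_comm[OF assms(1,2)] assms(3) by simp

lemma par_gen_e_prod:
  assumes "g \<in> carrier G" "hs \<in> lists (carrier G)"
  shows "par_gen G g \<otimes>\<^bsub>par_monoid G\<^esub> par_e_prod G hs =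
    par_e_prod G (map (mult G g) hs) \<otimes>\<^bsub>par_monoid G\<^esub> par_gen G g"
  using assms(2)
proof (induction hs)
  case (Cons h hs)
  then have *: "map (mult G g) hs \<in> lists (carrier G)" using assms(1) by (auto simp: in_lists_conv_set)
  have "par_gen G g \<otimes>\<^bsub>par_monoid G\<^esub> par_e_prod G (h # hs) =
      par_e G (g \<otimes> h) \<otimes>\<^bsub>par_monoid G\<^esub> (par_gen G g \<otimes>\<^bsub>par_monoid G\<^esub> par_e_prod G hs)"
    using Cons.hyps assms(1) par_reassoc[OF par_gen_e[of g h]] by (simp add: par.m_assoc)
  then show ?case using Cons assms(1) * by (simp add: par.m_assoc)
qed (use assms in simp)

lemma par_supp_deg_e_prod:
  "hs \<in> lists (carrier G) \<Longrightarrow>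
    par_supp G (par_e_prod G hs) = insert \<one> (set hs) \<and> par_deg G (par_e_prod G hs) = \<one>"
proof (induction hs)
  case (Cons h hs)
  then have "set hs \<subseteq> carrier G" by (auto simp: in_lists_conv_set)
  then show ?case using Cons by (simp add: par_supp_mult par_deg_mult par_supp_deg_e mult_one_image)
qed simp

text \<open>Prefixing \<open>[g]\<close> translates every index by \<open>g\<close>, and
  \<open>par_gen_gen\<close> replaces \<open>[g][p]\<close> by \<open>e_g [gp]\<close>. The new
  factor \<open>e_g\<close> is absorbed because \<open>g\<close> is the translate of the starting
  vertex \<open>1\<close>. The new starting vertex contributes \<open>e_1\<close>, which is the
  identity.\<close>

lemma par_class_normal_form:
  assumes "u \<in> lists (carrier G)"
  shows "par_class G u = par_e_prod G (prefix_prods G u) \<otimes>\<^bsub>par_monoid G\<^esub> par_gen G (word_prod G u)"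
  using assms
proof (induction u)
  case Nil
  show ?case by (simp add: par_one[symmetric] par_gen_one par_e_def)
next
  case (Cons g u)
  let ?ps = "prefix_prods G u" and ?p = "word_prod G u"
  have ps: "?ps \<in> lists (carrier G)" using Cons.hyps by simp
  have gps: "map (mult G g) ?ps \<in> lists (carrier G)"
    using ps Cons.hyps by (auto simp: in_lists_conv_set)
  have g: "g \<in> set (map (mult G g) ?ps)"
    using one_in_prefix_prods[of u] Cons.hyps by (force simp: image_iff)
  have "par_class G (g # u) = par_gen G g \<otimes>\<^bsub>par_monoid G\<^esub> par_class G u"
    using Cons.hyps by (simp add: par_gen_def par_mult_class)
  also have "\<dots> = par_gen G g \<otimes>\<^bsub>par_monoid G\<^esub> par_e_prod G ?ps \<otimes>\<^bsub>par_monoid G\<^esub> par_gen G ?p"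
    using Cons.hyps Cons.IH ps by (simp add: par.m_assoc)
  also have "\<dots> = par_e_prod G (map (mult G g) ?ps) \<otimes>\<^bsub>par_monoid G\<^esub>
      (par_gen G g \<otimes>\<^bsub>par_monoid G\<^esub> par_gen G ?p)"
    using Cons.hyps ps gps by (simp add: par_gen_e_prod par.m_assoc)
  also have "\<dots> = par_e_prod G (map (mult G g) ?ps) \<otimes>\<^bsub>par_monoid G\<^esub> par_e G g
      \<otimes>\<^bsub>par_monoid G\<^esub> par_gen G (g \<otimes> ?p)"
    using Cons.hyps gps par_gen_gen[of g ?p] by (simp add: par.m_assoc)
  also have "par_e_prod G (map (mult G g) ?ps) \<otimes>\<^bsub>par_monoid G\<^esub> par_e G g = par_e_prod G (map (mult G g) ?ps)"
    using Cons.hyps gps g by (metis par_e_e_prod_comm par_e_absorb lists.cases list.distinct(1) list.inject)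
  finally show ?case
    using Cons.hyps gps par_gen_one by (simp add: par_e_def)
qed

text \<open>Completeness of the invariants: the normal form is determined by the visited set and the
  endpoint.\<close>

lemma par_monoid_eqI:
  assumes "s \<in> carrier (par_monoid G)" "t \<in> carrier (par_monoid G)"
    "par_supp G s = par_supp G t" "par_deg G s = par_deg G t"
  shows "s = t"
proof -
  obtain u v where uv: "u \<in> lists (carrier G)" "v \<in> lists (carrier G)" "s = par_class G u" "t = par_class G v"
    using assms by (auto simp: par_carrier)
  then have "par_e_prod G (prefix_prods G u) = par_e_prod G (prefix_prods G v)"
    using assms by (intro par_e_prod_cong) (auto simp: par_supp_deg_class)
  moreover have "word_prod G u = word_prod G v" using uv assms(4) by (simp add: par_supp_deg_class)
  ultimately show ?thesis
    using uv by (simp add: par_class_normal_form)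
qed

lemma par_monoid_exists:
  assumes "finite A" "A \<subseteq> carrier G" "\<one> \<in> A" "g \<in> A"
  obtains s where "s \<in> carrier (par_monoid G)" "par_supp G s = A" "par_deg G s = g"
proof -
  obtain hs where hs: "set hs = A" using assms(1) finite_list by blast
  then have "hs \<in> lists (carrier G)" "g \<in> carrier G" using assms by (auto simp: in_lists_conv_set)
  with that[of "par_e_prod G hs \<otimes>\<^bsub>par_monoid G\<^esub> par_gen G g"] hs assms show ?thesis
    by (auto simp: par_supp_mult par_deg_mult par_supp_deg_e_prod par_supp_deg_gen)
qed

subsection \<open>Inverses, idempotents and the basis\<close>

lemma mult_image_subset_iff:
  assumes "g \<in> carrier G" "A \<subseteq> carrier G" "B \<subseteq> carrier G"
  shows "mult G g ` A \<subseteq> B \<longleftrightarrow> A \<subseteq> mult G (inv g) ` B"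
proof
  assume "mult G g ` A \<subseteq> B"
  then have "mult G (inv g) ` mult G g ` A \<subseteq> mult G (inv g) ` B" by blast
  then show "A \<subseteq> mult G (inv g) ` B" using assms by (simp add: mult_image_mult_image mult_one_image)
next
  assume "A \<subseteq> mult G (inv g) ` B"
  then have "mult G g ` A \<subseteq> mult G g ` mult G (inv g) ` B" by blast
  then show "mult G g ` A \<subseteq> B" using assms by (simp add: mult_image_mult_image mult_one_image)
qed

text \<open>The inverse of \<open>(V, g)\<close> is \<open>(inv g V, inv g)\<close>. Since
  \<open>semigroup_inv\<close> is a definite description, uniqueness has to be proved along with
  existence.\<close>

lemma semigroup_inv_par_monoid:
  assumes s: "s \<in> carrier (par_monoid G)"
  shows "semigroup_inv (par_monoid G) s \<in> carrier (par_monoid G)"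
    "par_supp G (semigroup_inv (par_monoid G) s) = mult G (inv (par_deg G s)) ` par_supp G s"
    "par_deg G (semigroup_inv (par_monoid G) s) = inv (par_deg G s)"
proof -
  let ?g = "par_deg G s" and ?A = "par_supp G s"
  note A = par_supp_props[OF s]
  have g: "?g \<in> carrier G" using s by simp
  \<comment> \<open>The two membership conditions for a pair: \<open>1 = inv g g\<close> comes from
    \<open>g\<close> in the support, and \<open>inv g = inv g 1\<close> from \<open>1\<close> in
    it.\<close>
  have "\<one> \<in> mult G (inv ?g) ` ?A" "inv ?g \<in> mult G (inv ?g) ` ?A"
    using A g by (force simp: image_iff)+
  then obtain t where t: "t \<in> carrier (par_monoid G)" "par_supp G t = mult G (inv ?g) ` ?A"
      "par_deg G t = inv ?g"
    using A g by (elim par_monoid_exists[rotated 2]) auto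
  have "semigroup_inv (par_monoid G) s = t"
    unfolding semigroup_inv_def
  proof (rule the_equality, intro conjI t)
    show "s \<otimes>\<^bsub>par_monoid G\<^esub> t \<otimes>\<^bsub>par_monoid G\<^esub> s = s"
      using s t A g
      by (intro par_monoid_eqI) (auto simp: par_supp_mult par_deg_mult mult_image_mult_image mult_one_image)
    show "t \<otimes>\<^bsub>par_monoid G\<^esub> s \<otimes>\<^bsub>par_monoid G\<^esub> t = t"
      using s t A g
      by (intro par_monoid_eqI) (auto simp: par_supp_mult par_deg_mult mult_image_mult_image mult_one_image)
  next
    \<comment> \<open>Degrees force \<open>inv g\<close>. For the supports, \<open>s r s = s\<close>
      bounds that of \<open>r\<close> from above and \<open>r s r = r\<close> bounds it from below,
      both by the translate of the support of \<open>s\<close>.\<close>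
    fix r assume r: "r \<in> carrier (par_monoid G) \<and> s \<otimes>\<^bsub>par_monoid G\<^esub> r \<otimes>\<^bsub>par_monoid G\<^esub> s = s \<and>
      r \<otimes>\<^bsub>par_monoid G\<^esub> s \<otimes>\<^bsub>par_monoid G\<^esub> r = r"
    note B = par_supp_props[of r]
    have "?g \<otimes> par_deg G r \<otimes> ?g = \<one> \<otimes> ?g"
      using r s par_deg_mult by (metis par.m_closed l_one g)
    then have "?g \<otimes> par_deg G r = \<one>" using r g by (subst (asm) right_cancel) auto
    then have deg: "par_deg G r = inv ?g" using r g by (metis inv_equality inv_inv par_deg_closed)
    have "mult G ?g ` par_supp G r \<subseteq> ?A"
      using r s par_supp_mult[of "s \<otimes>\<^bsub>par_monoid G\<^esub> r" s] par_supp_mult[of s r] by auto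
    moreover have "mult G (inv ?g) ` ?A \<subseteq> par_supp G r"
      using r s par_supp_mult[of "r \<otimes>\<^bsub>par_monoid G\<^esub> s" r] par_supp_mult[of r s] deg by auto
    ultimately have "par_supp G r = mult G (inv ?g) ` ?A"
      using r g A B by (auto simp: mult_image_subset_iff)
    with r t deg show "r = t" by (intro par_monoid_eqI) auto
  qed
  with t show "semigroup_inv (par_monoid G) s \<in> carrier (par_monoid G)"
    "par_supp G (semigroup_inv (par_monoid G) s) = mult G (inv (par_deg G s)) ` par_supp G s"
    "par_deg G (semigroup_inv (par_monoid G) s) = inv (par_deg G s)"
    by auto
qed

text \<open>The degree of an idempotent is an idempotent of a group, hence \<open>1\<close>;
  conversely \<open>(V, 1)(V, 1) = (V, 1)\<close>.\<close>

lemma idempotents_par_monoid: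
  "idempotents (par_monoid G) = {s \<in> carrier (par_monoid G). par_deg G s = \<one>}"
proof -
  have "s \<otimes>\<^bsub>par_monoid G\<^esub> s = s \<longleftrightarrow> par_deg G s = \<one>" if s: "s \<in> carrier (par_monoid G)" for s
  proof
    assume "s \<otimes>\<^bsub>par_monoid G\<^esub> s = s"
    then have "par_deg G s \<otimes> par_deg G s = par_deg G s" using par_deg_mult[OF s s] by simp
    then show "par_deg G s = \<one>" using s by (metis par_deg_closed r_cancel_one')
  next
    assume "par_deg G s = \<one>"
    then show "s \<otimes>\<^bsub>par_monoid G\<^esub> s = s"
      using s par_supp_props[OF s]
      by (intro par_monoid_eqI) (auto simp: par_supp_mult par_deg_mult mult_one_image)
  qed
  then show ?thesis by (auto simp: idempotents_def)
qed

lemma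
  assumes "gs \<in> lists (carrier G)"
  shows par_e_tuple_closed [simp]: "par_e_tuple G gs \<in> carrier (par_monoid G)"
    and par_supp_e_tuple: "par_supp G (par_e_tuple G gs) = set (prefix_prods G gs)"
    and par_deg_e_tuple: "par_deg G (par_e_tuple G gs) = \<one>"
proof -
  let ?hs = "map (\<lambda>k. word_prod G (take k gs)) [1..<Suc (length gs)]"
  have "word_prod G (take k gs) \<in> carrier G" for k
    using assms by (intro word_prod_closed) (auto simp: in_lists_conv_set dest: in_set_takeD)
  then have hs: "?hs \<in> lists (carrier G)" by (auto simp: in_lists_conv_set simp del: upt_Suc)
  have e: "par_e_tuple G gs = par_e_prod G ?hs"
    by (simp add: par_e_tuple_def par_e_prod_def word_prod_def comp_def)
  \<comment> \<open>The product defining \<open>par_e_tuple\<close> starts at \<open>k = 1\<close>,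
    while \<open>prefix_prods\<close> also lists the empty product. Every support contains
    \<open>1\<close>, so the sets agree.\<close>
  have "prefix_prods G gs = \<one> # ?hs"
    unfolding prefix_prods_eq by (subst upt_conv_Cons) auto
  then show "par_e_tuple G gs \<in> carrier (par_monoid G)"
    "par_supp G (par_e_tuple G gs) = set (prefix_prods G gs)" "par_deg G (par_e_tuple G gs) = \<one>"
    using par_supp_deg_e_prod[OF hs] hs unfolding e by auto
qed

text \<open>Right multiplication by \<open>(W, 1)\<close> turns \<open>(V, g)\<close> into
  \<open>(V Un gW, g)\<close>, so it fixes the element exactly when \<open>gW\<close> lies in
  \<open>V\<close>.\<close>

lemma mult_par_e_tuple_iff:
  assumes s: "s \<in> carrier (par_monoid G)" and gs: "gs \<in> lists (carrier G)"
  shows "s \<otimes>\<^bsub>par_monoid G\<^esub> par_e_tuple G gs = s \<longleftrightarrow>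
    mult G (par_deg G s) ` set (prefix_prods G gs) \<subseteq> par_supp G s"
proof
  assume "s \<otimes>\<^bsub>par_monoid G\<^esub> par_e_tuple G gs = s"
  then show "mult G (par_deg G s) ` set (prefix_prods G gs) \<subseteq> par_supp G s"
    using par_supp_mult[OF s par_e_tuple_closed[OF gs]] gs by (auto simp: par_supp_e_tuple)
next
  assume "mult G (par_deg G s) ` set (prefix_prods G gs) \<subseteq> par_supp G s"
  then show "s \<otimes>\<^bsub>par_monoid G\<^esub> par_e_tuple G gs = s"
    using s gs by (intro par_monoid_eqI) (auto simp: par_supp_mult par_deg_mult par_supp_e_tuple par_deg_e_tuple)
qed

text \<open>With \<open>s = (V, g)\<close>, the idempotent \<open>inv s s\<close> is
  \<open>(inv g V, 1)\<close>. It lies below \<open>(W, 1)\<close> iff \<open>W\<close> is contained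
  in \<open>inv g V\<close>, that is, iff the vertices \<open>gW\<close> all lie in
  \<open>V\<close>.\<close>

lemma par_basis_iff:
  "(s, gs) \<in> par_basis G n \<longleftrightarrow> s \<in> carrier (par_monoid G) \<and> gs \<in> tuples G n \<and>
    mult G (par_deg G s) ` set (prefix_prods G gs) \<subseteq> par_supp G s"
proof -
  have "idempotent_le (par_monoid G) (semigroup_inv (par_monoid G) s \<otimes>\<^bsub>par_monoid G\<^esub> s) (par_e_tuple G gs) \<longleftrightarrow>
      mult G (par_deg G s) ` set (prefix_prods G gs) \<subseteq> par_supp G s"
    if s: "s \<in> carrier (par_monoid G)" and gs: "gs \<in> lists (carrier G)"
  proof -
    note A = par_supp_props[OF s] and inv_s = semigroup_inv_par_monoid[OF s]
    let ?t = "semigroup_inv (par_monoid G) s \<otimes>\<^bsub>par_monoid G\<^esub> s"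
    have t: "?t \<in> carrier (par_monoid G)" "par_deg G ?t = \<one>"
        "par_supp G ?t = mult G (inv (par_deg G s)) ` par_supp G s"
      using s inv_s by (auto simp: par_deg_mult par_supp_mult)
    show ?thesis
      unfolding idempotent_le_def mult_par_e_tuple_iff[OF t(1) gs] t(2,3)
      using s A prefix_prods_closed[OF gs] by (simp add: mult_one_image mult_image_subset_iff)
  qed
  then show ?thesis by (auto simp: par_basis_def tuples_def)
qed

text \<open>The algebraic form of the same condition; it is visibly stable under left
  multiplication.\<close>

lemma par_basis_iff_mult:
  "(s, gs) \<in> par_basis G n \<longleftrightarrow> s \<in> carrier (par_monoid G) \<and> gs \<in> tuples G n \<and>
    s \<otimes>\<^bsub>par_monoid G\<^esub> par_e_tuple G gs = s"
  using mult_par_e_tuple_iff[of s gs] unfolding par_basis_iff tuples_def by blast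

end

section \<open>The modules of the resolution\<close>

text \<open>In contrast to \<open>par_elem\<close> this carries a coefficient and does not multiply
  \<open>s\<close> by the idempotent of the tuple, so it can be split into coordinates without
  knowing that \<open>s\<close> absorbs that idempotent.\<close>

definition par_mono ::
  "('k, 'c) ring_scheme \<Rightarrow> ('g, 'd) monoid_scheme \<Rightarrow> 'k \<Rightarrow> 'g list set \<Rightarrow> 'g list \<Rightarrow>
    'g list \<Rightarrow> 'g list set \<Rightarrow> 'k"
where
  "par_mono K G c s gs =
    (\<lambda>hs\<in>tuples G (length gs). if hs = gs then monomial K c s else (\<lambda>_. \<zero>\<^bsub>K\<^esub>))"

lemma direct_sum_module_cong:
  "(\<And>i. i \<in> I \<Longrightarrow> M i = N i) \<Longrightarrow> direct_sum_module I M = direct_sum_module I N"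
  unfolding direct_sum_module_def by (auto simp: PiE_iff fun_eq_iff restrict_def cong: conj_cong)

locale partial_group_algebra = K: cring K + group G
  for K :: "('k, 'c) ring_scheme" and G :: "('g, 'd) monoid_scheme" (structure)
begin

abbreviation "S \<equiv> par_monoid G"
abbreviation "A \<equiv> par_algebra K G"
abbreviation "P \<equiv> par_P K G"
abbreviation "B \<equiv> par_B K G"
abbreviation "e_alg gs \<equiv> monomial K \<one>\<^bsub>K\<^esub> (par_e_tuple G gs)"
abbreviation "Q gs \<equiv> principal_left_ideal A (e_alg gs)"

lemma par_algebra_simps:
  "carrier A = free_carrier K (carrier S)" "mult A = bilinear_ext K (mult S)"
  "one A = monomial K \<one>\<^bsub>K\<^esub> \<one>\<^bsub>S\<^esub>" "zero A = (\<lambda>_. \<zero>\<^bsub>K\<^esub>)" "add A = (\<lambda>f g s. f s \<oplus>\<^bsub>K\<^esub> g s)"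
  by (simp_all add: par_algebra_def semigroup_algebra_def)

lemma ring_par_algebra: "Ring.ring A"
  unfolding par_algebra_def by (rule K.ring_semigroup_algebra[OF monoid_par_monoid])

lemma monomial_in_par_algebra [simp]:
  "\<lbrakk>c \<in> carrier K; s \<in> carrier S\<rbrakk> \<Longrightarrow> monomial K c s \<in> carrier A"
  by (simp add: par_algebra_simps K.monomial_in_free_carrier)

lemma par_algebra_monomial_mult:
  "\<lbrakk>c \<in> carrier K; d \<in> carrier K\<rbrakk> \<Longrightarrow>
    monomial K c s \<otimes>\<^bsub>A\<^esub> monomial K d t = monomial K (c \<otimes>\<^bsub>K\<^esub> d) (s \<otimes>\<^bsub>S\<^esub> t)"
  by (simp add: par_algebra_simps K.bilinear_ext_monomial)

lemma par_algebra_monomial_add: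
  "\<lbrakk>c \<in> carrier K; d \<in> carrier K\<rbrakk> \<Longrightarrow>
    monomial K c s \<oplus>\<^bsub>A\<^esub> monomial K d s = monomial K (c \<oplus>\<^bsub>K\<^esub> d) s"
  by (simp add: par_algebra_simps K.monomial_add)

lemma tuples_lists: "gs \<in> tuples G n \<Longrightarrow> gs \<in> lists (carrier G)"
  by (simp add: tuples_def)

lemma par_e_tuple_idem:
  "gs \<in> lists (carrier G) \<Longrightarrow> par_e_tuple G gs \<otimes>\<^bsub>S\<^esub> par_e_tuple G gs = par_e_tuple G gs"
  by (simp add: mult_par_e_tuple_iff par_supp_e_tuple par_deg_e_tuple mult_one_image prefix_prods_closed)

lemma e_alg:
  assumes "gs \<in> lists (carrier G)"
  shows "e_alg gs \<in> carrier A" "e_alg gs \<otimes>\<^bsub>A\<^esub> e_alg gs = e_alg gs"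
  using assms by (simp_all add: par_algebra_monomial_mult par_e_tuple_idem)

text \<open>The idempotent of the empty tuple is the identity, so the separate case of degree 0 fits
  the general pattern.\<close>

lemma par_P_eq: "P n = direct_sum_module (tuples G n) Q"
proof (cases "n = 0")
  case True
  have "regular_module A = Q gs" if "gs \<in> tuples G 0" for gs
    using that regular_module_eq_principal[OF ring_par_algebra]
    by (simp add: tuples_def par_e_tuple_def par_algebra_simps)
  then show ?thesis unfolding par_P_def using True by (auto intro: direct_sum_module_cong)
qed (simp add: par_P_def)

sublocale family: left_module_family A "tuples G n" Q for n
  by (intro left_module_family.intro left_module_family_axioms.intro ring_par_algebra
      left_module_principal_left_ideal e_alg tuples_lists)

sublocale P: left_module A "P n" for n
  unfolding par_P_eq by (rule family.left_module_direct_sum)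

lemma projective_par_P: "projective_module TYPE('m) TYPE('n) A (P n)"
  unfolding par_P_eq
  by (intro projective_direct_sum_principal_left_ideals ring_par_algebra e_alg tuples_lists)

text \<open>Right multiplication by the idempotent of \<open>gs\<close> maps the monoid into the
  elements absorbing it and fixes those, so the left ideal is free over \<open>K\<close> on exactly
  these elements.\<close>

lemma carrier_Q:
  assumes "gs \<in> tuples G n"
  shows "carrier (Q gs) = free_carrier K {s. (s, gs) \<in> par_basis G n}"
proof -
  let ?X = "{s. (s, gs) \<in> par_basis G n}"
  note gs = tuples_lists[OF assms]
  have X: "?X \<subseteq> carrier S" by (auto simp: par_basis_iff)
  have "a \<in> carrier A \<and> a \<otimes>\<^bsub>A\<^esub> e_alg gs = a \<longleftrightarrow> a \<in> free_carrier K ?X" for a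
  proof safe
    assume a: "a \<in> carrier A" "a \<otimes>\<^bsub>A\<^esub> e_alg gs = a"
    have "s \<otimes>\<^bsub>S\<^esub> par_e_tuple G gs \<in> ?X" if "s \<in> carrier S" for s
      using that assms gs by (simp add: par_basis_iff_mult par.m_assoc par_e_tuple_idem)
    then have "bilinear_ext K (mult S) a (e_alg gs) \<in> free_carrier K ?X"
      using a(1) by (intro K.bilinear_ext_closed[of _ "carrier S" _ "{par_e_tuple G gs}"])
        (auto simp: par_algebra_simps intro: K.monomial_in_free_carrier)
    then show "a \<in> free_carrier K ?X" using a(2) by (simp add: par_algebra_simps)
  next
    assume a: "a \<in> free_carrier K ?X"
    show "a \<in> carrier A" using a free_carrier_mono[OF X] by (auto simp: par_algebra_simps)
    show "a \<otimes>\<^bsub>A\<^esub> e_alg gs = a"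
      using a
    proof (induction a rule: K.free_carrier_induct)
      case (add f c s)
      then have "f \<in> free_carrier K (carrier S)" "s \<otimes>\<^bsub>S\<^esub> par_e_tuple G gs = s" "s \<in> carrier S"
        using free_carrier_mono[OF X] by (auto simp: par_basis_iff_mult)
      moreover have "e_alg gs \<in> free_carrier K (carrier S)" "monomial K c s \<in> free_carrier K (carrier S)"
        using e_alg[OF gs] calculation add.hyps by (auto simp: par_algebra_simps K.monomial_in_free_carrier)
      ultimately show ?case
        using add by (simp add: par_algebra_simps K.bilinear_ext_add_left K.bilinear_ext_monomial)
    qed (simp add: par_algebra_simps)
  qed
  then show ?thesis
    by (simp add: carrier_principal_left_ideal_idempotent[OF ring_par_algebra e_alg[OF gs]])
qed

section \<open>The basis of \<open>P n\<close> over \<open>K\<close>\<close>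

lemma par_mono_eq_single:
  "gs \<in> tuples G n \<Longrightarrow> par_mono K G c s gs = direct_sum_single (tuples G n) Q gs (monomial K c s)"
  by (auto simp: par_mono_def direct_sum_single_def par_algebra_simps tuples_def)

lemma monomial_in_Q:
  "\<lbrakk>c \<in> carrier K; (s, gs) \<in> par_basis G n\<rbrakk> \<Longrightarrow> monomial K c s \<in> carrier (Q gs)"
  by (subst carrier_Q[of _ n]) (auto simp: par_basis_iff intro!: K.monomial_in_free_carrier)

lemma par_mono_closed:
  assumes "c \<in> carrier K" "(s, gs) \<in> par_basis G n"
  shows "par_mono K G c s gs \<in> carrier (P n)"
  using assms by (subst par_mono_eq_single[of _ n])
    (auto simp: par_P_eq par_basis_iff[of s gs] intro!: family.single_closed monomial_in_Q)

lemma par_mono_smult: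
  assumes "c \<in> carrier K" "d \<in> carrier K" "r \<in> carrier S" "(s, gs) \<in> par_basis G n"
  shows "monomial K c r \<odot>\<^bsub>P n\<^esub> par_mono K G d s gs = par_mono K G (c \<otimes>\<^bsub>K\<^esub> d) (r \<otimes>\<^bsub>S\<^esub> s) gs"
proof -
  have gs: "gs \<in> tuples G n" using assms by (simp add: par_basis_iff)
  show ?thesis
    using assms gs
    by (simp add: par_mono_eq_single par_P_eq family.single_smult monomial_in_Q par_algebra_monomial_mult)
qed

text \<open>Two nested inductions, over the summands and then over the monomials within one summand,
  so that additive maps can be compared on multiples of basis elements.\<close>

lemma par_P_induct [consumes 1, case_names zero add]:
  assumes x: "x \<in> carrier (P n)"
    and zero: "R \<zero>\<^bsub>P n\<^esub>"
    and add: "\<And>x c s gs. \<lbrakk>x \<in> carrier (P n); R x; c \<in> carrier K; (s, gs) \<in> par_basis G n\<rbrakk> \<Longrightarrow>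
      R (x \<oplus>\<^bsub>P n\<^esub> par_mono K G c s gs)"
  shows "R x"
  using x[unfolded par_P_eq]
proof (induction x rule: family.direct_sum_induct)
  case zero
  show ?case using assms(2) by (simp add: par_P_eq)
next
  case (add x gs y)
  let ?s = "direct_sum_single (tuples G n) Q gs"
  have x: "x \<in> carrier (P n)" using add by (simp add: par_P_eq)
  have "y \<in> free_carrier K {s. (s, gs) \<in> par_basis G n}"
    using add carrier_Q by simp
  then have "R (x \<oplus>\<^bsub>P n\<^esub> ?s y)"
  proof (induction y rule: K.free_carrier_induct)
    case zero
    have "?s (\<lambda>_. \<zero>\<^bsub>K\<^esub>) = \<zero>\<^bsub>P n\<^esub>"
      by (auto simp: direct_sum_single_def par_P_eq direct_sum_module_def par_algebra_simps)
    then show ?case using x \<open>R x\<close> by simp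
  next
    case (add y c s)
    have y: "y \<in> carrier (Q gs)" and m: "monomial K c s \<in> carrier (Q gs)"
      using add.hyps carrier_Q[OF \<open>gs \<in> tuples G n\<close>] monomial_in_Q[of c s gs n] by simp_all
    have sy: "?s y \<in> carrier (P n)"
      using family.single_closed[OF \<open>gs \<in> tuples G n\<close> y] by (simp add: par_P_eq)
    have "?s (\<lambda>t. y t \<oplus>\<^bsub>K\<^esub> monomial K c s t) = ?s y \<oplus>\<^bsub>P n\<^esub> par_mono K G c s gs"
      using family.single_add[OF \<open>gs \<in> tuples G n\<close> y m] \<open>gs \<in> tuples G n\<close>
      by (simp add: par_algebra_simps par_mono_eq_single par_P_eq)
    then have "x \<oplus>\<^bsub>P n\<^esub> ?s (\<lambda>t. y t \<oplus>\<^bsub>K\<^esub> monomial K c s t) =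
        (x \<oplus>\<^bsub>P n\<^esub> ?s y) \<oplus>\<^bsub>P n\<^esub> par_mono K G c s gs"
      using x sy add.hyps by (simp add: P.a_assoc par_mono_closed)
    then show ?case
      using assms(3)[OF _ add.IH] x sy add.hyps by simp
  qed
  then show ?case by (simp add: par_P_eq)
qed

subsection \<open>Linear extension\<close>


text \<open>Here \<open>\<phi>\<close> is arbitrary on the basis, as the contraction requires;
  linearity over the algebra is added in \<open>par_linear_ext_hom\<close> under an equivariance
  condition.\<close>

lemma par_linear_ext_additive:
  assumes N: "left_module A N" and \<phi>: "\<And>s gs. (s, gs) \<in> par_basis G n \<Longrightarrow> \<phi> s gs \<in> carrier N"
  shows "par_linear_ext K G n N \<phi> \<in> hom (add_monoid (P n)) (add_monoid N)"
proof -
  interpret N: left_module A N by (rule N)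
  define \<psi> where "\<psi> b c = monomial K c \<one>\<^bsub>S\<^esub> \<odot>\<^bsub>N\<^esub> \<phi> (fst b) (snd b)" for b c
  have \<psi>: "\<psi> b \<in> hom (add_monoid K) (add_monoid N)" if "b \<in> par_basis G n" for b
  proof -
    have "\<phi> (fst b) (snd b) \<in> carrier N" using \<phi> that by simp
    then show ?thesis
      by (auto simp: hom_def \<psi>_def N.smult_closed N.smult_l_distr par_algebra_monomial_add[symmetric])
  qed
  have eq: "par_linear_ext K G n N \<phi> x =
      (\<Oplus>\<^bsub>N\<^esub>b\<in>{b \<in> par_basis G n. x (snd b) (fst b) \<noteq> \<zero>\<^bsub>K\<^esub>}. \<psi> b (x (snd b) (fst b)))" for x
  proof -
    have "{(s, gs). (s, gs) \<in> par_basis G n \<and> x gs s \<noteq> \<zero>\<^bsub>K\<^esub>} =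
        {b \<in> par_basis G n. x (snd b) (fst b) \<noteq> \<zero>\<^bsub>K\<^esub>}" by auto
    then show ?thesis by (simp add: par_linear_ext_def \<psi>_def)
  qed
  have car: "x gs s \<in> carrier K" if "x \<in> carrier (P n)" "(s, gs) \<in> par_basis G n" for x s gs
  proof -
    have "gs \<in> tuples G n" using that by (simp add: par_basis_iff)
    then have "x gs \<in> free_carrier K {s. (s, gs) \<in> par_basis G n}"
      using that carrier_Q by (auto simp: par_P_eq family.carrier_iff)
    then show ?thesis by (rule K.free_carrierD)
  qed
  \<comment> \<open>Only finitely many coordinates are nonzero, and each of them has finite
    support.\<close>
  have fin: "finite {b \<in> par_basis G n. x (snd b) (fst b) \<noteq> \<zero>\<^bsub>K\<^esub>}" if x: "x \<in> carrier (P n)" for x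
  proof (rule finite_subset)
    let ?I = "{gs \<in> tuples G n. x gs \<noteq> (\<lambda>_. \<zero>\<^bsub>K\<^esub>)}"
    show "{b \<in> par_basis G n. x (snd b) (fst b) \<noteq> \<zero>\<^bsub>K\<^esub>} \<subseteq>
        (\<Union>gs\<in>?I. {s. x gs s \<noteq> \<zero>\<^bsub>K\<^esub>} \<times> {gs})"
      by (auto simp: par_basis_iff)
    have "x gs \<in> free_carrier K {s. (s, gs) \<in> par_basis G n}" if "gs \<in> tuples G n" for gs
      using x that carrier_Q by (auto simp: par_P_eq family.carrier_iff)
    then show "finite (\<Union>gs\<in>?I. {s. x gs s \<noteq> \<zero>\<^bsub>K\<^esub>} \<times> {gs})"
      using x K.free_carrierD(2) by (auto simp: par_P_eq family.carrier_iff par_algebra_simps)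
  qed
  show ?thesis
  proof (rule homI; simp)
    fix x assume x: "x \<in> carrier (P n)"
    show "par_linear_ext K G n N \<phi> x \<in> carrier N"
      unfolding eq using car[OF x] additive_closed[OF \<psi>] by (intro N.finsum_closed) auto
  next
    fix x y assume x: "x \<in> carrier (P n)" and y: "y \<in> carrier (P n)"
    have xy: "(x \<oplus>\<^bsub>P n\<^esub> y) (snd b) (fst b) = x (snd b) (fst b) \<oplus>\<^bsub>K\<^esub> y (snd b) (fst b)"
      if "b \<in> par_basis G n" for b
      using that by (cases b) (simp add: par_basis_iff par_P_eq direct_sum_module_def par_algebra_simps)
    have "par_linear_ext K G n N \<phi> (x \<oplus>\<^bsub>P n\<^esub> y) =
        (\<Oplus>\<^bsub>N\<^esub>b\<in>{b \<in> par_basis G n. x (snd b) (fst b) \<oplus>\<^bsub>K\<^esub> y (snd b) (fst b) \<noteq> \<zero>\<^bsub>K\<^esub>}.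
          \<psi> b (x (snd b) (fst b) \<oplus>\<^bsub>K\<^esub> y (snd b) (fst b)))"
      unfolding eq using xy car[OF x] car[OF y] additive_closed[OF \<psi>] by (intro N.finsum_cong') auto
    also have "\<dots> = par_linear_ext K G n N \<phi> x \<oplus>\<^bsub>N\<^esub> par_linear_ext K G n N \<phi> y"
      unfolding eq using car[OF x] car[OF y] fin[OF x] fin[OF y] \<psi>
      by (intro N.finsum_support_add[where N = "\<lambda>_. K"] K.is_abelian_group) auto
    finally show "par_linear_ext K G n N \<phi> (x \<oplus>\<^bsub>P n\<^esub> y) =
        par_linear_ext K G n N \<phi> x \<oplus>\<^bsub>N\<^esub> par_linear_ext K G n N \<phi> y" .
  qed
qed

lemma par_linear_ext_mono:
  assumes N: "left_module A N" and b: "(s, gs) \<in> par_basis G n" and \<phi>: "\<phi> s gs \<in> carrier N"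
    and c: "c \<in> carrier K"
  shows "par_linear_ext K G n N \<phi> (par_mono K G c s gs) = monomial K c \<one>\<^bsub>S\<^esub> \<odot>\<^bsub>N\<^esub> \<phi> s gs"
proof -
  interpret N: left_module A N by (rule N)
  have gs: "gs \<in> tuples G n" "length gs = n" using b by (auto simp: par_basis_iff tuples_def)
  have coeff: "par_mono K G c s gs hs t = (if (t, hs) = (s, gs) then c else \<zero>\<^bsub>K\<^esub>)"
    if "hs \<in> tuples G n" for t hs
    using that gs by (simp add: par_mono_def monomial_def)
  have "par_linear_ext K G n N \<phi> (par_mono K G c s gs) =
      (\<Oplus>\<^bsub>N\<^esub>b\<in>{(s, gs)}. monomial K c \<one>\<^bsub>S\<^esub> \<odot>\<^bsub>N\<^esub> \<phi> (fst b) (snd b))"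
  proof (cases "c = \<zero>\<^bsub>K\<^esub>")
    \<comment> \<open>For coefficient zero the sum is empty instead of ranging over the single basis
      element.\<close>
    case True
    then have supp: "{(t, hs). (t, hs) \<in> par_basis G n \<and> par_mono K G c s gs hs t \<noteq> \<zero>\<^bsub>K\<^esub>} = {}"
      using coeff by (auto simp: par_basis_iff)
    have "monomial K c \<one>\<^bsub>S\<^esub> = \<zero>\<^bsub>A\<^esub>"
      using True by (auto simp: monomial_def par_algebra_simps)
    then show ?thesis unfolding par_linear_ext_def supp using \<phi> by (simp add: N.smult_l_null)
  next
    case False
    then have supp: "{(t, hs). (t, hs) \<in> par_basis G n \<and> par_mono K G c s gs hs t \<noteq> \<zero>\<^bsub>K\<^esub>} = {(s, gs)}"
      using coeff b by (auto simp: par_basis_iff split: if_splits)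
    show ?thesis
      unfolding par_linear_ext_def supp using coeff[OF gs(1)] c \<phi>
      by (auto intro!: N.finsum_cong' N.smult_closed)
  qed
  then show ?thesis using c \<phi> by (simp add: N.smult_closed)
qed

text \<open>The monoid spans the algebra over \<open>K\<close>, so equivariance under the monoid on
  basis elements is enough.\<close>

lemma par_linear_ext_hom:
  assumes N: "left_module A N" and \<phi>: "\<And>s gs. (s, gs) \<in> par_basis G n \<Longrightarrow> \<phi> s gs \<in> carrier N"
    and equivariant: "\<And>r s gs. \<lbrakk>r \<in> carrier S; (s, gs) \<in> par_basis G n\<rbrakk> \<Longrightarrow>
      \<phi> (r \<otimes>\<^bsub>S\<^esub> s) gs = monomial K \<one>\<^bsub>K\<^esub> r \<odot>\<^bsub>N\<^esub> \<phi> s gs"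
  shows "par_linear_ext K G n N \<phi> \<in> left_module_hom A (P n) N"
proof -
  interpret N: left_module A N by (rule N)
  let ?f = "par_linear_ext K G n N \<phi>"
  have f: "?f \<in> hom (add_monoid (P n)) (add_monoid N)"
    by (rule par_linear_ext_additive[OF N \<phi>])
  note f_closed [simp] = additive_closed[OF f] and f_add = additive_add[OF f]
  have mono: "?f (monomial K c r \<odot>\<^bsub>P n\<^esub> par_mono K G d s gs) = monomial K c r \<odot>\<^bsub>N\<^esub> ?f (par_mono K G d s gs)"
    if "c \<in> carrier K" "r \<in> carrier S" "d \<in> carrier K" "(s, gs) \<in> par_basis G n" for c d r s gs
  proof -
    have rs: "(r \<otimes>\<^bsub>S\<^esub> s, gs) \<in> par_basis G n"
      using that tuples_lists[of gs n] by (simp add: par_basis_iff_mult par.m_assoc)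
    have "?f (monomial K c r \<odot>\<^bsub>P n\<^esub> par_mono K G d s gs) =
        monomial K (c \<otimes>\<^bsub>K\<^esub> d) \<one>\<^bsub>S\<^esub> \<odot>\<^bsub>N\<^esub> (monomial K \<one>\<^bsub>K\<^esub> r \<odot>\<^bsub>N\<^esub> \<phi> s gs)"
      using that rs \<phi>[OF rs] by (simp add: par_mono_smult par_linear_ext_mono[OF N] equivariant)
    also have "\<dots> = monomial K c r \<odot>\<^bsub>N\<^esub> (monomial K d \<one>\<^bsub>S\<^esub> \<odot>\<^bsub>N\<^esub> \<phi> s gs)"
      using that \<phi>[OF that(4)] by (simp add: N.smult_assoc[symmetric] par_algebra_monomial_mult)
    finally show ?thesis using that \<phi>[OF that(4)] by (simp add: par_linear_ext_mono[OF N])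
  qed
  have monomial: "?f (monomial K c r \<odot>\<^bsub>P n\<^esub> x) = monomial K c r \<odot>\<^bsub>N\<^esub> ?f x"
    if "c \<in> carrier K" "r \<in> carrier S" "x \<in> carrier (P n)" for c r x
    using that(3)
  proof (induction x rule: par_P_induct)
    case zero
    show ?case using that
      by (simp add: P.smult_r_null N.smult_r_null additive_zero[OF P.abelian_group N.abelian_group f])
  next
    case (add x d s gs)
    then show ?case using that mono par_mono_closed
      by (simp add: P.smult_r_distr N.smult_r_distr f_add P.smult_closed)
  qed
  have "?f (a \<odot>\<^bsub>P n\<^esub> x) = a \<odot>\<^bsub>N\<^esub> ?f x" if "a \<in> carrier A" and x: "x \<in> carrier (P n)" for a x
    using that(1)[unfolded par_algebra_simps]
  proof (induction a rule: K.free_carrier_induct)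
    case zero
    show ?case using x P.smult_l_null[OF x] N.smult_l_null[OF f_closed[OF x]]
      by (simp add: par_algebra_simps additive_zero[OF P.abelian_group N.abelian_group f])
  next
    case (add a c s)
    then have a: "a \<in> carrier A" by (simp add: par_algebra_simps)
    have "(\<lambda>t. a t \<oplus>\<^bsub>K\<^esub> monomial K c s t) = a \<oplus>\<^bsub>A\<^esub> monomial K c s" by (simp add: par_algebra_simps)
    then show ?case using add x a monomial
      by (simp add: P.smult_l_distr N.smult_l_distr f_add P.smult_closed)
  qed
  with f show ?thesis by (simp add: left_module_hom_def)
qed

subsection \<open>The module \<open>B\<close> and the maps\<close>

lemma semigroup_inv_closed [simp]: "s \<in> carrier S \<Longrightarrow> semigroup_inv S s \<in> carrier S"
  by (rule semigroup_inv_par_monoid)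

lemma mult_semigroup_inv:
  assumes "s \<in> carrier S"
  shows "par_supp G (s \<otimes>\<^bsub>S\<^esub> semigroup_inv S s) = par_supp G s"
    "par_deg G (s \<otimes>\<^bsub>S\<^esub> semigroup_inv S s) = \<one>"
  using assms par_supp_props[OF assms]
  by (simp_all add: par_supp_mult par_deg_mult semigroup_inv_par_monoid mult_image_mult_image mult_one_image)

text \<open>In pairs, the action of \<open>(V, g)\<close> on \<open>B\<close> sends
  \<open>(E, 1)\<close> to \<open>(V Un gE, 1)\<close>.\<close>

lemma conjugate_idempotent:
  assumes "s \<in> carrier S" "e \<in> carrier S" "par_deg G e = \<one>"
  shows "par_supp G (s \<otimes>\<^bsub>S\<^esub> e \<otimes>\<^bsub>S\<^esub> semigroup_inv S s) = par_supp G s \<union> mult G (par_deg G s) ` par_supp G e"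
    "par_deg G (s \<otimes>\<^bsub>S\<^esub> e \<otimes>\<^bsub>S\<^esub> semigroup_inv S s) = \<one>"
  using assms par_supp_props[OF assms(1)]
  by (auto simp: par_supp_mult par_deg_mult semigroup_inv_par_monoid mult_image_mult_image mult_one_image)

lemma par_B_simps:
  "carrier B = free_carrier K (idempotents S)" "zero B = (\<lambda>_. \<zero>\<^bsub>K\<^esub>)" "add B = (\<lambda>f g s. f s \<oplus>\<^bsub>K\<^esub> g s)"
  "smult B = bilinear_ext K (\<lambda>s e. s \<otimes>\<^bsub>S\<^esub> e \<otimes>\<^bsub>S\<^esub> semigroup_inv S s)"
  by (simp_all add: par_B_def)

sublocale B: left_module A B
  unfolding par_algebra_def
proof (rule K.left_module_free_carrier[OF monoid_par_monoid par_B_simps])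
  show "Ring.ring (semigroup_algebra K S)"
    using ring_par_algebra by (simp add: par_algebra_def)
next
  fix s e assume "s \<in> carrier S" "e \<in> idempotents S"
  then show "s \<otimes>\<^bsub>S\<^esub> e \<otimes>\<^bsub>S\<^esub> semigroup_inv S s \<in> idempotents S"
    by (simp add: idempotents_par_monoid conjugate_idempotent)
next
  fix e assume "e \<in> idempotents S"
  then show "\<one>\<^bsub>S\<^esub> \<otimes>\<^bsub>S\<^esub> e \<otimes>\<^bsub>S\<^esub> semigroup_inv S \<one>\<^bsub>S\<^esub> = e"
    using par_supp_props[of e] by (intro par_monoid_eqI)
      (auto simp: idempotents_par_monoid conjugate_idempotent mult_one_image simp del: par.l_one)
next
  fix s t e assume st: "s \<in> carrier S" "t \<in> carrier S" and "e \<in> idempotents S"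
  then have e: "e \<in> carrier S" "par_deg G e = \<one>" by (simp_all add: idempotents_par_monoid)
  \<comment> \<open>Writing \<open>s = (V, g)\<close>, \<open>t = (W, h)\<close> and
    \<open>e = (E, 1)\<close>, both sides are \<open>(V Un gW Un ghE, 1)\<close>.\<close>
  show "s \<otimes>\<^bsub>S\<^esub> t \<otimes>\<^bsub>S\<^esub> e \<otimes>\<^bsub>S\<^esub> semigroup_inv S (s \<otimes>\<^bsub>S\<^esub> t) =
      s \<otimes>\<^bsub>S\<^esub> (t \<otimes>\<^bsub>S\<^esub> e \<otimes>\<^bsub>S\<^esub> semigroup_inv S t) \<otimes>\<^bsub>S\<^esub> semigroup_inv S s"
    using st e par_supp_props[OF e(1)] conjugate_idempotent[OF _ e, of "s \<otimes>\<^bsub>S\<^esub> t"]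
      conjugate_idempotent[OF st(2) e]
      conjugate_idempotent[OF st(1), of "t \<otimes>\<^bsub>S\<^esub> e \<otimes>\<^bsub>S\<^esub> semigroup_inv S t"]
    by (intro par_monoid_eqI)
      (simp_all add: par_supp_mult[OF st] par_deg_mult[OF st] image_Un mult_image_mult_image Un_assoc)
qed

lemma monomial_smult_B:
  "\<lbrakk>c \<in> carrier K; d \<in> carrier K\<rbrakk> \<Longrightarrow>
    monomial K c s \<odot>\<^bsub>B\<^esub> monomial K d e = monomial K (c \<otimes>\<^bsub>K\<^esub> d) (s \<otimes>\<^bsub>S\<^esub> e \<otimes>\<^bsub>S\<^esub> semigroup_inv S s)"
  by (simp add: par_B_simps K.bilinear_ext_monomial)

lemma monomial_in_B:
  "\<lbrakk>c \<in> carrier K; e \<in> carrier S; par_deg G e = \<one>\<rbrakk> \<Longrightarrow> monomial K c e \<in> carrier B"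
  by (simp add: par_B_simps idempotents_par_monoid K.monomial_in_free_carrier)

lemma par_boundary0_hom: "par_boundary0 K G \<in> left_module_hom A (P 0) B"
  unfolding par_boundary0_def
proof (rule par_linear_ext_hom[OF B.left_module_axioms])
  fix s gs assume "(s, gs) \<in> par_basis G 0"
  then show "monomial K \<one>\<^bsub>K\<^esub> (s \<otimes>\<^bsub>S\<^esub> semigroup_inv S s) \<in> carrier B"
    by (simp add: par_basis_iff monomial_in_B mult_semigroup_inv)
next
  fix r s gs assume r: "r \<in> carrier S" and "(s, gs) \<in> par_basis G 0"
  then have s: "s \<in> carrier S" by (simp add: par_basis_iff)
  have "r \<otimes>\<^bsub>S\<^esub> s \<otimes>\<^bsub>S\<^esub> semigroup_inv S (r \<otimes>\<^bsub>S\<^esub> s) =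
      r \<otimes>\<^bsub>S\<^esub> (s \<otimes>\<^bsub>S\<^esub> semigroup_inv S s) \<otimes>\<^bsub>S\<^esub> semigroup_inv S r"
    using r s mult_semigroup_inv[OF s] mult_semigroup_inv[of "r \<otimes>\<^bsub>S\<^esub> s"]
      conjugate_idempotent[OF r, of "s \<otimes>\<^bsub>S\<^esub> semigroup_inv S s"]
    by (intro par_monoid_eqI) (simp_all add: par_supp_mult[OF r s])
  then show "monomial K \<one>\<^bsub>K\<^esub> (r \<otimes>\<^bsub>S\<^esub> s \<otimes>\<^bsub>S\<^esub> semigroup_inv S (r \<otimes>\<^bsub>S\<^esub> s)) =
      monomial K \<one>\<^bsub>K\<^esub> r \<odot>\<^bsub>B\<^esub> monomial K \<one>\<^bsub>K\<^esub> (s \<otimes>\<^bsub>S\<^esub> semigroup_inv S s)"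
    by (simp add: monomial_smult_B)
qed

section \<open>The boundary maps in tuple coordinates\<close>

lemma par_elem_eq: "par_elem K G s gs = par_mono K G \<one>\<^bsub>K\<^esub> (s \<otimes>\<^bsub>S\<^esub> par_e_tuple G gs) gs"
  by (simp add: par_elem_def par_mono_def)

lemma par_elem_basis:
  "\<lbrakk>s \<in> carrier S; gs \<in> tuples G n\<rbrakk> \<Longrightarrow> (s \<otimes>\<^bsub>S\<^esub> par_e_tuple G gs, gs) \<in> par_basis G n"
  using tuples_lists[of gs n] by (simp add: par_basis_iff_mult par.m_assoc par_e_tuple_idem)

lemma par_elem_closed: "\<lbrakk>s \<in> carrier S; gs \<in> tuples G n\<rbrakk> \<Longrightarrow> par_elem K G s gs \<in> carrier (P n)"
  by (simp add: par_elem_eq par_mono_closed par_elem_basis)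

lemma par_elem_smult:
  "\<lbrakk>c \<in> carrier K; r \<in> carrier S; s \<in> carrier S; gs \<in> tuples G n\<rbrakk> \<Longrightarrow>
    monomial K c r \<odot>\<^bsub>P n\<^esub> par_elem K G s gs = par_mono K G c (r \<otimes>\<^bsub>S\<^esub> s \<otimes>\<^bsub>S\<^esub> par_e_tuple G gs) gs"
  using tuples_lists[of gs n] by (simp add: par_elem_eq par_mono_smult par_elem_basis par.m_assoc)

lemma merge_at_tuples:
  assumes "gs \<in> tuples G (Suc n)" "i \<in> {1..n}"
  shows "merge_at G i gs \<in> tuples G n"
proof -
  have "gs ! k \<in> carrier G" if "k < Suc n" for k
    using assms that by (auto simp: tuples_def in_lists_conv_set)
  with assms show ?thesis
    by (auto simp: tuples_def merge_at_def in_lists_conv_set dest: in_set_takeD in_set_dropD)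
qed

text \<open>The three shapes of summands in the boundary become one family of faces indexed by
  \<open>0\<close> to \<open>n + 1\<close>. Here \<open>n\<close> is the degree of the target, so
  \<open>gs\<close> has \<open>n + 1\<close> entries.\<close>

definition boundary_term :: "nat \<Rightarrow> 'g list set \<Rightarrow> 'g list \<Rightarrow> nat \<Rightarrow> 'g list \<Rightarrow> 'g list set \<Rightarrow> 'k" where
  "boundary_term n s gs i =
    (if i = 0 then par_elem K G (s \<otimes>\<^bsub>S\<^esub> par_gen G (hd gs)) (tl gs)
     else if i \<le> n then par_elem K G s (merge_at G i gs) else par_elem K G s (butlast gs))"

lemma boundary_term_closed:
  assumes "s \<in> carrier S" "gs \<in> tuples G (Suc n)"
  shows "boundary_term n s gs i \<in> carrier (P n)"
proof -
  have "hd gs \<in> carrier G" "tl gs \<in> tuples G n" "butlast gs \<in> tuples G n"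
    using assms by (auto simp: tuples_def in_lists_conv_set length_Suc_conv dest: in_set_butlastD)
  with assms show ?thesis
    by (auto simp: boundary_term_def intro!: par_elem_closed merge_at_tuples)
qed

lemma boundary_term_smult:
  assumes "r \<in> carrier S" "s \<in> carrier S" "gs \<in> tuples G (Suc n)"
  shows "boundary_term n (r \<otimes>\<^bsub>S\<^esub> s) gs i = monomial K \<one>\<^bsub>K\<^esub> r \<odot>\<^bsub>P n\<^esub> boundary_term n s gs i"
proof -
  have "hd gs \<in> carrier G" "tl gs \<in> tuples G n" "butlast gs \<in> tuples G n"
    using assms by (auto simp: tuples_def in_lists_conv_set length_Suc_conv dest: in_set_butlastD)
  with assms merge_at_tuples[OF assms(3), of i] show ?thesis
    by (auto simp: boundary_term_def par_elem_smult, auto simp: par_elem_eq par.m_assoc)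
qed

definition boundary_sum :: "nat \<Rightarrow> 'g list set \<Rightarrow> 'g list \<Rightarrow> 'g list \<Rightarrow> 'g list set \<Rightarrow> 'k" where
  "boundary_sum n s gs = (\<Oplus>\<^bsub>P n\<^esub>i\<in>{..Suc n}. [((-1 :: int) ^ i)] \<cdot>\<^bsub>P n\<^esub> boundary_term n s gs i)"

lemma boundary_sum_eq:
  assumes "s \<in> carrier S" "gs \<in> tuples G (Suc n)"
  shows "par_elem K G (s \<otimes>\<^bsub>S\<^esub> par_gen G (hd gs)) (tl gs)
      \<oplus>\<^bsub>P n\<^esub> (\<Oplus>\<^bsub>P n\<^esub>i\<in>{1..n}. [((-1 :: int) ^ i)] \<cdot>\<^bsub>P n\<^esub> par_elem K G s (merge_at G i gs))
      \<oplus>\<^bsub>P n\<^esub> [((-1 :: int) ^ Suc n)] \<cdot>\<^bsub>P n\<^esub> par_elem K G s (butlast gs) = boundary_sum n s gs"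
proof -
  have split: "(\<Oplus>\<^bsub>P n\<^esub>i\<in>{..Suc n}. t i) = t 0 \<oplus>\<^bsub>P n\<^esub> (\<Oplus>\<^bsub>P n\<^esub>i\<in>{1..n}. t i) \<oplus>\<^bsub>P n\<^esub> t (Suc n)"
    if c: "\<And>i. t i \<in> carrier (P n)" for t
  proof -
    have set: "{..Suc n} = insert (Suc n) (insert 0 {1..n})" by auto
    have sum: "(\<Oplus>\<^bsub>P n\<^esub>i\<in>{1..n}. t i) \<in> carrier (P n)" using c by (intro P.finsum_closed) auto
    have "(\<Oplus>\<^bsub>P n\<^esub>i\<in>{..Suc n}. t i) = t (Suc n) \<oplus>\<^bsub>P n\<^esub> (t 0 \<oplus>\<^bsub>P n\<^esub> (\<Oplus>\<^bsub>P n\<^esub>i\<in>{1..n}. t i))"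
      unfolding set using c by (simp add: P.finsum_insert Pi_def)
    then show ?thesis using c sum by (simp add: P.a_comm)
  qed
  let ?t = "\<lambda>i. [((-1 :: int) ^ i)] \<cdot>\<^bsub>P n\<^esub> boundary_term n s gs i"
  have c: "?t i \<in> carrier (P n)" for i
    by (intro P.add.int_pow_closed boundary_term_closed assms)
  have mid: "(\<Oplus>\<^bsub>P n\<^esub>i\<in>{1..n}. [((-1 :: int) ^ i)] \<cdot>\<^bsub>P n\<^esub> par_elem K G s (merge_at G i gs)) =
      (\<Oplus>\<^bsub>P n\<^esub>i\<in>{1..n}. ?t i)"
    using c by (intro P.finsum_cong') (auto simp: boundary_term_def)
  have first: "par_elem K G (s \<otimes>\<^bsub>S\<^esub> par_gen G (hd gs)) (tl gs) = ?t 0"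
    using boundary_term_closed[OF assms, of 0] by (simp add: boundary_term_def P.add.int_pow_1)
  have last: "[((-1 :: int) ^ Suc n)] \<cdot>\<^bsub>P n\<^esub> par_elem K G s (butlast gs) = ?t (Suc n)"
    by (simp add: boundary_term_def)
  show ?thesis unfolding boundary_sum_def split[of ?t, OF c] mid first last ..
qed

lemma boundary_sum_closed:
  assumes "s \<in> carrier S" "gs \<in> tuples G (Suc n)"
  shows "boundary_sum n s gs \<in> carrier (P n)"
  unfolding boundary_sum_def
  by (intro P.finsum_closed Pi_I P.add.int_pow_closed boundary_term_closed assms)

lemma boundary_sum_smult:
  assumes "r \<in> carrier S" "s \<in> carrier S" "gs \<in> tuples G (Suc n)"
  shows "boundary_sum n (r \<otimes>\<^bsub>S\<^esub> s) gs = monomial K \<one>\<^bsub>K\<^esub> r \<odot>\<^bsub>P n\<^esub> boundary_sum n s gs"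
proof -
  have r: "monomial K \<one>\<^bsub>K\<^esub> r \<in> carrier A" using assms by simp
  note smult = P.smult_additive_right[OF r, of n]
  note t = boundary_term_closed[OF assms(2,3)]
  have "monomial K \<one>\<^bsub>K\<^esub> r \<odot>\<^bsub>P n\<^esub> boundary_sum n s gs =
      (\<Oplus>\<^bsub>P n\<^esub>i\<in>{..Suc n}. monomial K \<one>\<^bsub>K\<^esub> r \<odot>\<^bsub>P n\<^esub> ([((-1 :: int) ^ i)] \<cdot>\<^bsub>P n\<^esub> boundary_term n s gs i))"
    unfolding boundary_sum_def
    by (intro additive_finsum[OF P.abelian_group P.abelian_group smult] Pi_I P.add.int_pow_closed t)
  also have "\<dots> = boundary_sum n (r \<otimes>\<^bsub>S\<^esub> s) gs"
    unfolding boundary_sum_def boundary_term_smult[OF assms]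
      additive_add_pow_int[OF P.abelian_group P.abelian_group smult t] ..
  finally show ?thesis ..
qed

lemma par_boundary_hom: "par_boundary K G (Suc n) \<in> left_module_hom A (P (Suc n)) (P n)"
  unfolding par_boundary_def diff_Suc_1
proof (rule par_linear_ext_hom[OF P.left_module_axioms])
  fix s gs assume "(s, gs) \<in> par_basis G (Suc n)"
  then have "s \<in> carrier S" "gs \<in> tuples G (Suc n)" by (simp_all add: par_basis_iff)
  from boundary_sum_closed[OF this]
  show "par_elem K G (s \<otimes>\<^bsub>S\<^esub> par_gen G (hd gs)) (tl gs)
      \<oplus>\<^bsub>P n\<^esub> (\<Oplus>\<^bsub>P n\<^esub>i\<in>{1..n}. [((-1 :: int) ^ i)] \<cdot>\<^bsub>P n\<^esub> par_elem K G s (merge_at G i gs))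
      \<oplus>\<^bsub>P n\<^esub> [((-1 :: int) ^ Suc n)] \<cdot>\<^bsub>P n\<^esub> par_elem K G s (butlast gs) \<in> carrier (P n)"
    unfolding boundary_sum_eq[OF \<open>s \<in> carrier S\<close> \<open>gs \<in> tuples G (Suc n)\<close>] .
next
  fix r s gs assume r: "r \<in> carrier S" and "(s, gs) \<in> par_basis G (Suc n)"
  then have s: "s \<in> carrier S" "gs \<in> tuples G (Suc n)" by (simp_all add: par_basis_iff)
  show "par_elem K G (r \<otimes>\<^bsub>S\<^esub> s \<otimes>\<^bsub>S\<^esub> par_gen G (hd gs)) (tl gs)
      \<oplus>\<^bsub>P n\<^esub> (\<Oplus>\<^bsub>P n\<^esub>i\<in>{1..n}. [((-1 :: int) ^ i)] \<cdot>\<^bsub>P n\<^esub> par_elem K G (r \<otimes>\<^bsub>S\<^esub> s) (merge_at G i gs))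
      \<oplus>\<^bsub>P n\<^esub> [((-1 :: int) ^ Suc n)] \<cdot>\<^bsub>P n\<^esub> par_elem K G (r \<otimes>\<^bsub>S\<^esub> s) (butlast gs) =
    monomial K \<one>\<^bsub>K\<^esub> r \<odot>\<^bsub>P n\<^esub> (par_elem K G (s \<otimes>\<^bsub>S\<^esub> par_gen G (hd gs)) (tl gs)
      \<oplus>\<^bsub>P n\<^esub> (\<Oplus>\<^bsub>P n\<^esub>i\<in>{1..n}. [((-1 :: int) ^ i)] \<cdot>\<^bsub>P n\<^esub> par_elem K G s (merge_at G i gs))
      \<oplus>\<^bsub>P n\<^esub> [((-1 :: int) ^ Suc n)] \<cdot>\<^bsub>P n\<^esub> par_elem K G s (butlast gs))"
    unfolding boundary_sum_eq[OF s] boundary_sum_eq[OF par.m_closed[OF r s(1)] s(2)]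
    by (rule boundary_sum_smult[OF r s])
qed

lemma par_boundary_mono:
  assumes c: "c \<in> carrier K" and b: "(s, gs) \<in> par_basis G (Suc n)"
  shows "par_boundary K G (Suc n) (par_mono K G c s gs) =
    (\<Oplus>\<^bsub>P n\<^esub>i\<in>{..Suc n}. [((-1 :: int) ^ i)] \<cdot>\<^bsub>P n\<^esub> (monomial K c \<one>\<^bsub>S\<^esub> \<odot>\<^bsub>P n\<^esub> boundary_term n s gs i))"
proof -
  have s: "s \<in> carrier S" "gs \<in> tuples G (Suc n)" using b by (simp_all add: par_basis_iff)
  have c1: "monomial K c \<one>\<^bsub>S\<^esub> \<in> carrier A" using c by simp
  note smult = P.smult_additive_right[OF c1, of n]
  note t = boundary_term_closed[OF s]
  have "par_boundary K G (Suc n) (par_mono K G c s gs) = monomial K c \<one>\<^bsub>S\<^esub> \<odot>\<^bsub>P n\<^esub> boundary_sum n s gs"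
    unfolding par_boundary_def diff_Suc_1
    by (subst par_linear_ext_mono[OF P.left_module_axioms b _ c])
      (simp_all only: boundary_sum_eq[OF s] boundary_sum_closed[OF s])
  also have "\<dots> = (\<Oplus>\<^bsub>P n\<^esub>i\<in>{..Suc n}. monomial K c \<one>\<^bsub>S\<^esub> \<odot>\<^bsub>P n\<^esub> ([((-1 :: int) ^ i)] \<cdot>\<^bsub>P n\<^esub> boundary_term n s gs i))"
    unfolding boundary_sum_def
    by (intro additive_finsum[OF P.abelian_group P.abelian_group smult] Pi_I P.add.int_pow_closed t)
  finally show ?thesis
    unfolding additive_add_pow_int[OF P.abelian_group P.abelian_group smult t] .
qed

lemma par_boundary0_mono:
  assumes "c \<in> carrier K" "s \<in> carrier S" "(s, []) \<in> par_basis G 0"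
  shows "par_boundary0 K G (par_mono K G c s []) = monomial K c (s \<otimes>\<^bsub>S\<^esub> semigroup_inv S s)"
proof -
  let ?e = "s \<otimes>\<^bsub>S\<^esub> semigroup_inv S s"
  have e: "?e \<in> carrier S" "par_deg G ?e = \<one>" using assms by (simp_all add: mult_semigroup_inv)
  have "par_boundary0 K G (par_mono K G c s []) = monomial K c \<one>\<^bsub>S\<^esub> \<odot>\<^bsub>B\<^esub> monomial K \<one>\<^bsub>K\<^esub> ?e"
    unfolding par_boundary0_def
    by (rule par_linear_ext_mono[OF B.left_module_axioms assms(3) _ assms(1)]) (simp add: monomial_in_B e)
  also have "\<dots> = monomial K c (\<one>\<^bsub>S\<^esub> \<otimes>\<^bsub>S\<^esub> ?e \<otimes>\<^bsub>S\<^esub> semigroup_inv S \<one>\<^bsub>S\<^esub>)"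
    using assms by (simp add: monomial_smult_B)
  also have "\<one>\<^bsub>S\<^esub> \<otimes>\<^bsub>S\<^esub> ?e \<otimes>\<^bsub>S\<^esub> semigroup_inv S \<one>\<^bsub>S\<^esub> = ?e"
    using e par_supp_props[OF e(1)] conjugate_idempotent[OF par.one_closed e]
    by (intro par_monoid_eqI) (auto simp: mult_one_image simp del: par.l_one)
  finally show ?thesis .
qed

end

section \<open>The simplicial description and the contraction\<close>

text \<open>The passage from homogeneous to inhomogeneous coordinates, as for the bar resolution of
  a group.\<close>

definition vertex_diffs :: "('g, 'd) monoid_scheme \<Rightarrow> 'g list \<Rightarrow> 'g list" where
  "vertex_diffs G vs = map (\<lambda>k. inv\<^bsub>G\<^esub> (vs ! k) \<otimes>\<^bsub>G\<^esub> vs ! Suc k) [0..<length vs - 1]"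

definition delete_at :: "nat \<Rightarrow> 'a list \<Rightarrow> 'a list" where
  "delete_at i xs = take i xs @ drop (Suc i) xs"

lemma length_delete_at: "i < length xs \<Longrightarrow> length (delete_at i xs) = length xs - 1"
  by (simp add: delete_at_def)

lemma set_delete_at: "set (delete_at i xs) \<subseteq> set xs"
  by (auto simp: delete_at_def dest: in_set_takeD in_set_dropD)

lemma nth_delete_at:
  "\<lbrakk>i < length xs; Suc k < length xs\<rbrakk> \<Longrightarrow> delete_at i xs ! k = (if k < i then xs ! k else xs ! Suc k)"
  by (auto simp: delete_at_def nth_append min_def)

lemma delete_at_Cons [simp]: "delete_at 0 (x # xs) = xs" "delete_at (Suc i) (x # xs) = x # delete_at i xs"
  by (simp_all add: delete_at_def)

lemma length_vertex_diffs [simp]: "length (vertex_diffs G vs) = length vs - 1"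
  by (simp add: vertex_diffs_def)

lemma nth_vertex_diffs:
  "Suc k < length vs \<Longrightarrow> vertex_diffs G vs ! k = inv\<^bsub>G\<^esub> (vs ! k) \<otimes>\<^bsub>G\<^esub> vs ! Suc k"
  by (simp add: vertex_diffs_def less_diff_conv)

lemma vertex_diffs_singleton [simp]: "vertex_diffs G [v] = []"
  by (simp add: vertex_diffs_def)

lemma vertex_diffs_Cons:
  "vs \<noteq> [] \<Longrightarrow> vertex_diffs G (v # vs) = (inv\<^bsub>G\<^esub> v \<otimes>\<^bsub>G\<^esub> hd vs) # vertex_diffs G vs"
  by (intro nth_equalityI) (auto simp: nth_vertex_diffs nth_Cons' hd_conv_nth)

section \<open>Conversion between tuples and vertex lists\<close>

context group
begin

lemma vertex_diffs_closed: "vs \<in> lists (carrier G) \<Longrightarrow> vertex_diffs G vs \<in> lists (carrier G)"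
  by (auto simp: vertex_diffs_def in_lists_conv_set)

text \<open>The products telescope. With \<open>vertex_diffs_map_prefix_prods\<close> this makes
  vertex lists equivalent to a first vertex together with a tuple.\<close>

lemma map_prefix_prods_vertex_diffs:
  assumes "vs \<noteq> []" "vs \<in> lists (carrier G)"
  shows "map (mult G (hd vs)) (prefix_prods G (vertex_diffs G vs)) = vs"
  using assms(1) assms(2)
proof (induction vs rule: list_nonempty_induct)
  case (cons v vs)
  have v: "v \<in> carrier G" "hd vs \<in> carrier G" "vs \<in> lists (carrier G)"
    using cons by (auto simp: in_lists_conv_set)
  have "v \<otimes> (inv v \<otimes> hd vs \<otimes> x) = hd vs \<otimes> x" if "x \<in> set (prefix_prods G (vertex_diffs G vs))" for x
    using that v prefix_prods_closed[OF vertex_diffs_closed[OF v(3)]] by (auto simp: m_assoc[symmetric])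
  then have "map (mult G v) (map (mult G (inv v \<otimes> hd vs)) (prefix_prods G (vertex_diffs G vs))) =
      map (mult G (hd vs)) (prefix_prods G (vertex_diffs G vs))"
    by simp
  then show ?case using cons v by (simp add: vertex_diffs_Cons)
qed simp

lemma hd_map_prefix_prods: "g \<in> carrier G \<Longrightarrow> hd (map (mult G g) (prefix_prods G gs)) = g"
  by (cases gs) auto

lemma prefix_prods_nonempty [simp]: "prefix_prods G gs \<noteq> []"
  by (cases gs) auto

lemma length_prefix_prods [simp]: "length (prefix_prods G gs) = Suc (length gs)"
  by (induction gs) auto

lemma vertex_diffs_map_prefix_prods:
  assumes "g \<in> carrier G" "gs \<in> lists (carrier G)"
  shows "vertex_diffs G (map (mult G g) (prefix_prods G gs)) = gs"
  using assms(2,1)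
proof (induction gs arbitrary: g)
  case (Cons h gs)
  have "map (mult G g) (map (mult G h) (prefix_prods G gs)) = map (mult G (g \<otimes> h)) (prefix_prods G gs)"
    using Cons prefix_prods_closed[OF Cons.hyps(2)] by (auto simp: m_assoc)
  moreover have "inv g \<otimes> (g \<otimes> h) = h" using Cons by (simp add: m_assoc[symmetric])
  ultimately show ?case
    using Cons hd_map_prefix_prods[of "g \<otimes> h" gs]
    by (simp add: vertex_diffs_Cons del: map_map)
qed simp

lemma vertex_diffs_tl: "length vs \<ge> 2 \<Longrightarrow> vertex_diffs G (delete_at 0 vs) = tl (vertex_diffs G vs)"
  by (cases vs) (auto simp: vertex_diffs_Cons Suc_le_length_iff)

lemma vertex_diffs_butlast:
  "length vs = Suc (Suc n) \<Longrightarrow> vertex_diffs G (delete_at (Suc n) vs) = butlast (vertex_diffs G vs)"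
  by (intro nth_equalityI) (auto simp: length_delete_at nth_vertex_diffs nth_delete_at nth_butlast)

text \<open>Deleting an inner vertex multiplies the two differences that meet there, and the deleted
  vertex cancels from the product.\<close>

lemma vertex_diffs_merge:
  assumes "vs \<in> lists (carrier G)" "length vs = Suc (Suc n)" "i \<in> {1..n}"
  shows "vertex_diffs G (delete_at i vs) = merge_at G i (vertex_diffs G vs)"
proof (rule nth_equalityI)
  show "length (vertex_diffs G (delete_at i vs)) = length (merge_at G i (vertex_diffs G vs))"
    using assms by (auto simp: length_delete_at merge_at_def min_def)
next
  fix k assume "k < length (vertex_diffs G (delete_at i vs))"
  then have k: "k < n" using assms by (simp add: length_delete_at)
  have car: "vs ! j \<in> carrier G" if "j < Suc (Suc n)" for j
    using that assms by (simp add: in_lists_conv_set)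
  consider "Suc k < i" | "Suc k = i" | "i \<le> k" by linarith
  then show "vertex_diffs G (delete_at i vs) ! k = merge_at G i (vertex_diffs G vs) ! k"
  proof cases
    \<comment> \<open>The 0-based position \<open>i - 1\<close> is the only one holding a product;
      elsewhere the entries are copied or shifted.\<close>
    case 2
    have "vs ! Suc k \<otimes> (inv (vs ! Suc k) \<otimes> vs ! Suc (Suc k)) = vs ! Suc (Suc k)"
      using k car by (simp add: m_assoc[symmetric])
    then have "inv (vs ! k) \<otimes> vs ! Suc (Suc k) =
        (inv (vs ! k) \<otimes> vs ! Suc k) \<otimes> (inv (vs ! Suc k) \<otimes> vs ! Suc (Suc k))"
      using k car by (simp add: m_assoc)
    then show ?thesis
      using assms k 2 by (auto simp: length_delete_at nth_vertex_diffs nth_delete_at merge_at_def nth_append)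
  qed (use assms k in \<open>auto simp: length_delete_at nth_vertex_diffs nth_delete_at merge_at_def
      nth_append min_def nth_Cons'\<close>)
qed

text \<open>The element that the overview writes as \<open>(V, g)\<close>; uniqueness is
  \<open>par_monoid_eqI\<close>.\<close>

definition par_of :: "'a set \<Rightarrow> 'a \<Rightarrow> 'a list set" where
  "par_of V g = (THE s. s \<in> carrier (par_monoid G) \<and> par_supp G s = V \<and> par_deg G s = g)"

lemma par_of_eqI:
  "\<lbrakk>s \<in> carrier (par_monoid G); par_supp G s = V; par_deg G s = g\<rbrakk> \<Longrightarrow> par_of V g = s"
  unfolding par_of_def by (rule the_equality, blast, rule par_monoid_eqI, simp_all)

lemma par_of:
  assumes "finite V" "V \<subseteq> carrier G" "\<one> \<in> V" "g \<in> V"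
  shows "par_of V g \<in> carrier (par_monoid G)" "par_supp G (par_of V g) = V" "par_deg G (par_of V g) = g"
  using par_monoid_exists[OF assms] par_of_eqI by metis+

text \<open>Vertices may repeat, as in ordered chain complexes. The condition on \<open>1\<close>
  makes \<open>V\<close> a possible support; the degree is the first vertex.\<close>

definition is_simplex :: "nat \<Rightarrow> 'a set \<Rightarrow> 'a list \<Rightarrow> bool" where
  "is_simplex n V vs \<longleftrightarrow>
    finite V \<and> V \<subseteq> carrier G \<and> \<one> \<in> V \<and> set vs \<subseteq> V \<and> length vs = Suc n"

lemma is_simplexD:
  assumes "is_simplex n V vs"
  shows "vs \<noteq> []" "vs \<in> lists (carrier G)" "hd vs \<in> V" "length vs = Suc n"
proof -
  show "vs \<noteq> []" using assms by (auto simp: is_simplex_def)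
  from hd_in_set[OF this] show "hd vs \<in> V" using assms by (auto simp: is_simplex_def)
qed (use assms in \<open>auto simp: is_simplex_def in_lists_conv_set\<close>)

lemma is_simplex_par_of:
  assumes "is_simplex n V vs"
  shows "par_of V (hd vs) \<in> carrier (par_monoid G)" "par_supp G (par_of V (hd vs)) = V"
    "par_deg G (par_of V (hd vs)) = hd vs"
  using assms is_simplexD(3)[OF assms] by (simp_all add: is_simplex_def par_of)

lemma is_simplex_diffs:
  "is_simplex n V vs \<Longrightarrow> vertex_diffs G vs \<in> tuples G n"
  using is_simplexD vertex_diffs_closed by (simp add: tuples_def)

lemma is_simplex_delete_at: "\<lbrakk>is_simplex (Suc n) V vs; i \<le> Suc n\<rbrakk> \<Longrightarrow> is_simplex n V (delete_at i vs)"
  using set_delete_at[of i vs] by (auto simp: is_simplex_def length_delete_at)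

lemma is_simplex_Cons_one: "is_simplex n V vs \<Longrightarrow> is_simplex (Suc n) V (\<one> # vs)"
  by (simp add: is_simplex_def)

lemma set_map_prefix_prods_diffs:
  "is_simplex n V vs \<Longrightarrow> mult G (hd vs) ` set (prefix_prods G (vertex_diffs G vs)) = set vs"
  using map_prefix_prods_vertex_diffs[OF is_simplexD(1,2)] by (metis set_map)

lemma is_simplex_basis: "is_simplex n V vs \<Longrightarrow> (par_of V (hd vs), vertex_diffs G vs) \<in> par_basis G n"
  by (simp add: par_basis_iff is_simplex_par_of is_simplex_diffs set_map_prefix_prods_diffs)
    (simp add: is_simplex_def)

text \<open>Take the support of \<open>s\<close> for \<open>V\<close>, and for the vertices the
  partial products of the tuple translated by the degree of \<open>s\<close>.\<close>

lemma basis_simplex: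
  assumes "(s, gs) \<in> par_basis G n"
  obtains V vs where "is_simplex n V vs" "s = par_of V (hd vs)" "gs = vertex_diffs G vs"
proof
  let ?vs = "map (mult G (par_deg G s)) (prefix_prods G gs)"
  have s: "s \<in> carrier (par_monoid G)" "gs \<in> lists (carrier G)" "length gs = n"
    using assms by (simp_all add: par_basis_iff tuples_def)
  show "is_simplex n (par_supp G s) ?vs"
    using assms s par_supp_props[OF s(1)] by (simp add: is_simplex_def par_basis_iff)
  show "s = par_of (par_supp G s) (hd ?vs)"
    using s by (intro par_of_eqI[symmetric]) (simp_all only: hd_map_prefix_prods par_deg_closed)
  show "gs = vertex_diffs G ?vs"
    using s by (simp add: vertex_diffs_map_prefix_prods del: map_map)
qed

end

context partial_group_algebra
begin

text \<open>
  The basis element \<open>(V, v\<^sub>0) (v\<^sub>0\<^sup>-\<^sup>1 v\<^sub>1, \<dots>)\<close>, viewed as the ordered simplex \<open>(v\<^sub>0, \<dots>, v\<^sub>n)\<close> of the full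
  simplex on \<open>V\<close>.
\<close>

definition simplex :: "'k \<Rightarrow> 'g set \<Rightarrow> 'g list \<Rightarrow> 'g list \<Rightarrow> 'g list set \<Rightarrow> 'k" where
  "simplex c V vs = par_mono K G c (par_of V (hd vs)) (vertex_diffs G vs)"

lemma simplex_closed: "\<lbrakk>c \<in> carrier K; is_simplex n V vs\<rbrakk> \<Longrightarrow> simplex c V vs \<in> carrier (P n)"
  by (simp add: simplex_def par_mono_closed is_simplex_basis)

lemma simplex_induct [consumes 1, case_names zero add]:
  assumes x: "x \<in> carrier (P n)"
    and zero: "R \<zero>\<^bsub>P n\<^esub>"
    and add: "\<And>x c V vs. \<lbrakk>x \<in> carrier (P n); R x; c \<in> carrier K; is_simplex n V vs\<rbrakk> \<Longrightarrow>
      R (x \<oplus>\<^bsub>P n\<^esub> simplex c V vs)"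
  shows "R x"
  using x
proof (induction x rule: par_P_induct)
  case (add x c s gs)
  then show ?case using assms(3) by (metis basis_simplex simplex_def)
qed (rule zero)

text \<open>The idempotent inside \<open>par_elem\<close> keeps the degree of \<open>t\<close> and
  adds the vertices of \<open>vs\<close> to its support.\<close>

lemma par_elem_simplex:
  assumes c: "c \<in> carrier K" and vs: "is_simplex n V vs" and t: "t \<in> carrier S" "par_deg G t = hd vs"
    "par_supp G t \<union> set vs = V"
  shows "monomial K c \<one>\<^bsub>S\<^esub> \<odot>\<^bsub>P n\<^esub> par_elem K G t (vertex_diffs G vs) = simplex c V vs"
proof -
  note gs = is_simplex_diffs[OF vs]
  have "par_of V (hd vs) = t \<otimes>\<^bsub>S\<^esub> par_e_tuple G (vertex_diffs G vs)"
    using t tuples_lists[OF gs]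
    by (intro par_of_eqI) (simp_all add: par_supp_mult par_deg_mult par_supp_e_tuple par_deg_e_tuple
      t(2)[symmetric] set_map_prefix_prods_diffs[OF vs, folded t(2)])
  then show ?thesis using c t gs by (simp add: par_elem_smult simplex_def)
qed

text \<open>Every face keeps \<open>V\<close>. Only deletion of the first vertex changes the base
  point, which is why that face alone multiplies \<open>s\<close> by a generator.\<close>

lemma boundary_term_simplex:
  assumes c: "c \<in> carrier K" and vs: "is_simplex (Suc n) V vs" and i: "i \<le> Suc n"
  shows "monomial K c \<one>\<^bsub>S\<^esub> \<odot>\<^bsub>P n\<^esub> boundary_term n (par_of V (hd vs)) (vertex_diffs G vs) i =
    simplex c V (delete_at i vs)"
proof -
  note vsD = is_simplexD[OF vs] and del = is_simplex_delete_at[OF vs i]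
  note s = is_simplex_par_of[OF vs]
  have sub: "set (delete_at i vs) \<subseteq> V" using del by (simp add: is_simplex_def)
  obtain v w us where vs_eq: "vs = v # w # us"
    using vsD(4) by (metis length_Suc_conv)
  have vw: "v \<in> carrier G" "w \<in> carrier G" "v \<in> V" "w \<in> V" "V \<subseteq> carrier G"
    using vs by (auto simp: is_simplex_def vs_eq)
  consider "i = 0" | "i \<in> {1..n}" | "i = Suc n" using i by fastforce
  then show ?thesis
  proof cases
    \<comment> \<open>Multiplication by \<open>[inv v w]\<close> moves the degree from
      \<open>v\<close> to \<open>w\<close>; the support does not grow because \<open>w\<close> is
      already in \<open>V\<close>.\<close>
    case 1
    let ?t = "par_of V (hd vs) \<otimes>\<^bsub>S\<^esub> par_gen G (hd (vertex_diffs G vs))"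
    have hd: "hd (vertex_diffs G vs) = inv v \<otimes> w" by (simp add: vs_eq vertex_diffs_Cons)
    have vw': "v \<otimes> (inv v \<otimes> w) = w" using vw by (simp add: m_assoc[symmetric])
    have "?t \<in> carrier S" "par_deg G ?t = hd (delete_at i vs)" "par_supp G ?t \<union> set (delete_at i vs) = V"
      using s vw vw' sub unfolding hd
      by (auto simp: par_deg_mult par_supp_mult par_supp_deg_gen 1 vs_eq)
    from par_elem_simplex[OF c del this] show ?thesis
      using vsD(4) by (simp add: boundary_term_def 1 vertex_diffs_tl)
  next
    case 2
    then have "hd (delete_at i vs) = hd vs" by (cases i) (simp_all add: vs_eq)
    with par_elem_simplex[OF c del s(1)] s sub show ?thesis
      using 2 vertex_diffs_merge[OF vsD(2) vsD(4) 2] by (auto simp: boundary_term_def)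
  next
    case 3
    then have "hd (delete_at i vs) = hd vs" by (simp add: vs_eq)
    with par_elem_simplex[OF c del s(1)] s sub show ?thesis
      using 3 vertex_diffs_butlast[OF vsD(4)] by (auto simp: boundary_term_def)
  qed
qed

lemma par_boundary_simplex:
  assumes c: "c \<in> carrier K" and vs: "is_simplex (Suc n) V vs"
  shows "par_boundary K G (Suc n) (simplex c V vs) =
    (\<Oplus>\<^bsub>P n\<^esub>i\<in>{..Suc n}. [((-1 :: int) ^ i)] \<cdot>\<^bsub>P n\<^esub> simplex c V (delete_at i vs))"
  unfolding simplex_def[of c V vs] par_boundary_mono[OF c is_simplex_basis[OF vs]]
  using simplex_closed[OF c is_simplex_delete_at[OF vs]]
  by (intro P.finsum_cong') (auto simp: boundary_term_simplex[OF c vs])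

text \<open>For \<open>s = (V, g)\<close> the product of \<open>s\<close> with its inverse is
  \<open>(V, 1)\<close>, so the new first vertex is \<open>1\<close>; prefixing \<open>g\<close> to
  the tuple makes the old first vertex the second one.\<close>

definition contraction :: "nat \<Rightarrow> ('g list \<Rightarrow> 'g list set \<Rightarrow> 'k) \<Rightarrow> 'g list \<Rightarrow> 'g list set \<Rightarrow> 'k" where
  "contraction n = par_linear_ext K G n (P (Suc n))
    (\<lambda>s gs. par_elem K G (s \<otimes>\<^bsub>S\<^esub> semigroup_inv S s) (par_deg G s # gs))"

lemma contraction_term_closed:
  "(s, gs) \<in> par_basis G n \<Longrightarrow>
    par_elem K G (s \<otimes>\<^bsub>S\<^esub> semigroup_inv S s) (par_deg G s # gs) \<in> carrier (P (Suc n))"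
  by (intro par_elem_closed) (auto simp: par_basis_iff tuples_def)

lemma contraction_additive: "contraction n \<in> hom (add_monoid (P n)) (add_monoid (P (Suc n)))"
  unfolding contraction_def
  by (rule par_linear_ext_additive[OF P.left_module_axioms contraction_term_closed])

lemma contraction_simplex:
  assumes c: "c \<in> carrier K" and vs: "is_simplex n V vs"
  shows "contraction n (simplex c V vs) = simplex c V (\<one> # vs)"
proof -
  note b = is_simplex_basis[OF vs] and s = is_simplex_par_of[OF vs]
  let ?s = "par_of V (hd vs)"
  have hd: "hd vs \<in> carrier G" using is_simplexD(1,2)[OF vs] by (auto simp: in_lists_conv_set)
  have "contraction n (simplex c V vs) = monomial K c \<one>\<^bsub>S\<^esub> \<odot>\<^bsub>P (Suc n)\<^esub>
      par_elem K G (?s \<otimes>\<^bsub>S\<^esub> semigroup_inv S ?s) (par_deg G ?s # vertex_diffs G vs)"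
    unfolding contraction_def simplex_def
    by (rule par_linear_ext_mono[OF P.left_module_axioms b _ c]) (rule contraction_term_closed[OF b])
  also have "par_deg G ?s # vertex_diffs G vs = vertex_diffs G (\<one> # vs)"
    using is_simplexD(1)[OF vs] hd s by (simp add: vertex_diffs_Cons)
  also have "monomial K c \<one>\<^bsub>S\<^esub> \<odot>\<^bsub>P (Suc n)\<^esub> par_elem K G (?s \<otimes>\<^bsub>S\<^esub> semigroup_inv S ?s) \<dots> =
      simplex c V (\<one> # vs)"
    using s vs by (intro par_elem_simplex c is_simplex_Cons_one vs)
      (auto simp: mult_semigroup_inv is_simplex_def)
  finally show ?thesis .
qed

text \<open>The cancellation in the homotopy: deleting vertex \<open>i + 1\<close> after inserting
  \<open>1\<close> gives the same simplex as deleting vertex \<open>i\<close> before, with the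
  opposite sign.\<close>

lemma P_finsum_neg_add:
  assumes y: "\<And>i. i \<in> I \<Longrightarrow> y i \<in> carrier (P n)"
  shows "(\<Oplus>\<^bsub>P n\<^esub>i\<in>I. [((-1 :: int) ^ Suc i)] \<cdot>\<^bsub>P n\<^esub> y i) \<oplus>\<^bsub>P n\<^esub>
    (\<Oplus>\<^bsub>P n\<^esub>i\<in>I. [((-1 :: int) ^ i)] \<cdot>\<^bsub>P n\<^esub> y i) = \<zero>\<^bsub>P n\<^esub>"
proof -
  have "(\<Oplus>\<^bsub>P n\<^esub>i\<in>I. [((-1 :: int) ^ Suc i)] \<cdot>\<^bsub>P n\<^esub> y i) \<oplus>\<^bsub>P n\<^esub>
      (\<Oplus>\<^bsub>P n\<^esub>i\<in>I. [((-1 :: int) ^ i)] \<cdot>\<^bsub>P n\<^esub> y i) =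
      (\<Oplus>\<^bsub>P n\<^esub>i\<in>I. [((-1 :: int) ^ Suc i)] \<cdot>\<^bsub>P n\<^esub> y i \<oplus>\<^bsub>P n\<^esub> [((-1 :: int) ^ i)] \<cdot>\<^bsub>P n\<^esub> y i)"
    using y by (intro P.finsum_addf[symmetric]) auto
  also have "\<dots> = (\<Oplus>\<^bsub>P n\<^esub>i\<in>I. \<zero>\<^bsub>P n\<^esub>)"
    using y by (intro P.finsum_cong') (auto simp: P.add.int_pow_neg P.l_neg)
  finally show ?thesis by (simp add: P.finsum_zero)
qed

lemma contraction_id_Suc:
  assumes "x \<in> carrier (P (Suc n))"
  shows "par_boundary K G (Suc (Suc n)) (contraction (Suc n) x) \<oplus>\<^bsub>P (Suc n)\<^esub>
    contraction n (par_boundary K G (Suc n) x) = x"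
proof -
  note d = left_module_hom_additive[OF par_boundary_hom] and h = contraction_additive
  note [simp] = additive_closed[OF d] additive_closed[OF h]
  show ?thesis
    using assms
  proof (induction x rule: simplex_induct)
    case zero
    show ?case
      by (simp add: additive_zero[OF P.abelian_group P.abelian_group d]
          additive_zero[OF P.abelian_group P.abelian_group h])
  next
    case (add x c V vs)
    note vs = \<open>is_simplex (Suc n) V vs\<close> and c = \<open>c \<in> carrier K\<close>
    let ?x = "simplex c V vs" and ?y = "\<lambda>i. simplex c V (\<one> # delete_at i vs)"
    let ?d = "par_boundary K G" and ?h = contraction
    note x = simplex_closed[OF c vs]
    have face: "simplex c V (delete_at i vs) \<in> carrier (P n)" "?y i \<in> carrier (P (Suc n))"
      "?h n (simplex c V (delete_at i vs)) = ?y i" if "i \<le> Suc n" for i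
      using is_simplex_delete_at[OF vs that] c
      by (simp_all add: simplex_closed contraction_simplex is_simplex_Cons_one)
    have "?h n (?d (Suc n) ?x) =
        (\<Oplus>\<^bsub>P (Suc n)\<^esub>i\<in>{..Suc n}. ?h n ([((-1 :: int) ^ i)] \<cdot>\<^bsub>P n\<^esub> simplex c V (delete_at i vs)))"
      unfolding par_boundary_simplex[OF c vs] using face
      by (intro additive_finsum[OF P.abelian_group P.abelian_group h]) auto
    also have "\<dots> = (\<Oplus>\<^bsub>P (Suc n)\<^esub>i\<in>{..Suc n}. [((-1 :: int) ^ i)] \<cdot>\<^bsub>P (Suc n)\<^esub> ?y i)"
      using face by (intro P.finsum_cong')
        (auto simp: additive_add_pow_int[OF P.abelian_group P.abelian_group h])
    finally have hd: "?h n (?d (Suc n) ?x) = \<dots>" .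
    let ?z = "\<Oplus>\<^bsub>P (Suc n)\<^esub>i\<in>{..Suc n}. [((-1 :: int) ^ Suc i)] \<cdot>\<^bsub>P (Suc n)\<^esub> ?y i"
    have z: "?z \<in> carrier (P (Suc n))" using face by (intro P.finsum_closed) auto
    have "?d (Suc (Suc n)) (?h (Suc n) ?x) = (\<Oplus>\<^bsub>P (Suc n)\<^esub>i\<in>{..Suc (Suc n)}.
        [((-1 :: int) ^ i)] \<cdot>\<^bsub>P (Suc n)\<^esub> simplex c V (delete_at i (\<one> # vs)))"
      by (simp only: contraction_simplex[OF c vs] par_boundary_simplex[OF c is_simplex_Cons_one[OF vs]])
    \<comment> \<open>Splits off the face \<open>i = 0\<close>, which removes the inserted vertex
      and returns the original simplex.\<close>
    also have "\<dots> = ?z \<oplus>\<^bsub>P (Suc n)\<^esub> ?x"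
      using simplex_closed[OF c is_simplex_delete_at[OF is_simplex_Cons_one[OF vs]]] x
      by (subst P.finsum_Suc2) (auto simp: P.add.int_pow_1)
    finally have dh: "?d (Suc (Suc n)) (?h (Suc n) ?x) = ?z \<oplus>\<^bsub>P (Suc n)\<^esub> ?x" .
    have "?d (Suc (Suc n)) (?h (Suc n) ?x) \<oplus>\<^bsub>P (Suc n)\<^esub> ?h n (?d (Suc n) ?x) =
        (?z \<oplus>\<^bsub>P (Suc n)\<^esub> ?h n (?d (Suc n) ?x)) \<oplus>\<^bsub>P (Suc n)\<^esub> ?x"
      unfolding dh using x z by (simp add: P.a_ac)
    also have "\<dots> = ?x"
      unfolding hd using P_finsum_neg_add[of "{..Suc n}" ?y "Suc n"] face x by simp
    finally have id: "?d (Suc (Suc n)) (?h (Suc n) ?x) \<oplus>\<^bsub>P (Suc n)\<^esub> ?h n (?d (Suc n) ?x) = ?x" .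
    have "?d (Suc (Suc n)) (?h (Suc n) (x \<oplus>\<^bsub>P (Suc n)\<^esub> ?x)) \<oplus>\<^bsub>P (Suc n)\<^esub>
          ?h n (?d (Suc n) (x \<oplus>\<^bsub>P (Suc n)\<^esub> ?x)) =
        (?d (Suc (Suc n)) (?h (Suc n) x) \<oplus>\<^bsub>P (Suc n)\<^esub> ?h n (?d (Suc n) x)) \<oplus>\<^bsub>P (Suc n)\<^esub>
        (?d (Suc (Suc n)) (?h (Suc n) ?x) \<oplus>\<^bsub>P (Suc n)\<^esub> ?h n (?d (Suc n) ?x))"
      using add.hyps(1) x by (simp add: additive_add[OF d] additive_add[OF h] P.a_ac)
    then show ?case using id add.IH by simp
  qed
qed

text \<open>The contraction in degree -1: \<open>(V, 1)\<close> is read as the one-vertex simplex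
  \<open>1\<close> on \<open>V\<close>, so again the vertex \<open>1\<close> is inserted, now into
  the empty list.\<close>

definition augmentation_section :: "('g list set \<Rightarrow> 'k) \<Rightarrow> 'g list \<Rightarrow> 'g list set \<Rightarrow> 'k" where
  "augmentation_section b = direct_sum_single (tuples G 0) Q [] b"

lemma nil_tuples [simp]: "[] \<in> tuples G 0"
  by (simp add: tuples_def)

lemma basis_nil_iff: "(s, []) \<in> par_basis G 0 \<longleftrightarrow> s \<in> carrier S"
  by (auto simp: par_basis_iff par_supp_props)

lemma B_subset_Q: "b \<in> carrier B \<Longrightarrow> b \<in> carrier (Q [])"
  using free_carrier_mono[of "idempotents S" "{s. (s, []) \<in> par_basis G 0}" K]
  by (auto simp: carrier_Q[OF nil_tuples] par_B_simps basis_nil_iff idempotents_par_monoid)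

lemma augmentation_section_additive: "augmentation_section \<in> hom (add_monoid B) (add_monoid (P 0))"
proof (rule homI; simp)
  fix b assume "b \<in> carrier B"
  then show "augmentation_section b \<in> carrier (P 0)"
    unfolding augmentation_section_def par_P_eq by (intro family.single_closed B_subset_Q) simp
next
  fix b b' assume "b \<in> carrier B" "b' \<in> carrier B"
  then show "augmentation_section (b \<oplus>\<^bsub>B\<^esub> b') = augmentation_section b \<oplus>\<^bsub>P 0\<^esub> augmentation_section b'"
    using family.single_add[OF nil_tuples B_subset_Q B_subset_Q, of b b']
    by (simp add: augmentation_section_def par_P_eq par_algebra_simps par_B_simps)
qed

lemma augmentation_section_monomial:
  "augmentation_section (monomial K c e) = par_mono K G c e []"
  by (simp add: augmentation_section_def par_mono_eq_single[OF nil_tuples])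

lemma augmentation_section_id:
  assumes "b \<in> carrier B"
  shows "par_boundary0 K G (augmentation_section b) = b"
proof -
  note d = left_module_hom_additive[OF par_boundary0_hom] and h = augmentation_section_additive
  show ?thesis
    using assms[unfolded par_B_simps]
  proof (induction b rule: K.free_carrier_induct)
    case zero
    show ?case
      using additive_zero[OF P.abelian_group B.abelian_group d] additive_zero[OF B.abelian_group P.abelian_group h]
      by (simp add: par_B_simps)
  next
    case (add f c e)
    then have e: "e \<in> carrier S" "par_deg G e = \<one>" by (simp_all add: idempotents_par_monoid)
    have f: "f \<in> carrier B" and m: "monomial K c e \<in> carrier B"
      using add.hyps e by (simp_all add: par_B_simps K.monomial_in_free_carrier)
    have "e \<otimes>\<^bsub>S\<^esub> semigroup_inv S e = e"
      using e by (intro par_monoid_eqI) (simp_all add: mult_semigroup_inv)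
    then have "par_boundary0 K G (augmentation_section (monomial K c e)) = monomial K c e"
      using add.hyps e by (simp add: augmentation_section_monomial par_boundary0_mono basis_nil_iff)
    then have "par_boundary0 K G (augmentation_section (f \<oplus>\<^bsub>B\<^esub> monomial K c e)) = f \<oplus>\<^bsub>B\<^esub> monomial K c e"
      using f m add.IH additive_closed[OF h]
      by (simp add: additive_add[OF h] additive_add[OF d])
    then show ?case by (simp add: par_B_simps)
  qed
qed

text \<open>For a single vertex \<open>v\<close> the boundary of \<open>(1, v)\<close> is
  \<open>v - 1\<close>, and the section restores the vertex \<open>1\<close> that the augmentation
  leaves of \<open>v\<close>.\<close>

lemma contraction_id_0:
  assumes "x \<in> carrier (P 0)"
  shows "par_boundary K G (Suc 0) (contraction 0 x) \<oplus>\<^bsub>P 0\<^esub> augmentation_section (par_boundary0 K G x) = x"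
proof -
  note d0 = left_module_hom_additive[OF par_boundary0_hom] and hB = augmentation_section_additive
    and d = left_module_hom_additive[OF par_boundary_hom[of 0]] and h = contraction_additive[of 0]
  note [simp] = additive_closed[OF d] additive_closed[OF h] additive_closed[OF d0] additive_closed[OF hB]
  show ?thesis
    using assms
  proof (induction x rule: simplex_induct)
    case zero
    show ?case
      by (simp add: additive_zero[OF P.abelian_group P.abelian_group d]
          additive_zero[OF P.abelian_group P.abelian_group h]
          additive_zero[OF P.abelian_group B.abelian_group d0]
          additive_zero[OF B.abelian_group P.abelian_group hB])
  next
    case (add x c V vs)
    note vs = \<open>is_simplex 0 V vs\<close> and c = \<open>c \<in> carrier K\<close>
    obtain v where v: "vs = [v]" using vs by (auto simp: is_simplex_def length_Suc_conv)
    let ?x = "simplex c V vs" and ?y = "simplex c V [\<one>]"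
    let ?f = "\<lambda>x. par_boundary K G (Suc 0) (contraction 0 x) \<oplus>\<^bsub>P 0\<^esub> augmentation_section (par_boundary0 K G x)"
    note x = simplex_closed[OF c vs] and s = is_simplex_par_of[OF vs]
    have one: "is_simplex 0 V [\<one>]" using vs by (simp add: is_simplex_def)
    note y = simplex_closed[OF c one]
    have "par_boundary K G (Suc 0) (contraction 0 ?x) = (\<Oplus>\<^bsub>P 0\<^esub>i\<in>{..Suc 0}.
        [((-1 :: int) ^ i)] \<cdot>\<^bsub>P 0\<^esub> simplex c V (delete_at i (\<one> # vs)))"
      by (simp only: contraction_simplex[OF c vs] par_boundary_simplex[OF c is_simplex_Cons_one[OF vs]])
    also have "\<dots> = (\<ominus>\<^bsub>P 0\<^esub> ?y) \<oplus>\<^bsub>P 0\<^esub> ?x"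
      using simplex_closed[OF c is_simplex_delete_at[OF is_simplex_Cons_one[OF vs]]] x y
      by (subst P.finsum_Suc2) (auto simp: P.add.int_pow_1 P.add.int_pow_neg v delete_at_def)
    finally have 1: "par_boundary K G (Suc 0) (contraction 0 ?x) = (\<ominus>\<^bsub>P 0\<^esub> ?y) \<oplus>\<^bsub>P 0\<^esub> ?x" .
    \<comment> \<open>The augmentation forgets the degree and keeps the support, so the result is
      the same for every vertex of \<open>V\<close>.\<close>
    have "par_of V \<one> = par_of V v \<otimes>\<^bsub>S\<^esub> semigroup_inv S (par_of V v)"
      using s by (intro par_of_eqI) (simp_all add: mult_semigroup_inv v)
    then have 2: "augmentation_section (par_boundary0 K G ?x) = ?y"
      using c s by (simp add: simplex_def v par_boundary0_mono basis_nil_iff augmentation_section_monomial)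
    have "?f ?x = ?x"
      unfolding 1 2 using x y by (simp add: P.a_assoc P.a_comm[of ?x] P.r_neg1 P.l_neg P.a_assoc[symmetric])
    moreover have "?f (x \<oplus>\<^bsub>P 0\<^esub> ?x) = ?f x \<oplus>\<^bsub>P 0\<^esub> ?f ?x"
      using add.hyps(1) x
      by (simp add: additive_add[OF d] additive_add[OF h] additive_add[OF d0] additive_add[OF hB] P.a_ac)
    ultimately show ?case using add.IH by simp
  qed
qed


text \<open>Supplies the generation property behind \<open>d d = 0\<close>: each basis element of
  positive degree is an algebra multiple of a contraction, although the first vertex of a
  contraction is always \<open>1\<close>.\<close>

lemma par_mono_smult_contraction:
  assumes c: "c \<in> carrier K" and b: "(s, gs) \<in> par_basis G (Suc n)"
  obtains y where "y \<in> carrier (P n)"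
    "par_mono K G c s gs = monomial K c s \<odot>\<^bsub>P (Suc n)\<^esub> contraction n y"
proof -
  obtain g hs where gs: "gs = g # hs" using b by (auto simp: par_basis_iff tuples_def length_Suc_conv)
  have car: "s \<in> carrier S" "g \<in> carrier G" "hs \<in> lists (carrier G)" "length hs = n"
    "s \<otimes>\<^bsub>S\<^esub> par_e_tuple G gs = s" "gs \<in> tuples G (Suc n)"
    using b by (auto simp: par_basis_iff_mult tuples_def gs)
  \<comment> \<open>Chosen as \<open>(W, g)\<close> with \<open>W\<close> the vertices of
    \<open>gs\<close>, starting from \<open>1\<close>. The contraction of \<open>?t\<close> with
    tuple \<open>hs\<close> is then the idempotent of \<open>gs\<close> in its own summand, and
    \<open>s\<close> absorbs that idempotent.\<close>
  let ?t = "par_e_tuple G gs \<otimes>\<^bsub>S\<^esub> par_gen G g"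
  have gsl: "gs \<in> lists (carrier G)" using car gs by simp
  have g: "g \<in> set (prefix_prods G gs)"
    using one_in_prefix_prods[of hs] car by (force simp: gs image_iff)
  have t: "?t \<in> carrier S" "par_deg G ?t = g" "par_supp G ?t = set (prefix_prods G gs)"
    using car gsl g one_in_prefix_prods[of gs]
    by (auto simp: par_deg_mult par_supp_mult par_deg_e_tuple par_supp_e_tuple par_supp_deg_gen)
  have tb: "(?t, hs) \<in> par_basis G n"
    using t car by (auto simp: par_basis_iff tuples_def gs)
  have "contraction n (par_mono K G \<one>\<^bsub>K\<^esub> ?t hs) =
      monomial K \<one>\<^bsub>K\<^esub> \<one>\<^bsub>S\<^esub> \<odot>\<^bsub>P (Suc n)\<^esub> par_elem K G (?t \<otimes>\<^bsub>S\<^esub> semigroup_inv S ?t) (par_deg G ?t # hs)"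
    unfolding contraction_def
    by (rule par_linear_ext_mono[OF P.left_module_axioms tb _ K.one_closed]) (rule contraction_term_closed[OF tb])
  also have "\<dots> = par_elem K G (?t \<otimes>\<^bsub>S\<^esub> semigroup_inv S ?t) gs"
    using P.smult_one[OF contraction_term_closed[OF tb]] t(2) by (simp add: par_algebra_simps gs)
  also have "?t \<otimes>\<^bsub>S\<^esub> semigroup_inv S ?t = par_e_tuple G gs"
    using t gsl by (intro par_monoid_eqI) (simp_all add: mult_semigroup_inv par_supp_e_tuple par_deg_e_tuple)
  finally have "monomial K c s \<odot>\<^bsub>P (Suc n)\<^esub> contraction n (par_mono K G \<one>\<^bsub>K\<^esub> ?t hs) = par_mono K G c s gs"
    using c car gsl by (simp add: par_elem_smult)
  with that par_mono_closed[OF _ tb, of "\<one>\<^bsub>K\<^esub>"] show ?thesis by simp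
qed

theorem projective_resolution_par_B:
  "projective_resolution TYPE('m) TYPE('n) A P (par_boundary K G) (par_boundary0 K G) B"
proof (rule projective_resolution_from_homotopy[where hB = augmentation_section and h = contraction])
  fix n and R :: "('g list \<Rightarrow> 'g list set \<Rightarrow> 'k) \<Rightarrow> bool" and y
  assume zero: "R \<zero>\<^bsub>P (Suc n)\<^esub>"
    and step: "\<And>y a x. \<lbrakk>R y; y \<in> carrier (P (Suc n)); a \<in> carrier A; x \<in> carrier (P n)\<rbrakk> \<Longrightarrow>
      R (y \<oplus>\<^bsub>P (Suc n)\<^esub> a \<odot>\<^bsub>P (Suc n)\<^esub> contraction n x)"
    and "y \<in> carrier (P (Suc n))"
  from this(3) show "R y"
  proof (induction y rule: par_P_induct)
    case (add x c s gs)
    \<comment> \<open>Adding a basis element is an instance of \<open>step\<close>, so induction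
      over the basis gives generation over the algebra.\<close>
    obtain y where "y \<in> carrier (P n)" "par_mono K G c s gs = monomial K c s \<odot>\<^bsub>P (Suc n)\<^esub> contraction n y"
      using par_mono_smult_contraction[OF add.hyps(2,3)] .
    then show ?case
      using step[OF add.IH add.hyps(1)] add.hyps by (simp add: par_basis_iff)
  qed (rule zero)
qed (rule B.left_module_axioms projective_par_P par_boundary0_hom par_boundary_hom
    augmentation_section_additive contraction_additive augmentation_section_id contraction_id_0
    contraction_id_Suc; assumption?)+

end

theorem proposition2p14:
  fixes K :: "('k, 'c) ring_scheme" and G :: "('g, 'd) monoid_scheme"
  assumes "cring K" and "group G"
  shows "projective_resolution TYPE('m) TYPE('n) (par_algebra K G)
    (par_P K G) (par_boundary K G) (par_boundary0 K G) (par_B K G)"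
proof -
  interpret partial_group_algebra K G
    using assms by (rule partial_group_algebra.intro)
  show ?thesis by (rule projective_resolution_par_B)
qed

end
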